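(* Let $(M,\omega)$ be a symplectic manifold admitting a metaplectic structure $(\pi_P,\Lambda)$. The bundle of measurements $\mathcal{CH}=\mathcal{P}\times_\rho CH\to M$ and the product bundle $M\times CH\to M$ are isomorphic as Banach bundles. Consequently, the bundle of measurements is trivial.
   Context: $(V,\omega_0)$ is a real symplectic vector space of dimension $2n=\dim M$, $n\ge 1$; $G=Sp(V,\omega_0)$; $\lambda:\widetilde G\to G$ is its connected double cover (metaplectic group). $L\subset V$ is a Lagrangian subspace and $\check H=L^2(L)$ (complex valued). $\check\sigma:\widetilde G\to U(\check H)$ is a fixed Segal--Shale--Weil representation: the strongly continuous unitary representation with $\check\sigma(g)r(v,t)\check\sigma(g)^{-1}=r(\lambda(g)v,t)$, where $r$ is the Schrödinger representation of the Heisenberg group $V\times\mathbb{R}$ on $L^2(L)$. $CH$ is the $C^*$-algebra of compact operators on $\check H$ with the operator norm, and $\rho:\widetilde G\to\mathrm{Aut}(CH)$ is $\rho(g)a=\check\sigma(g)\circ a\circ\check\sigma(g)^{-1}$. $\mathcal{Q}\to M$ is the principal $G$-bundle of symplectic frames: linear maps $A:V\to T_mM$ with $\omega_m(Au,Av)=\omega_0(u,v)$, and right action $A\mapsto A\circ g$. A metaplectic structure is a pair $(\pi_P,\Lambda)$ of a principal $\widetilde G$-bundle $\pi_P:\mathcal{P}\to M$ and a smooth map $\Lambda:\mathcal{P}\to\mathcal{Q}$ over $\mathrm{Id}_M$ with $\Lambda(rg)=\Lambda(r)\lambda(g)$. $\mathcal{CH}$ is the quotient of $\mathcal{P}\times CH$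 by $(r,a)\sim(rg^{-1},\rho(g)a)$, with the quotient topology and with fiberwise norm $\|[(r,a)]\|=\|a\|_{CH}$. An isomorphism of Banach bundles over $M$ is a homeomorphism of total spaces covering $\mathrm{Id}_M$ which is a linear isometry on each fiber. *)

theory Defs
  imports "HOL-Analysis.Analysis" "HOL-Algebra.Group"
begin

section \<open>Smooth maps and smooth atlases\<close>

text \<open>
  The notions below are only used for finite-dimensional \<open>'a\<close>; there \<open>Ck_on k f S\<close>, for open \<open>S\<close>,
  says that \<open>f\<close> is \<open>k\<close> times continuously differentiable on \<open>S\<close>.
\<close>

primrec Ck_on :: "nat \<Rightarrow> ('a::real_normed_vector \<Rightarrow> 'b::real_normed_vector) \<Rightarrow> 'a set \<Rightarrow> bool" where
  "Ck_on 0 f S \<longleftrightarrow> continuous_on S f"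
| "Ck_on (Suc k) f S \<longleftrightarrow> (\<forall>x\<in>S. f differentiable (at x)) \<and>
     (\<forall>v. Ck_on k (\<lambda>x. frechet_derivative f (at x) v) S)"

text \<open>
  Smoothness on an arbitrary subset, by local smooth extension. On an embedded submanifold such as
  the symplectic group in the space of endomorphisms this is the usual smoothness.
\<close>

definition smooth_on :: "'a::real_normed_vector set \<Rightarrow> ('a \<Rightarrow> 'b::real_normed_vector) \<Rightarrow> bool" where
  "smooth_on S f \<longleftrightarrow> (\<forall>x\<in>S. \<exists>N F. open N \<and> x \<in> N \<and> (\<forall>k. Ck_on k F N) \<and> (\<forall>y\<in>S \<inter> N. F y = f y))"

type_synonym ('a, 'e) chart = "'a set \<times> ('a \<Rightarrow> 'e)"

definition chart_inv :: "('a, 'e) chart \<Rightarrow> 'e \<Rightarrow> 'a" where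
  "chart_inv c = inv_into (fst c) (snd c)"

definition transition :: "('a, 'e) chart \<Rightarrow> ('a, 'e) chart \<Rightarrow> 'e \<Rightarrow> 'e" where
  "transition c d = snd d \<circ> chart_inv c"

definition smooth_atlas :: "('a::topological_space, 'e::euclidean_space) chart set \<Rightarrow> bool" where
  "smooth_atlas A \<longleftrightarrow>
     (\<Union>c\<in>A. fst c) = UNIV \<and>
     (\<forall>c\<in>A. open (fst c) \<and> open (snd c ` fst c) \<and>
        homeomorphism (fst c) (snd c ` fst c) (snd c) (chart_inv c)) \<and>
     (\<forall>c\<in>A. \<forall>d\<in>A. smooth_on (snd c ` (fst c \<inter> fst d)) (transition c d))"

text \<open>
  Neighbourhoods \<open>N\<close> are needed because atlases are not assumed maximal. Continuity of \<open>f\<close> for the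
  topology determined by the charts in \<open>B\<close> is part of the condition. The images of the charts may be
  embedded submanifolds of the model spaces instead of open subsets.
\<close>

definition smooth_map_on ::
  "('a::topological_space, 'e::real_normed_vector) chart set \<Rightarrow>
   ('b, 'f::real_normed_vector) chart set \<Rightarrow> 'a set \<Rightarrow> ('a \<Rightarrow> 'b) \<Rightarrow> bool" where
  "smooth_map_on A B S f \<longleftrightarrow>
     (\<forall>x\<in>S. \<exists>c\<in>A. \<exists>d\<in>B. \<exists>N. open N \<and> x \<in> N \<and> N \<subseteq> fst c \<and> f ` (N \<inter> S) \<subseteq> fst d \<and>
        smooth_on (snd c ` (N \<inter> S)) (snd d \<circ> f \<circ> chart_inv c))"

definition prod_atlas :: "('a, 'e) chart set \<Rightarrow> ('b, 'f) chart set \<Rightarrow> ('a \<times> 'b, 'e \<times> 'f) chart set" where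
  "prod_atlas A B = {(fst c \<times> fst d, map_prod (snd c) (snd d)) |c d. c \<in> A \<and> d \<in> B}"


section \<open>Tangent spaces and symplectic manifolds\<close>

text \<open>
  A tangent vector at \<open>m\<close> is a family of coordinate vectors, one for each chart around \<open>m\<close>, that
  transforms with the derivatives of the transition maps. The value is \<open>0\<close> at irrelevant charts.
  Vector space operations are pointwise.
\<close>

type_synonym ('m, 'v) tvec = "('m, 'v) chart \<Rightarrow> 'v"

definition tangent_space :: "('m, 'v::euclidean_space) chart set \<Rightarrow> 'm \<Rightarrow> ('m, 'v) tvec set" where
  "tangent_space A m = {X.
     (\<forall>c\<in>A. \<forall>d\<in>A. m \<in> fst c \<longrightarrow> m \<in> fst d \<longrightarrow>
        X d = frechet_derivative (transition c d) (at (snd c m)) (X c)) \<and>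
     (\<forall>c. \<not> (c \<in> A \<and> m \<in> fst c) \<longrightarrow> X c = 0)}"

text \<open>The tangent vector at \<open>m\<close> with coordinate vector \<open>u\<close> in the chart \<open>c\<close>.\<close>

definition coord_vec ::
  "('m, 'v::euclidean_space) chart set \<Rightarrow> ('m, 'v) chart \<Rightarrow> 'm \<Rightarrow> 'v \<Rightarrow> ('m, 'v) tvec" where
  "coord_vec A c m u = (\<lambda>d. if d \<in> A \<and> m \<in> fst d
     then frechet_derivative (transition c d) (at (snd c m)) u else 0)"

definition coord_form ::
  "('m, 'v::euclidean_space) chart set \<Rightarrow> ('m \<Rightarrow> ('m, 'v) tvec \<Rightarrow> ('m, 'v) tvec \<Rightarrow> real) \<Rightarrow>
   ('m, 'v) chart \<Rightarrow> 'v \<Rightarrow> 'v \<Rightarrow> 'v \<Rightarrow> real" where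
  "coord_form A \<omega> c u w x =
     (let m = chart_inv c x in \<omega> m (coord_vec A c m u) (coord_vec A c m w))"

text \<open>
  The last clause is \<open>d\<omega> = 0\<close>, evaluated on the coordinate vector fields with constant coefficients
  \<open>u\<close>, \<open>v\<close>, \<open>w\<close>. Antisymmetry turns linearity in the first argument into bilinearity.
\<close>

definition symplectic_form ::
  "('m, 'v::euclidean_space) chart set \<Rightarrow> ('m \<Rightarrow> ('m, 'v) tvec \<Rightarrow> ('m, 'v) tvec \<Rightarrow> real) \<Rightarrow> bool" where
  "symplectic_form A \<omega> \<longleftrightarrow>
     (\<forall>m. \<forall>X\<in>tangent_space A m. \<forall>Y\<in>tangent_space A m.
        \<omega> m Y X = - \<omega> m X Y \<and>
        (\<forall>Z\<in>tangent_space A m. \<forall>a b.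
           \<omega> m (\<lambda>c. a *\<^sub>R X c + b *\<^sub>R Z c) Y = a * \<omega> m X Y + b * \<omega> m Z Y)) \<and>
     (\<forall>m. \<forall>X\<in>tangent_space A m.
        (\<forall>Y\<in>tangent_space A m. \<omega> m X Y = 0) \<longrightarrow> X = (\<lambda>c. 0)) \<and>
     (\<forall>c\<in>A. \<forall>u w. smooth_on (snd c ` fst c) (coord_form A \<omega> c u w)) \<and>
     (\<forall>c\<in>A. \<forall>x\<in>snd c ` fst c. \<forall>u v w.
        frechet_derivative (coord_form A \<omega> c v w) (at x) u +
        frechet_derivative (coord_form A \<omega> c w u) (at x) v +
        frechet_derivative (coord_form A \<omega> c u v) (at x) w = 0)"

definition symplectic_manifold ::
  "('m::{t2_space, second_countable_topology}, 'v::euclidean_space) chart set \<Rightarrow>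
   ('m \<Rightarrow> ('m, 'v) tvec \<Rightarrow> ('m, 'v) tvec \<Rightarrow> real) \<Rightarrow> bool" where
  "symplectic_manifold A \<omega> \<longleftrightarrow> smooth_atlas A \<and> symplectic_form A \<omega>"


section \<open>Symplectic vector spaces and the metaplectic group\<close>

definition symplectic_space :: "('v::euclidean_space \<Rightarrow> 'v \<Rightarrow> real) \<Rightarrow> bool" where
  "symplectic_space \<omega>0 \<longleftrightarrow>
     bilinear \<omega>0 \<and> (\<forall>v. \<omega>0 v v = 0) \<and> (\<forall>u. (\<forall>v. \<omega>0 u v = 0) \<longrightarrow> u = 0)"

definition lagrangian :: "('v::euclidean_space \<Rightarrow> 'v \<Rightarrow> real) \<Rightarrow> 'v set \<Rightarrow> bool" where
  "lagrangian \<omega>0 L \<longleftrightarrow> subspace L \<and> L = {v. \<forall>l\<in>L. \<omega>0 v l = 0}"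

definition Sp :: "('v::euclidean_space \<Rightarrow> 'v \<Rightarrow> real) \<Rightarrow> ('v \<Rightarrow>\<^sub>L 'v) monoid" where
  "Sp \<omega>0 = \<lparr>carrier = {A :: 'v \<Rightarrow>\<^sub>L 'v. \<forall>u v. \<omega>0 (A u) (A v) = \<omega>0 u v}, mult = (o\<^sub>L), one = id_blinfun\<rparr>"

definition topological_group :: "('g::topological_space) monoid \<Rightarrow> bool" where
  "topological_group G \<longleftrightarrow> group G \<and> carrier G = UNIV \<and>
     continuous_on UNIV (\<lambda>(g, h). g \<otimes>\<^bsub>G\<^esub> h) \<and> continuous_on UNIV (\<lambda>g. inv\<^bsub>G\<^esub> g)"

definition connected_double_cover ::
  "('v::euclidean_space \<Rightarrow> 'v \<Rightarrow> real) \<Rightarrow> ('g::topological_space) monoid \<Rightarrow> ('g \<Rightarrow> 'v \<Rightarrow>\<^sub>L 'v) \<Rightarrow> bool" where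
  "connected_double_cover \<omega>0 G lam \<longleftrightarrow>
     topological_group G \<and> connected (UNIV :: 'g set) \<and> lam \<in> hom G (Sp \<omega>0) \<and>
     covering_space UNIV lam (carrier (Sp \<omega>0)) \<and>
     (\<forall>A\<in>carrier (Sp \<omega>0). card {g. lam g = A} = 2)"

text \<open>
  The smooth structure of the covering group: the unique one for which \<open>lam\<close> is a local
  diffeomorphism onto the symplectic group. The chart images are open in the symplectic group,
  an embedded submanifold of the space of endomorphisms.
\<close>

definition cover_atlas :: "('g::topological_space \<Rightarrow> 'e) \<Rightarrow> ('g, 'e) chart set" where
  "cover_atlas lam = {(W, lam) |W. open W \<and> inj_on lam W}"


section \<open>Symplectic frames and metaplectic structures\<close>

definition frames ::
  "('m, 'v::euclidean_space) chart set \<Rightarrow> ('m \<Rightarrow> ('m, 'v) tvec \<Rightarrow> ('m, 'v) tvec \<Rightarrow> real) \<Rightarrow>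
   ('v \<Rightarrow> 'v \<Rightarrow> real) \<Rightarrow> ('m \<times> ('v \<Rightarrow> ('m, 'v) tvec)) set" where
  "frames A \<omega> \<omega>0 = {(m, F).
     (\<forall>u. F u \<in> tangent_space A m) \<and>
     (\<forall>a b u w. F (a *\<^sub>R u + b *\<^sub>R w) = (\<lambda>c. a *\<^sub>R F u c + b *\<^sub>R F w c)) \<and>
     (\<forall>u w. \<omega> m (F u) (F w) = \<omega>0 u w)}"

text \<open>
  The smooth structure of the bundle of symplectic frames, as an embedded submanifold of the bundle
  of linear maps from \<open>'v\<close> to the tangent spaces: a frame has as coordinates the coordinates of its
  base point and its matrix in the chart.
\<close>

definition frame_atlas ::
  "('m, 'v::euclidean_space) chart set \<Rightarrow> ('m \<Rightarrow> ('m, 'v) tvec \<Rightarrow> ('m, 'v) tvec \<Rightarrow> real) \<Rightarrow>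
   ('v \<Rightarrow> 'v \<Rightarrow> real) \<Rightarrow> ('m \<times> ('v \<Rightarrow> ('m, 'v) tvec), 'v \<times> ('v \<Rightarrow>\<^sub>L 'v)) chart set" where
  "frame_atlas A \<omega> \<omega>0 =
     {({q \<in> frames A \<omega> \<omega>0. fst q \<in> fst c}, \<lambda>(m, F). (snd c m, Blinfun (\<lambda>u. F u c))) |c. c \<in> A}"

text \<open>Principal bundle over the manifold with atlas \<open>A\<close>, whose structure group has atlas \<open>AG\<close>.\<close>

definition principal_bundle ::
  "('m::{t2_space, second_countable_topology}, 'v::euclidean_space) chart set \<Rightarrow>
   ('g::topological_space) monoid \<Rightarrow> ('g, 'f::real_normed_vector) chart set \<Rightarrow>
   ('p::{t2_space, second_countable_topology}, 'e::euclidean_space) chart set \<Rightarrow>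
   ('p \<Rightarrow> 'm) \<Rightarrow> ('p \<Rightarrow> 'g \<Rightarrow> 'p) \<Rightarrow> bool" where
  "principal_bundle A G AG AP \<pi> act \<longleftrightarrow>
     smooth_atlas AP \<and>
     smooth_map_on AP A UNIV \<pi> \<and> surj \<pi> \<and>
     smooth_map_on (prod_atlas AP AG) AP UNIV (\<lambda>(r, g). act r g) \<and>
     (\<forall>r. act r \<one>\<^bsub>G\<^esub> = r) \<and>
     (\<forall>r g h. act (act r g) h = act r (g \<otimes>\<^bsub>G\<^esub> h)) \<and>
     (\<forall>r g. \<pi> (act r g) = \<pi> r) \<and>
     (\<forall>m. \<exists>U \<tau>. open U \<and> m \<in> U \<and>
        bij_betw \<tau> (\<pi> -` U) (U \<times> UNIV) \<and>
        smooth_map_on AP (prod_atlas A AG) (\<pi> -` U) \<tau> \<and>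
        smooth_map_on (prod_atlas A AG) AP (U \<times> UNIV) (inv_into (\<pi> -` U) \<tau>) \<and>
        (\<forall>r\<in>\<pi> -` U. fst (\<tau> r) = \<pi> r \<and>
           (\<forall>g. \<tau> (act r g) = (\<pi> r, snd (\<tau> r) \<otimes>\<^bsub>G\<^esub> g))))"

definition metaplectic_structure ::
  "('m::{t2_space, second_countable_topology}, 'v::euclidean_space) chart set \<Rightarrow>
   ('m \<Rightarrow> ('m, 'v) tvec \<Rightarrow> ('m, 'v) tvec \<Rightarrow> real) \<Rightarrow> ('v \<Rightarrow> 'v \<Rightarrow> real) \<Rightarrow>
   ('g::topological_space) monoid \<Rightarrow> ('g \<Rightarrow> 'v \<Rightarrow>\<^sub>L 'v) \<Rightarrow>
   ('p::{t2_space, second_countable_topology}, 'e::euclidean_space) chart set \<Rightarrow>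
   ('p \<Rightarrow> 'm) \<Rightarrow> ('p \<Rightarrow> 'g \<Rightarrow> 'p) \<Rightarrow> ('p \<Rightarrow> 'm \<times> ('v \<Rightarrow> ('m, 'v) tvec)) \<Rightarrow> bool" where
  "metaplectic_structure A \<omega> \<omega>0 G lam AP \<pi> act \<Lambda> \<longleftrightarrow>
     principal_bundle A G (cover_atlas lam) AP \<pi> act \<and>
     (\<forall>r. \<Lambda> r \<in> frames A \<omega> \<omega>0 \<and> fst (\<Lambda> r) = \<pi> r) \<and>
     smooth_map_on AP (frame_atlas A \<omega> \<omega>0) UNIV \<Lambda> \<and>
     (\<forall>r g. \<Lambda> (act r g) = (\<pi> r, snd (\<Lambda> r) \<circ> blinfun_apply (lam g)))"


section \<open>The Hilbert space of square integrable functions\<close>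

definition square_integrable :: "('a::euclidean_space \<Rightarrow> complex) \<Rightarrow> bool" where
  "square_integrable f \<longleftrightarrow>
     f \<in> borel_measurable lborel \<and> integrable lborel (\<lambda>x. (cmod (f x))\<^sup>2)"

definition l2_rel :: "('a::euclidean_space \<Rightarrow> complex) \<Rightarrow> ('a \<Rightarrow> complex) \<Rightarrow> bool" where
  "l2_rel f g \<longleftrightarrow> square_integrable f \<and> square_integrable g \<and> (AE x in lborel. f x = g x)"

lemma part_equivp_l2_rel: "part_equivp (l2_rel :: ('a::euclidean_space \<Rightarrow> complex) \<Rightarrow> _)"
proof (rule part_equivpI)
  show "\<exists>f :: 'a \<Rightarrow> complex. l2_rel f f"
    by (rule exI[of _ "\<lambda>_. 0"]) (simp add: l2_rel_def square_integrable_def)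
  show "symp (l2_rel :: ('a \<Rightarrow> complex) \<Rightarrow> _)"
    unfolding symp_def l2_rel_def by (simp add: eq_commute)
  show "transp (l2_rel :: ('a \<Rightarrow> complex) \<Rightarrow> _)"
    unfolding transp_def l2_rel_def
  proof (intro allI impI, elim conjE, intro conjI)
    fix f g h :: "'a \<Rightarrow> complex"
    assume "AE x in lborel. f x = g x" "AE x in lborel. g x = h x"
    then show "AE x in lborel. f x = h x" by eventually_elim simp
  qed
qed

quotient_type (overloaded) 'a l2 = "'a::euclidean_space \<Rightarrow> complex" / partial: l2_rel
  by (rule part_equivp_l2_rel)

lemma square_integrable_0: "square_integrable (\<lambda>_. 0)"
  by (simp add: square_integrable_def)

lemma square_integrable_add:
  assumes "square_integrable f" "square_integrable g"
  shows "square_integrable (\<lambda>x. f x + g x)"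
proof -
  have m: "f \<in> borel_measurable lborel" "g \<in> borel_measurable lborel"
    and i: "integrable lborel (\<lambda>x. (cmod (f x))\<^sup>2)" "integrable lborel (\<lambda>x. (cmod (g x))\<^sup>2)"
    using assms by (auto simp: square_integrable_def)
  have "(cmod (f x + g x))\<^sup>2 \<le> 2 * (cmod (f x))\<^sup>2 + 2 * (cmod (g x))\<^sup>2" for x
  proof -
    have "(cmod (f x + g x))\<^sup>2 \<le> (cmod (f x) + cmod (g x))\<^sup>2"
      by (simp add: norm_triangle_ineq power_mono)
    also have "\<dots> \<le> 2 * (cmod (f x))\<^sup>2 + 2 * (cmod (g x))\<^sup>2"
      using zero_le_power2[of "cmod (f x) - cmod (g x)"]
      by (simp add: power2_eq_square algebra_simps)
    finally show ?thesis .
  qed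
  then have bound: "norm ((cmod (f x + g x))\<^sup>2) \<le> norm (2 * (cmod (f x))\<^sup>2 + 2 * (cmod (g x))\<^sup>2)" for x
    by simp
  have int: "integrable lborel (\<lambda>x. 2 * (cmod (f x))\<^sup>2 + 2 * (cmod (g x))\<^sup>2)"
    using i by simp
  have "(\<lambda>x. (cmod (f x + g x))\<^sup>2) \<in> borel_measurable lborel"
    using m by measurable
  then have "integrable lborel (\<lambda>x. (cmod (f x + g x))\<^sup>2)"
    by (rule Bochner_Integration.integrable_bound[OF int _ AE_I2[OF bound]])
  then show ?thesis using m by (simp add: square_integrable_def)
qed

lemma square_integrable_scale:
  assumes "square_integrable f"
  shows "square_integrable (\<lambda>x. c * f x)"
  using assms by (auto simp: square_integrable_def norm_mult power_mult_distrib)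

lemma integrable_cnj_mult:
  assumes "square_integrable f" "square_integrable g"
  shows "integrable lborel (\<lambda>x. cnj (f x) * g x)"
proof -
  have m: "f \<in> borel_measurable lborel" "g \<in> borel_measurable lborel"
    and i: "integrable lborel (\<lambda>x. (cmod (f x))\<^sup>2)" "integrable lborel (\<lambda>x. (cmod (g x))\<^sup>2)"
    using assms by (auto simp: square_integrable_def)
  have b: "cmod (f x) * cmod (g x) \<le> (cmod (f x))\<^sup>2 + (cmod (g x))\<^sup>2" for x
  proof -
    have "2 * (cmod (f x) * cmod (g x)) \<le> (cmod (f x))\<^sup>2 + (cmod (g x))\<^sup>2"
      using zero_le_power2[of "cmod (f x) - cmod (g x)"]
      by (simp add: power2_eq_square algebra_simps)
    moreover have "0 \<le> cmod (f x) * cmod (g x)" by simp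
    ultimately show ?thesis by linarith
  qed
  have "(\<lambda>x. cnj (f x)) \<in> borel_measurable lborel"
    using m(1) by (rule borel_measurable_continuous_on[rotated]) (intro continuous_intros)
  then have meas: "(\<lambda>x. cnj (f x) * g x) \<in> borel_measurable lborel"
    using m(2) by (rule borel_measurable_times)
  have bound: "norm (cnj (f x) * g x) \<le> norm ((cmod (f x))\<^sup>2 + (cmod (g x))\<^sup>2)" for x
    using b[of x] by (simp add: norm_mult)
  have int: "integrable lborel (\<lambda>x. (cmod (f x))\<^sup>2 + (cmod (g x))\<^sup>2)"
    using i by simp
  show ?thesis
    by (rule Bochner_Integration.integrable_bound[OF int meas AE_I2[OF bound]])
qed

lift_definition cscale :: "complex \<Rightarrow> 'a::euclidean_space l2 \<Rightarrow> 'a l2" is "\<lambda>c f x. c * f x"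
  by (auto simp: l2_rel_def square_integrable_scale)

lift_definition cinner :: "'a::euclidean_space l2 \<Rightarrow> 'a l2 \<Rightarrow> complex"
  is "\<lambda>f g. \<integral>x. cnj (f x) * g x \<partial>lborel"
proof -
  fix f f' g g' :: "'a \<Rightarrow> complex"
  assume r: "l2_rel f f'" "l2_rel g g'"
  then have s: "square_integrable f" "square_integrable f'" "square_integrable g" "square_integrable g'"
    and ae: "AE x in lborel. f x = f' x" "AE x in lborel. g x = g' x"
    by (auto simp: l2_rel_def)
  from ae have "AE x in lborel. cnj (f x) * g x = cnj (f' x) * g' x"
    by eventually_elim simp
  then show "(\<integral>x. cnj (f x) * g x \<partial>lborel) = (\<integral>x. cnj (f' x) * g' x \<partial>lborel)"
    using s by (intro integral_cong_AE borel_measurable_integrable integrable_cnj_mult)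
qed

instantiation l2 :: (euclidean_space) real_vector
begin

lift_definition zero_l2 :: "'a l2" is "\<lambda>_. 0"
  by (simp add: l2_rel_def square_integrable_0)

lift_definition plus_l2 :: "'a l2 \<Rightarrow> 'a l2 \<Rightarrow> 'a l2" is "\<lambda>f g x. f x + g x"
  by (auto simp: l2_rel_def square_integrable_add)

definition uminus_l2 :: "'a l2 \<Rightarrow> 'a l2" where "uminus_l2 f = cscale (- 1) f"

definition minus_l2 :: "'a l2 \<Rightarrow> 'a l2 \<Rightarrow> 'a l2" where "minus_l2 f g = f + cscale (- 1) g"

definition scaleR_l2 :: "real \<Rightarrow> 'a l2 \<Rightarrow> 'a l2" where "scaleR_l2 a f = cscale (complex_of_real a) f"

instance
proof
  fix f g h :: "'a l2" and a b :: real
  note l2_simps = l2_rel_def square_integrable_add square_integrable_scale square_integrable_0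
  show "f + g + h = f + (g + h)"
    by transfer (auto simp: l2_simps add.assoc)
  show "f + g = g + f"
    by transfer (auto simp: l2_simps add.commute)
  show "0 + f = f"
    by transfer (auto simp: l2_simps)
  show "- f + f = 0"
    unfolding uminus_l2_def by transfer (auto simp: l2_simps)
  show "f - g = f + - g"
    by (simp add: minus_l2_def uminus_l2_def)
  show "a *\<^sub>R (f + g) = a *\<^sub>R f + a *\<^sub>R g"
    unfolding scaleR_l2_def by transfer
      (auto simp: l2_rel_def distrib_left intro!: square_integrable_add square_integrable_scale)
  show "(a + b) *\<^sub>R f = a *\<^sub>R f + b *\<^sub>R f"
    unfolding scaleR_l2_def by transfer
      (auto simp: l2_rel_def distrib_right intro!: square_integrable_add square_integrable_scale)
  show "a *\<^sub>R b *\<^sub>R f = (a * b) *\<^sub>R f"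
    unfolding scaleR_l2_def by transfer
      (auto simp: l2_rel_def mult.assoc intro!: square_integrable_scale)
  show "1 *\<^sub>R f = f"
    unfolding scaleR_l2_def by transfer (auto simp: l2_simps)
qed

end

instantiation l2 :: (euclidean_space) real_inner
begin

definition inner_l2 :: "'a l2 \<Rightarrow> 'a l2 \<Rightarrow> real" where "inner_l2 f g = Re (cinner f g)"

definition norm_l2 :: "'a l2 \<Rightarrow> real" where "norm_l2 f = sqrt (inner f f)"

definition sgn_l2 :: "'a l2 \<Rightarrow> 'a l2" where "sgn_l2 f = f /\<^sub>R norm f"

definition dist_l2 :: "'a l2 \<Rightarrow> 'a l2 \<Rightarrow> real" where "dist_l2 f g = norm (f - g)"

definition uniformity_l2 :: "('a l2 \<times> 'a l2) filter" where
  "uniformity_l2 = (INF e\<in>{0<..}. principal {(f, g). dist f g < e})"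

definition open_l2 :: "'a l2 set \<Rightarrow> bool" where
  "open_l2 S = (\<forall>f\<in>S. \<forall>\<^sub>F (f', g) in uniformity. f' = f \<longrightarrow> g \<in> S)"

instance
proof
  fix f g h :: "'a l2" and a :: real
  show "sgn f = f /\<^sub>R norm f" by (rule sgn_l2_def)
  show "dist f g = norm (f - g)" by (rule dist_l2_def)
  show "(uniformity :: ('a l2 \<times> 'a l2) filter) = (INF e\<in>{0<..}. principal {(f, g). dist f g < e})"
    by (rule uniformity_l2_def)
  show "open S \<longleftrightarrow> (\<forall>f\<in>S. \<forall>\<^sub>F (f', g) in uniformity. f' = f \<longrightarrow> g \<in> S)" for S :: "'a l2 set"
    by (rule open_l2_def)
  show "norm f = sqrt (inner f f)" by (rule norm_l2_def)
  have "cinner g f = cnj (cinner f g)"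
  proof transfer
    fix f g :: "'a \<Rightarrow> complex"
    have "(\<integral>x. cnj (g x) * f x \<partial>lborel) = (\<integral>x. cnj (cnj (f x) * g x) \<partial>lborel)"
      by (simp add: mult.commute)
    also have "\<dots> = cnj (\<integral>x. cnj (f x) * g x \<partial>lborel)"
      by (rule Bochner_Integration.integral_cnj)
    finally show "(\<integral>x. cnj (g x) * f x \<partial>lborel) = cnj (\<integral>x. cnj (f x) * g x \<partial>lborel)" .
  qed
  then show "inner f g = inner g f"
    by (simp add: inner_l2_def)
  have "cinner (f + g) h = cinner f h + cinner g h"
    by transfer (simp add: l2_rel_def ring_distribs Bochner_Integration.integral_add integrable_cnj_mult)
  then show "inner (f + g) h = inner f h + inner g h"
    by (simp add: inner_l2_def)
  have "cinner (cscale (complex_of_real a) f) g = complex_of_real a * cinner f g"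
    by transfer (simp add: mult.assoc)
  then show "inner (a *\<^sub>R f) g = a * inner f g"
    by (simp add: inner_l2_def scaleR_l2_def)
  have re: "Re (\<integral>x. cnj (f x) * f x \<partial>lborel) = (\<integral>x. (cmod (f x))\<^sup>2 \<partial>lborel)"
    for f :: "'a \<Rightarrow> complex"
  proof -
    have "(\<lambda>x. cnj (f x) * f x) = (\<lambda>x. complex_of_real ((cmod (f x))\<^sup>2))"
      by (metis complex_norm_square mult.commute)
    then show ?thesis by (metis Re_complex_of_real integral_complex_of_real)
  qed
  show "0 \<le> inner f f"
    unfolding inner_l2_def by transfer (simp add: re)
  show "inner f f = 0 \<longleftrightarrow> f = 0"
    unfolding inner_l2_def
  proof transfer
    fix f :: "'a \<Rightarrow> complex"
    assume "l2_rel f f"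
    then have s: "square_integrable f" by (simp add: l2_rel_def)
    then have "(\<integral>x. (cmod (f x))\<^sup>2 \<partial>lborel) = 0 \<longleftrightarrow> (AE x in lborel. (cmod (f x))\<^sup>2 = 0)"
      by (intro integral_nonneg_eq_0_iff_AE) (auto simp: square_integrable_def)
    then show "Re (\<integral>x. cnj (f x) * f x \<partial>lborel) = 0 \<longleftrightarrow> l2_rel f (\<lambda>_. 0)"
      using s by (simp add: re l2_rel_def square_integrable_0)
  qed
qed

end


section \<open>Operators and the Segal--Shale--Weil representation\<close>

text \<open>
  \<open>'l l2 \<Rightarrow>\<^sub>L 'l l2\<close> is the Banach space of all bounded real-linear operators with the operator norm;
  complex linearity is imposed separately.
\<close>

definition clinear_op :: "('l::euclidean_space l2 \<Rightarrow>\<^sub>L 'l l2) \<Rightarrow> bool" where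
  "clinear_op T \<longleftrightarrow> (\<forall>c f. T (cscale c f) = cscale c (T f))"

definition unitary_op :: "('l::euclidean_space l2 \<Rightarrow>\<^sub>L 'l l2) \<Rightarrow> bool" where
  "unitary_op T \<longleftrightarrow> clinear_op T \<and> surj (blinfun_apply T) \<and> (\<forall>f g. cinner (T f) (T g) = cinner f g)"

definition compact_ops :: "('l::euclidean_space l2 \<Rightarrow>\<^sub>L 'l l2) set" where
  "compact_ops = {T. clinear_op T \<and> compact (closure (blinfun_apply T ` cball 0 1))}"

definition cscale_op :: "complex \<Rightarrow> ('l::euclidean_space l2 \<Rightarrow>\<^sub>L 'l l2) \<Rightarrow> ('l l2 \<Rightarrow>\<^sub>L 'l l2)" where
  "cscale_op c T = Blinfun (\<lambda>f. cscale c (T f))"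

text \<open>
  The Schroedinger representation of the Heisenberg group, with group law
  \<open>(v, s) (w, t) = (v + w, s + t + \<omega>0 v w / 2)\<close> and central character \<open>exp (\<i> t)\<close>. It is
  realized on \<open>L\<^sup>2(L)\<close>, where \<open>L = range j\<close> is parametrized by the linear injection \<open>j\<close> and carries
  Lebesgue measure, with the help of a Lagrangian complement \<open>L'\<close>: for \<open>v = x + y\<close> with
  \<open>x \<in> L\<close> and \<open>y \<in> L'\<close>, \<open>(r (v, t) f) z = exp (\<i> (t + \<omega>0 y (z - x / 2))) f (z - x)\<close>.
\<close>

definition schroedinger ::
  "('v::euclidean_space \<Rightarrow> 'v \<Rightarrow> real) \<Rightarrow> ('l::euclidean_space \<Rightarrow> 'v) \<Rightarrow> 'v set \<Rightarrow>
   'v \<Rightarrow> real \<Rightarrow> 'l l2 \<Rightarrow> 'l l2" where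
  "schroedinger \<omega>0 j L' v t f =
     (let x = (THE x. x \<in> range j \<and> v - x \<in> L'); y = v - x
      in abs_l2 (\<lambda>z. cis (t + \<omega>0 y (j z - x /\<^sub>R 2)) * rep_l2 f (z - inv_into UNIV j x)))"

definition segal_shale_weil ::
  "('v::euclidean_space \<Rightarrow> 'v \<Rightarrow> real) \<Rightarrow> ('g::topological_space) monoid \<Rightarrow> ('g \<Rightarrow> 'v \<Rightarrow>\<^sub>L 'v) \<Rightarrow>
   ('l::euclidean_space \<Rightarrow> 'v) \<Rightarrow> 'v set \<Rightarrow> ('g \<Rightarrow> 'l l2 \<Rightarrow>\<^sub>L 'l l2) \<Rightarrow> bool" where
  "segal_shale_weil \<omega>0 G lam j L' \<sigma> \<longleftrightarrow>
     (\<forall>g. unitary_op (\<sigma> g)) \<and>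
     \<sigma> \<one>\<^bsub>G\<^esub> = id_blinfun \<and>
     (\<forall>g h. \<sigma> (g \<otimes>\<^bsub>G\<^esub> h) = \<sigma> g o\<^sub>L \<sigma> h) \<and>
     (\<forall>f. continuous_on UNIV (\<lambda>g. \<sigma> g f)) \<and>
     (\<forall>g v t f. \<sigma> g (schroedinger \<omega>0 j L' v t (inv_into UNIV (\<sigma> g) f)) =
        schroedinger \<omega>0 j L' (lam g v) t f)"

definition Ad_rep ::
  "('g \<Rightarrow> 'l::euclidean_space l2 \<Rightarrow>\<^sub>L 'l l2) \<Rightarrow> 'g \<Rightarrow> ('l l2 \<Rightarrow>\<^sub>L 'l l2) \<Rightarrow> ('l l2 \<Rightarrow>\<^sub>L 'l l2)" where
  "Ad_rep \<sigma> g a = Blinfun (\<lambda>f. \<sigma> g (a (inv_into UNIV (\<sigma> g) f)))"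


section \<open>Banach bundles and the bundle of measurements\<close>

text \<open>
  The field \<open>total\<close> is the total space with its topology. The operations \<open>fadd\<close>, \<open>fscale\<close> and \<open>fnorm\<close>
  are relevant only for points of the total space, \<open>fadd\<close> only for points of the same fibre.
\<close>

record ('x, 'm) banach_bundle =
  total :: "'x topology"
  proj :: "'x \<Rightarrow> 'm"
  fadd :: "'x \<Rightarrow> 'x \<Rightarrow> 'x"
  fscale :: "complex \<Rightarrow> 'x \<Rightarrow> 'x"
  fnorm :: "'x \<Rightarrow> real"

definition bundle_iso :: "('x, 'm) banach_bundle \<Rightarrow> ('y, 'm) banach_bundle \<Rightarrow> ('x \<Rightarrow> 'y) \<Rightarrow> bool" where
  "bundle_iso B C \<Phi> \<longleftrightarrow>
     homeomorphic_map (total B) (total C) \<Phi> \<and>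
     (\<forall>x\<in>topspace (total B). proj C (\<Phi> x) = proj B x) \<and>
     (\<forall>x\<in>topspace (total B). \<forall>y\<in>topspace (total B). proj B x = proj B y \<longrightarrow>
        \<Phi> (fadd B x y) = fadd C (\<Phi> x) (\<Phi> y)) \<and>
     (\<forall>x\<in>topspace (total B). \<forall>c. \<Phi> (fscale B c x) = fscale C c (\<Phi> x)) \<and>
     (\<forall>x\<in>topspace (total B). fnorm C (\<Phi> x) = fnorm B x)"

definition bundle_isomorphic :: "('x, 'm) banach_bundle \<Rightarrow> ('y, 'm) banach_bundle \<Rightarrow> bool" where
  "bundle_isomorphic B C \<longleftrightarrow> (\<exists>\<Phi>. bundle_iso B C \<Phi>)"

definition product_bundle ::
  "('l::euclidean_space l2 \<Rightarrow>\<^sub>L 'l l2) set \<Rightarrow>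
   ('m::topological_space \<times> ('l l2 \<Rightarrow>\<^sub>L 'l l2), 'm) banach_bundle" where
  "product_bundle E =
     \<lparr>total = top_of_set (UNIV \<times> E),
      proj = fst,
      fadd = (\<lambda>x y. (fst x, snd x + snd y)),
      fscale = (\<lambda>c x. (fst x, cscale_op c (snd x))),
      fnorm = (\<lambda>x. norm (snd x))\<rparr>"

text \<open>Triviality, with a Banach space of operators as the model fibre.\<close>

definition trivial_bundle ::
  "'l::euclidean_space itself \<Rightarrow> ('x, 'm::topological_space) banach_bundle \<Rightarrow> bool" where
  "trivial_bundle _ B \<longleftrightarrow>
     (\<exists>E :: ('l l2 \<Rightarrow>\<^sub>L 'l l2) set. subspace E \<and> (\<forall>c. \<forall>a\<in>E. cscale_op c a \<in> E) \<and> complete E \<and>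
        bundle_isomorphic B (product_bundle E))"

definition quotient_topology :: "'a topology \<Rightarrow> ('a \<Rightarrow> 'b) \<Rightarrow> 'b topology" where
  "quotient_topology X q =
     topology (\<lambda>U. U \<subseteq> q ` topspace X \<and> openin X {x \<in> topspace X. q x \<in> U})"

lemma openin_quotient_topology:
  "openin (quotient_topology X q) U \<longleftrightarrow> U \<subseteq> q ` topspace X \<and> openin X {x \<in> topspace X. q x \<in> U}"
proof -
  let ?P = "\<lambda>U. U \<subseteq> q ` topspace X \<and> openin X {x \<in> topspace X. q x \<in> U}"
  have "istopology ?P"
    unfolding istopology_def
  proof (intro conjI allI impI)
    fix S T assume "?P S" "?P T"
    moreover have "{x \<in> topspace X. q x \<in> S \<inter> T} =
        {x \<in> topspace X. q x \<in> S} \<inter> {x \<in> topspace X. q x \<in> T}" by auto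
    ultimately show "S \<inter> T \<subseteq> q ` topspace X" "openin X {x \<in> topspace X. q x \<in> S \<inter> T}"
      by (auto simp: openin_Int)
  next
    fix \<K> assume K: "\<forall>K\<in>\<K>. ?P K"
    have "{x \<in> topspace X. q x \<in> \<Union>\<K>} = (\<Union>K\<in>\<K>. {x \<in> topspace X. q x \<in> K})" by auto
    with K show "openin X {x \<in> topspace X. q x \<in> \<Union>\<K>}" by auto
    show "\<Union>\<K> \<subseteq> q ` topspace X" using K by blast
  qed
  then show ?thesis by (simp add: quotient_topology_def topology_inverse')
qed

text \<open>The equivalence class of \<open>(r, a)\<close> under \<open>(r, a) \<sim> (r g\<^sup>-\<^sup>1, \<rho> g a)\<close>.\<close>

definition assoc_class ::
  "'g monoid \<Rightarrow> ('p \<Rightarrow> 'g \<Rightarrow> 'p) \<Rightarrow> ('g \<Rightarrow> 'f \<Rightarrow> 'f) \<Rightarrow> 'p \<times> 'f \<Rightarrow> ('p \<times> 'f) set" where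
  "assoc_class G act \<rho> x = {(act (fst x) (inv\<^bsub>G\<^esub> g), \<rho> g (snd x)) |g. g \<in> carrier G}"

definition measurement_bundle ::
  "('g::topological_space) monoid \<Rightarrow> ('p::topological_space \<Rightarrow> 'm) \<Rightarrow> ('p \<Rightarrow> 'g \<Rightarrow> 'p) \<Rightarrow>
   ('g \<Rightarrow> 'l::euclidean_space l2 \<Rightarrow>\<^sub>L 'l l2) \<Rightarrow> (('p \<times> ('l l2 \<Rightarrow>\<^sub>L 'l l2)) set, 'm) banach_bundle" where
  "measurement_bundle G \<pi> act \<sigma> =
     (let cls = (\<lambda>r a. assoc_class G act (Ad_rep \<sigma>) (r, a)) in
     \<lparr>total = quotient_topology (top_of_set (UNIV \<times> compact_ops)) (\<lambda>(r, a). cls r a),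
      proj = (\<lambda>X. THE m. \<exists>r. \<exists>a\<in>compact_ops. X = cls r a \<and> m = \<pi> r),
      fadd = (\<lambda>X Y. THE Z. \<exists>r. \<exists>a\<in>compact_ops. \<exists>b\<in>compact_ops.
                X = cls r a \<and> Y = cls r b \<and> Z = cls r (a + b)),
      fscale = (\<lambda>c X. THE Z. \<exists>r. \<exists>a\<in>compact_ops. X = cls r a \<and> Z = cls r (cscale_op c a)),
      fnorm = (\<lambda>X. THE s. \<exists>r. \<exists>a\<in>compact_ops. X = cls r a \<and> s = norm a)\<rparr>)"

end

(*
  It suffices to find a strongly continuous map w from P to the unitary group of L^2 with
  w (r g) = w r \<circ> \<sigma> g: then [(r, a)] \<mapsto> (\<pi> r, w r \<circ> a \<circ> (w r)\<^sup>-\<^sup>1) trivializes the bundle, because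
  conjugation of a compact operator by a strongly continuous family of unitaries is norm continuous.
  Over a trivializing open set, w = \<sigma> \<circ> \<gamma> does the job, where \<gamma> is the group coordinate of the trivialization.
  Two local solutions differ by a strongly continuous unitary family on the base, and they are glued by
  contracting this family to the identity: the unitary group of L^2 is contractible in the strong
  topology (Dixmier and Douady). The contraction replaces u by V u W + (1 - V W), where V runs through a
  strongly continuous semigroup of isometries whose adjoints W tend strongly to 0, namely the semigroup
  that pushes the two half spaces x \<bullet> b > 0 and x \<bullet> b \<le> 0 apart.
*)

theory Submission
  imports Defs
begin

section \<open>The Hilbert space of square integrable functions\<close>

text \<open>Working on P instead of M avoids transition functions: an equivariant family amounts to
  a trivialization of the associated bundle with fibre L^2, and the quotient of two such families is
  invariant under the group, hence lives on the base. The obstacle is the topology. A strongly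
  continuous \<sigma> need not be norm continuous, so norm contractibility of the unitary group
  (Kuiper) is of no help; continuity of operators is stated vector by vector, and the bounds that
  make it composable come from isometry. Norm continuity reappears only when a compact operator
  stands between the unitaries. The contraction rests on infinite dimension: it needs isometries
  \<open>V\<close> with \<open>W V = 1\<close> that are not onto, whose ranges can be driven away
  from every fixed vector. Gluing is an infinite process in which each step gives up part of the
  domain. Thresholds that increase to 1/2 without reaching it leave room for countably many losses,
  while a point where some cut-off exceeds 1/2 keeps its value from some stage on.\<close>

lemma square_integrable_rep_l2 [simp]: "square_integrable (rep_l2 F)"
  using Quotient3_rel_rep[OF Quotient3_l2, of F F] by (simp add: l2_rel_def)

lemma abs_rep_l2 [simp]: "abs_l2 (rep_l2 F) = F"
  by (rule Quotient3_abs_rep[OF Quotient3_l2])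

lemma l2_cases: obtains f where "F = abs_l2 f" "square_integrable f"
  by (metis abs_rep_l2 square_integrable_rep_l2)

lemma add_abs_l2:
  "square_integrable f \<Longrightarrow> square_integrable g \<Longrightarrow> abs_l2 f + abs_l2 g = abs_l2 (\<lambda>x. f x + g x)"
  by (rule plus_l2.abs_eq) (simp_all add: l2_rel_def)

lemma cscale_abs_l2: "square_integrable f \<Longrightarrow> cscale c (abs_l2 f) = abs_l2 (\<lambda>x. c * f x)"
  by (rule cscale.abs_eq) (simp add: l2_rel_def)

lemma diff_abs_l2:
  "square_integrable f \<Longrightarrow> square_integrable g \<Longrightarrow> abs_l2 f - abs_l2 g = abs_l2 (\<lambda>x. f x - g x)"
  using square_integrable_scale[of g "-1"]
  by (simp add: minus_l2_def cscale_abs_l2 add_abs_l2)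

lemma square_integrable_diff:
  "square_integrable f \<Longrightarrow> square_integrable g \<Longrightarrow> square_integrable (\<lambda>x. f x - g x)"
  using square_integrable_add[of f "\<lambda>x. (-1) * g x"] square_integrable_scale[of g "-1"] by simp

lemma cinner_abs_l2:
  "square_integrable f \<Longrightarrow> square_integrable g \<Longrightarrow>
     cinner (abs_l2 f) (abs_l2 g) = (\<integral>x. cnj (f x) * g x \<partial>lborel)"
  by (rule cinner.abs_eq) (simp_all add: l2_rel_def)

lemma cinner_commute: "cinner g f = cnj (cinner f g)"
proof transfer
  fix f g :: "'a \<Rightarrow> complex"
  have "(\<integral>x. cnj (g x) * f x \<partial>lborel) = (\<integral>x. cnj (cnj (f x) * g x) \<partial>lborel)"
    by (simp add: mult.commute)
  also have "\<dots> = cnj (\<integral>x. cnj (f x) * g x \<partial>lborel)"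
    by (rule Bochner_Integration.integral_cnj)
  finally show "(\<integral>x. cnj (g x) * f x \<partial>lborel) = cnj (\<integral>x. cnj (f x) * g x \<partial>lborel)" .
qed

lemma cinner_add_right: "cinner f (g + h) = cinner f g + cinner f h"
  by transfer (simp add: l2_rel_def ring_distribs Bochner_Integration.integral_add integrable_cnj_mult)

lemma cinner_cscale_right: "cinner f (cscale c g) = c * cinner f g"
  by transfer (simp add: mult.left_commute)

lemma cinner_add_left: "cinner (f + g) h = cinner f h + cinner g h"
  by (metis cinner_add_right cinner_commute complex_cnj_add)

lemma cinner_cscale_left: "cinner (cscale c f) g = cnj c * cinner f g"
  by (metis cinner_cscale_right cinner_commute complex_cnj_mult)

lemma cinner_diff_right: "cinner f (g - h) = cinner f g - cinner f h"
  unfolding minus_l2_def by (simp add: cinner_add_right cinner_cscale_right)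

lemma cinner_diff_left: "cinner (f - g) h = cinner f h - cinner g h"
  unfolding minus_l2_def by (simp add: cinner_add_left cinner_cscale_left)

lemma cinner_self: "cinner f f = complex_of_real ((norm f)\<^sup>2)"
proof -
  have "Im (cinner f f) = 0"
    using arg_cong[OF cinner_commute[of f f], of Im] by simp
  moreover have "Re (cinner f f) = (norm f)\<^sup>2"
    by (metis inner_l2_def power2_norm_eq_inner)
  ultimately show ?thesis by (simp add: complex_eq_iff)
qed

lemma cscale_add_right: "cscale c (f + g) = cscale c f + cscale c g"
  by transfer (auto simp: l2_rel_def distrib_left intro!: square_integrable_add square_integrable_scale)

lemma cscale_diff_right: "cscale c (f - g) = cscale c f - cscale c g"
  by (metis add_diff_cancel_right' cscale_add_right diff_add_cancel)

lemma cscale_cscale: "cscale a (cscale b f) = cscale (a * b) f"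
  by transfer (auto simp: l2_rel_def mult.assoc intro!: square_integrable_scale)

lemma cscale_scaleR: "cscale c (a *\<^sub>R f) = a *\<^sub>R cscale c f"
  by (simp add: scaleR_l2_def cscale_cscale mult.commute)

lemma norm_cscale: "norm (cscale c f) = cmod c * norm f"
proof -
  have "complex_of_real ((norm (cscale c f))\<^sup>2) = complex_of_real ((cmod c * norm f)\<^sup>2)"
    unfolding cinner_self[symmetric] cinner_cscale_left cinner_cscale_right
    by (simp add: cinner_self power_mult_distrib complex_norm_square[of c, simplified of_real_power] mult_ac
        del: complex_cnj_mult)
  then show ?thesis
    by (metis norm_ge_zero of_real_eq_iff power2_eq_iff_nonneg mult_nonneg_nonneg)
qed

lemma bounded_linear_cscale: "bounded_linear (cscale c)"
  by (rule bounded_linear_intro[of _ "cmod c"])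
    (simp_all add: cscale_add_right cscale_scaleR norm_cscale mult.commute)

lemma norm_abs_l2:
  assumes "square_integrable f"
  shows "(norm (abs_l2 f))\<^sup>2 = (\<integral>x. (cmod (f x))\<^sup>2 \<partial>lborel)"
proof -
  have "complex_of_real ((norm (abs_l2 f))\<^sup>2) = (\<integral>x. complex_of_real ((cmod (f x))\<^sup>2) \<partial>lborel)"
    unfolding cinner_self[symmetric] cinner_abs_l2[OF assms assms]
    by (rule Bochner_Integration.integral_cong) (simp_all only: complex_norm_square mult.commute)
  then show ?thesis by (metis integral_complex_of_real of_real_eq_iff)
qed

lemma norm_l2_nn_integral:
  assumes "square_integrable f"
  shows "(\<integral>\<^sup>+x. ennreal ((cmod (f x))\<^sup>2) \<partial>lborel) = ennreal ((norm (abs_l2 f))\<^sup>2)"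
  using assms by (subst nn_integral_eq_integral) (auto simp: norm_abs_l2 square_integrable_def)

lemma square_integrable_nn_integral:
  assumes "f \<in> borel_measurable lborel" "(\<integral>\<^sup>+x. ennreal ((cmod (f x))\<^sup>2) \<partial>lborel) < \<infinity>"
  shows "square_integrable f"
  using assms by (auto simp: square_integrable_def intro!: integrableI_nonneg)

subsection \<open>Completeness\<close>

text \<open>The weighted terms tend to zero, so |d k| is eventually below 2^-k and a geometric
  series majorizes. The weight 4^k is what lets a bound on squares control absolute
  convergence.\<close>

lemma summable_if_weighted_square_suminf_finite:
  fixes d :: "nat \<Rightarrow> complex"
  assumes "(\<Sum>k. ennreal (4 ^ k * (cmod (d k))\<^sup>2)) < \<infinity>"
  shows "summable d"
proof (rule summable_comparison_test_ev)
  have s: "summable (\<lambda>k. 4 ^ k * (cmod (d k))\<^sup>2)"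
    using assms by (intro summable_suminf_not_top) auto
  from LIMSEQ_D[OF summable_LIMSEQ_zero[OF s], of 1]
  have "\<forall>\<^sub>F k in sequentially. 4 ^ k * (cmod (d k))\<^sup>2 < 1"
    by (auto simp: eventually_sequentially)
  then show "\<forall>\<^sub>F k in sequentially. norm (d k) \<le> (1/2) ^ k"
  proof eventually_elim
    case (elim k)
    have "(2 ^ k * cmod (d k))\<^sup>2 < 1\<^sup>2"
      using elim by (simp add: power_mult_distrib power_mult[symmetric] mult.commute[of k 2])
        (simp add: power_mult)
    then have "2 ^ k * cmod (d k) < 1"
      by (rule power_less_imp_less_base) simp
    then show ?case by (simp add: field_simps power_one_over)
  qed
qed (simp add: summable_geometric)

text \<open>Riesz-Fischer for a fast Cauchy sequence: the weighted sum of squared increments has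
  finite integral, so the representatives converge almost everywhere, and Fatou's lemma identifies
  the pointwise limit as the limit in norm.\<close>

lemma l2_convergent_if_geometric:
  fixes X :: "nat \<Rightarrow> 'a::euclidean_space l2"
  assumes X: "\<And>k l. k \<le> l \<Longrightarrow> norm (X l - X k) \<le> (1/4) ^ k"
  shows "\<exists>F. X \<longlonglongrightarrow> F"
proof -
  define f where "f k = rep_l2 (X k)" for k
  have sf: "square_integrable (f k)" and Xf: "X k = abs_l2 (f k)" for k
    by (simp_all add: f_def)
  have [measurable]: "f k \<in> borel_measurable lborel" for k
    using sf[of k] by (simp add: square_integrable_def)
  have dn: "(\<integral>\<^sup>+x. ennreal ((cmod (f l x - f k x))\<^sup>2) \<partial>lborel) \<le> ennreal (((1/4) ^ k)\<^sup>2)"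
    if "k \<le> l" for k l
    using X[OF that] norm_l2_nn_integral[OF square_integrable_diff[OF sf[of l] sf[of k]]]
    by (simp add: Xf diff_abs_l2 sf power_mono ennreal_leI)
  have "(\<integral>\<^sup>+x. (\<Sum>k. ennreal (4 ^ k * (cmod (f (Suc k) x - f k x))\<^sup>2)) \<partial>lborel)
      = (\<Sum>k. \<integral>\<^sup>+x. ennreal (4 ^ k * (cmod (f (Suc k) x - f k x))\<^sup>2) \<partial>lborel)"
    by (rule nn_integral_suminf) measurable
  also have "\<dots> \<le> (\<Sum>k. ennreal ((1/4) ^ k))"
  proof (intro suminf_le summableI)
    fix k
    have "(\<integral>\<^sup>+x. ennreal (4 ^ k * (cmod (f (Suc k) x - f k x))\<^sup>2) \<partial>lborel)
        = ennreal (4 ^ k) * (\<integral>\<^sup>+x. ennreal ((cmod (f (Suc k) x - f k x))\<^sup>2) \<partial>lborel)"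
      by (subst nn_integral_cmult[symmetric]) (auto simp: ennreal_mult)
    also have "\<dots> \<le> ennreal (4 ^ k) * ennreal (((1/4) ^ k)\<^sup>2)"
      by (intro mult_left_mono dn) auto
    also have "\<dots> = ennreal (4 ^ k * ((1/4) ^ k)\<^sup>2)"
      by (simp add: ennreal_mult)
    \<comment> \<open>The squared rate (1/16)^k absorbs the weight 4^k and still leaves a summable
      factor.\<close>
    also have "(4::real) ^ k * ((1/4) ^ k)\<^sup>2 = (1/4) ^ k"
      by (simp add: power2_eq_square power_one_over)
    finally show "(\<integral>\<^sup>+x. ennreal (4 ^ k * (cmod (f (Suc k) x - f k x))\<^sup>2) \<partial>lborel) \<le> ennreal ((1/4) ^ k)" .
  qed
  also have "\<dots> = ennreal (\<Sum>k. (1/4) ^ k)"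
    by (rule suminf_ennreal2) (auto simp: summable_geometric)
  also have "\<dots> < \<infinity>" by simp
  finally have "(\<integral>\<^sup>+x. (\<Sum>k. ennreal (4 ^ k * (cmod (f (Suc k) x - f k x))\<^sup>2)) \<partial>lborel) \<noteq> \<infinity>"
    by simp
  then have "AE x in lborel. (\<Sum>k. ennreal (4 ^ k * (cmod (f (Suc k) x - f k x))\<^sup>2)) \<noteq> \<infinity>"
    by (intro nn_integral_PInf_AE) measurable
  then have conv: "AE x in lborel. convergent (\<lambda>k. f k x)"
  proof eventually_elim
    case (elim x)
    then have "summable (\<lambda>k. f (Suc k) x - f k x)"
      by (intro summable_if_weighted_square_suminf_finite) (simp add: less_top)
    then have "convergent (\<lambda>n. \<Sum>k<n. f (Suc k) x - f k x)"
      by (simp add: summable_iff_convergent)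
    then have "convergent (\<lambda>n. f n x - f 0 x)"
      by (simp only: sum_lessThan_telescope[of "\<lambda>k. f k x"])
    then show ?case
      using convergent_add_const_right_iff[of "\<lambda>n. f n x" "- f 0 x"] by simp
  qed
  define g where "g x = lim (\<lambda>k. f k x)" for x
  have [measurable]: "g \<in> borel_measurable lborel"
    unfolding g_def by measurable
  have lim: "AE x in lborel. (\<lambda>k. f k x) \<longlonglongrightarrow> g x"
    using conv by eventually_elim (simp add: g_def convergent_LIMSEQ_iff)
  \<comment> \<open>Fatou in \<open>l\<close> for fixed \<open>k\<close>. The one estimate gives
    both the square integrability of \<open>g\<close> and the rate of convergence.\<close>
  have gn: "(\<integral>\<^sup>+x. ennreal ((cmod (g x - f k x))\<^sup>2) \<partial>lborel) \<le> ennreal (((1/4) ^ k)\<^sup>2)" for k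
  proof -
    have "(\<integral>\<^sup>+x. ennreal ((cmod (g x - f k x))\<^sup>2) \<partial>lborel)
        = (\<integral>\<^sup>+x. liminf (\<lambda>l. ennreal ((cmod (f l x - f k x))\<^sup>2)) \<partial>lborel)"
    proof (rule nn_integral_cong_AE, use lim in eventually_elim)
      case (elim x)
      then have "(\<lambda>l. ennreal ((cmod (f l x - f k x))\<^sup>2)) \<longlonglongrightarrow> ennreal ((cmod (g x - f k x))\<^sup>2)"
        by (intro tendsto_intros)
      then show ?case by (rule lim_imp_Liminf[OF sequentially_bot, symmetric])
    qed
    also have "\<dots> \<le> liminf (\<lambda>l. \<integral>\<^sup>+x. ennreal ((cmod (f l x - f k x))\<^sup>2) \<partial>lborel)"
      by (rule nn_integral_liminf) measurable
    also have "\<dots> \<le> ennreal (((1/4) ^ k)\<^sup>2)"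
    proof (rule order_trans[OF Liminf_le_Limsup Limsup_bounded])
      show "\<forall>\<^sub>F l in sequentially. (\<integral>\<^sup>+x. ennreal ((cmod (f l x - f k x))\<^sup>2) \<partial>lborel) \<le> ennreal (((1/4) ^ k)\<^sup>2)"
        using eventually_ge_at_top[of k] by eventually_elim (rule dn)
    qed simp
    finally show ?thesis .
  qed
  have sd: "square_integrable (\<lambda>x. g x - f k x)" for k
    by (rule square_integrable_nn_integral) (use gn[of k] in \<open>auto intro: le_less_trans\<close>)
  have sg: "square_integrable g"
    using square_integrable_add[OF sd[of 0] sf[of 0]] by simp
  have "norm (X k - abs_l2 g) \<le> (1/4) ^ k" for k
  proof -
    have "ennreal ((norm (abs_l2 g - X k))\<^sup>2) \<le> ennreal (((1/4) ^ k)\<^sup>2)"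
      using gn[of k] unfolding norm_l2_nn_integral[OF sd] by (simp add: Xf diff_abs_l2 sf sg)
    then have "(norm (abs_l2 g - X k))\<^sup>2 \<le> ((1/4) ^ k)\<^sup>2"
      by (subst (asm) ennreal_le_iff) auto
    then show ?thesis
      by (metis norm_minus_commute power2_le_imp_le zero_le_power zero_le_divide_1_iff zero_le_numeral)
  qed
  moreover have "(\<lambda>k. (1/4::real) ^ k) \<longlonglongrightarrow> 0" by (rule LIMSEQ_power_zero) simp
  ultimately have "(\<lambda>k. X k - abs_l2 g) \<longlonglongrightarrow> 0"
    by (intro Lim_null_comparison[of "\<lambda>k. X k - abs_l2 g" "\<lambda>k. (1/4) ^ k"]) auto
  then have "X \<longlonglongrightarrow> abs_l2 g" by (rule LIM_zero_cancel)
  then show ?thesis ..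
qed

instance l2 :: (euclidean_space) banach
proof
  fix X :: "nat \<Rightarrow> 'a l2"
  assume C: "Cauchy X"
  have "\<exists>N. \<forall>m\<ge>N. \<forall>n\<ge>N. norm (X m - X n) < (1/4) ^ k" for k
    by (rule CauchyD[OF C]) simp
  then obtain N where N: "\<And>k m n. m \<ge> N k \<Longrightarrow> n \<ge> N k \<Longrightarrow> norm (X m - X n) < (1/4) ^ k"
    by metis
  \<comment> \<open>Partial sums dominate each \<open>N k\<close>, and the summand \<open>k\<close>
    makes \<open>s\<close> strictly increasing.\<close>
  define s where "s k = (\<Sum>i\<le>k. N i) + k" for k
  have sN: "N k \<le> s k" for k
    unfolding s_def using member_le_sum[of k "{..k}" N] by simp
  have s: "strict_mono s"
    by (rule strict_monoI_Suc) (simp add: s_def)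
  have "\<exists>F. (X \<circ> s) \<longlonglongrightarrow> F"
  proof (rule l2_convergent_if_geometric)
    fix k l :: nat assume "k \<le> l"
    then have "s k \<le> s l" using s by (simp add: strict_mono_less_eq)
    then show "norm ((X \<circ> s) l - (X \<circ> s) k) \<le> (1/4) ^ k"
      using N[of k "s l" "s k"] sN[of k] by simp
  qed
  then show "convergent X"
    using C s Cauchy_converges_subseq by (metis convergent_def LIMSEQ_subseq_LIMSEQ)
qed

section \<open>Translations and half spaces\<close>

lemma AE_lborel_shift:
  fixes v :: "'a::euclidean_space"
  assumes "AE x in lborel. P x"
  shows "AE x in lborel. P (x - v)"
proof -
  have "AE x in distr lborel borel ((+) (- v)). P x"
    using assms by (simp only: lborel_distr_plus)
  then have "AE x in lborel. P (- v + x)"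
    by (rule AE_distrD[rotated]) simp
  then show ?thesis by simp
qed

lemma integral_lborel_shift:
  fixes v :: "'a::euclidean_space" and f :: "'a \<Rightarrow> 'b::{banach, second_countable_topology}"
  assumes [measurable]: "f \<in> borel_measurable borel"
  shows "(\<integral>x. f (x - v) \<partial>lborel) = (\<integral>x. f x \<partial>lborel)"
proof -
  have "(\<integral>x. f x \<partial>lborel) = (\<integral>x. f x \<partial>distr lborel borel ((+) (- v)))"
    by (simp add: lborel_distr_plus)
  also have "\<dots> = (\<integral>x. f (- v + x) \<partial>lborel)"
    by (rule integral_distr) measurable
  finally show ?thesis by simp
qed

lemma integrable_lborel_shift:
  fixes v :: "'a::euclidean_space" and f :: "'a \<Rightarrow> 'b::{banach, second_countable_topology}"
  assumes "integrable lborel f"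
  shows "integrable lborel (\<lambda>x. f (x - v))"
proof -
  have "integrable (distr lborel borel ((+) (- v))) f"
    using assms by (simp add: lborel_distr_plus)
  then have "integrable lborel (\<lambda>x. f (- v + x))"
    by (rule integrable_distr[rotated]) simp
  then show ?thesis by simp
qed

lemma square_integrable_shift:
  assumes "square_integrable f"
  shows "square_integrable (\<lambda>x. f (x - v))"
proof -
  have [measurable]: "f \<in> borel_measurable borel"
    using assms by (simp add: square_integrable_def)
  have "(\<lambda>x. f (x - v)) \<in> borel_measurable borel" by measurable
  then show ?thesis
    using assms integrable_lborel_shift[of "\<lambda>x. (cmod (f x))\<^sup>2" v] by (simp add: square_integrable_def)
qed

lift_definition l2_shift :: "'a::euclidean_space \<Rightarrow> 'a l2 \<Rightarrow> 'a l2" is "\<lambda>v f x. f (x - v)"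
  unfolding l2_rel_def using AE_lborel_shift[of "\<lambda>x. _ x = _ x"]
  by (blast intro: square_integrable_shift)

lemma l2_shift_abs: "square_integrable f \<Longrightarrow> l2_shift v (abs_l2 f) = abs_l2 (\<lambda>x. f (x - v))"
  by (rule l2_shift.abs_eq) (simp add: l2_rel_def)

lemma l2_shift_add: "l2_shift v (f + g) = l2_shift v f + l2_shift v g"
  by transfer (auto simp: l2_rel_def intro!: square_integrable_shift square_integrable_add)

lemma l2_shift_cscale: "l2_shift v (cscale c f) = cscale c (l2_shift v f)"
  by transfer (auto simp: l2_rel_def intro!: square_integrable_shift square_integrable_scale)

lemma l2_shift_diff: "l2_shift v (f - g) = l2_shift v f - l2_shift v g"
  by (metis add_diff_cancel_right' l2_shift_add diff_add_cancel)

lemma l2_shift_0 [simp]: "l2_shift 0 f = f"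
  by transfer (auto simp: l2_rel_def)

lemma l2_shift_shift: "l2_shift v (l2_shift w f) = l2_shift (v + w) f"
  by transfer (auto simp: l2_rel_def diff_diff_eq intro!: square_integrable_shift)

lemma cinner_l2_shift: "cinner (l2_shift v f) (l2_shift v g) = cinner f g"
proof transfer
  fix v :: 'a and f g :: "'a \<Rightarrow> complex"
  assume "l2_rel f f" "l2_rel g g"
  then have [measurable]: "f \<in> borel_measurable borel" "g \<in> borel_measurable borel"
    by (auto simp: l2_rel_def square_integrable_def)
  have [measurable]: "(\<lambda>x. cnj (f x)) \<in> borel_measurable borel"
    by (rule borel_measurable_continuous_on[of cnj]) (auto intro: continuous_intros)
  show "(\<integral>x. cnj (f (x - v)) * g (x - v) \<partial>lborel) = (\<integral>x. cnj (f x) * g x \<partial>lborel)"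
    by (rule integral_lborel_shift[of "\<lambda>x. cnj (f x) * g x"]) measurable
qed

lemma norm_l2_shift [simp]: "norm (l2_shift v f) = norm f"
  by (simp add: norm_l2_def inner_l2_def cinner_l2_shift)

lemma cinner_l2_shift_left: "cinner (l2_shift v f) g = cinner f (l2_shift (- v) g)"
  using cinner_l2_shift[of v f "l2_shift (- v) g"] by (simp add: l2_shift_shift)

section \<open>Projection onto the functions supported in a half space\<close>

lemma square_integrable_half:
  fixes f :: "'a::euclidean_space \<Rightarrow> complex"
  assumes f: "square_integrable f"
  shows "square_integrable (\<lambda>x. indicator {x. 0 < x \<bullet> b} x * f x)"
  unfolding square_integrable_def
proof
  have [measurable]: "{x. 0 < x \<bullet> b} \<in> sets borel" by measurable
  have [measurable]: "f \<in> borel_measurable borel" using f by (simp add: square_integrable_def)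
  show m: "(\<lambda>x. indicator {x. 0 < x \<bullet> b} x * f x) \<in> borel_measurable lborel"
    by measurable
  show "integrable lborel (\<lambda>x. (cmod (indicator {x. 0 < x \<bullet> b} x * f x))\<^sup>2)"
  proof (rule Bochner_Integration.integrable_bound)
    show "integrable lborel (\<lambda>x. (cmod (f x))\<^sup>2)"
      using f by (simp add: square_integrable_def)
  qed (use m in \<open>auto simp: indicator_def\<close>)
qed

lift_definition l2_half :: "'a::euclidean_space \<Rightarrow> 'a l2 \<Rightarrow> 'a l2"
  is "\<lambda>b f x. indicator {x. 0 < x \<bullet> b} x * f x"
  by (auto simp: l2_rel_def intro!: square_integrable_half simp del: indicator_simps)

lemma l2_half_abs:
  "square_integrable f \<Longrightarrow> l2_half b (abs_l2 f) = abs_l2 (\<lambda>x. indicator {x. 0 < x \<bullet> b} x * f x)"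
  by (rule l2_half.abs_eq) (simp add: l2_rel_def)

lemma l2_half_add: "l2_half b (f + g) = l2_half b f + l2_half b g"
  by transfer (auto simp: l2_rel_def distrib_left intro!: square_integrable_half square_integrable_add)

lemma l2_half_cscale: "l2_half b (cscale c f) = cscale c (l2_half b f)"
  by transfer (auto simp: l2_rel_def intro!: square_integrable_half square_integrable_scale)

lemma l2_half_diff: "l2_half b (f - g) = l2_half b f - l2_half b g"
  by (metis add_diff_cancel_right' l2_half_add diff_add_cancel)

lemma l2_half_half [simp]: "l2_half b (l2_half b f) = l2_half b f"
proof (cases f rule: l2_cases)
  case (1 g)
  have "(indicator {x. 0 < x \<bullet> b} x :: complex) * (indicator {x. 0 < x \<bullet> b} x * g x)
     = indicator {x. 0 < x \<bullet> b} x * g x" for x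
    by (auto simp: indicator_def)
  then show ?thesis
    by (simp only: 1(1) l2_half_abs[OF 1(2)] l2_half_abs[OF square_integrable_half[OF 1(2)]])
qed

lemma cinner_l2_half_left: "cinner (l2_half b f) g = cinner f (l2_half b g)"
  by transfer (auto intro!: Bochner_Integration.integral_cong simp: indicator_def)

text \<open>The cut-off is idempotent and symmetric, hence an orthogonal projection, and Pythagoras
  applies.\<close>

lemma norm_l2_half_le: "norm (l2_half b f) \<le> norm f"
proof -
  have "(norm f)\<^sup>2 = (norm (l2_half b f))\<^sup>2 + (norm (f - l2_half b f))\<^sup>2"
  proof -
    have "complex_of_real ((norm f)\<^sup>2) =
        complex_of_real ((norm (l2_half b f))\<^sup>2 + (norm (f - l2_half b f))\<^sup>2)"
      unfolding of_real_add cinner_self[symmetric]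
      by (simp add: cinner_diff_left cinner_diff_right cinner_l2_half_left)
    then show ?thesis by (simp only: of_real_eq_iff)
  qed
  then have "(norm (l2_half b f))\<^sup>2 \<le> (norm f)\<^sup>2" by simp
  then show ?thesis by (rule power2_le_imp_le) simp
qed

text \<open>Translation by a nonnegative multiple of \<open>b\<close> maps the half space into
  itself, so the support stays inside.\<close>

lemma l2_half_shift_half:
  assumes "0 \<le> a" "b \<bullet> b = 1"
  shows "l2_half b (l2_shift (a *\<^sub>R b) (l2_half b f)) = l2_shift (a *\<^sub>R b) (l2_half b f)"
proof (cases f rule: l2_cases)
  case (1 g)
  have "(indicator {x. 0 < x \<bullet> b} x :: complex) * (indicator {x. 0 < x \<bullet> b} (x - a *\<^sub>R b) * g (x - a *\<^sub>R b))
     = indicator {x. 0 < x \<bullet> b} (x - a *\<^sub>R b) * g (x - a *\<^sub>R b)" for x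
    using assms by (auto simp: indicator_def inner_diff_left)
  then show ?thesis
    by (simp only: 1(1) l2_half_abs[OF 1(2)] l2_shift_abs[OF square_integrable_half[OF 1(2)]]
        l2_half_abs[OF square_integrable_shift[OF square_integrable_half[OF 1(2)]]])
qed

text \<open>Dual to the preceding invariance: what lands in the half space after moving back by
  \<open>a *\<^sub>R b\<close> came from a point at least as deep inside, so the earlier cut-off is
  not seen.\<close>

lemma l2_half_shift_minus:
  assumes "0 \<le> a" "b \<bullet> b = 1"
  shows "l2_half b (l2_shift (- (a *\<^sub>R b)) (l2_half b f)) = l2_half b (l2_shift (- (a *\<^sub>R b)) f)"
proof (cases f rule: l2_cases)
  case (1 g)
  have "(indicator {x. 0 < x \<bullet> b} x :: complex) * (indicator {x. 0 < x \<bullet> b} (x - - (a *\<^sub>R b)) * g (x - - (a *\<^sub>R b)))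
     = indicator {x. 0 < x \<bullet> b} x * g (x - - (a *\<^sub>R b))" for x
    using assms by (auto simp: indicator_def inner_add_left)
  then show ?thesis
    by (simp only: 1(1) l2_half_abs[OF 1(2)] l2_shift_abs[OF square_integrable_half[OF 1(2)]]
        l2_shift_abs[OF 1(2)] l2_half_abs[OF square_integrable_shift[OF 1(2)]]
        l2_half_abs[OF square_integrable_shift[OF square_integrable_half[OF 1(2)]]])
qed

subsection \<open>Strong continuity of translations\<close>

text \<open>For an isometry, the squared distance from \<open>F\<close> to its image is 2 ||F||^2
  minus twice the real inner product, here the overlap of \<open>B\<close> with its translate.
  Enclosing \<open>B\<close> in a slightly larger open set bounds this overlap from below.\<close>

lemma l2_shift_indicator_LIMSEQ:
  fixes v :: "nat \<Rightarrow> 'a::euclidean_space"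
  assumes B[measurable]: "B \<in> sets borel" and fin: "emeasure lborel B < \<infinity>" and v: "v \<longlonglongrightarrow> 0"
    and F: "F = abs_l2 (\<lambda>x. indicator B x)"
  shows "(\<lambda>n. l2_shift (v n) F) \<longlonglongrightarrow> F"
proof (rule LIMSEQ_I)
  fix e :: real assume e: "0 < e"
  \<comment> \<open>Two errors of size \<open>d\<close>, one from the enclosing open set and one
    from the limit, each enter the squared distance with factor 2; hence 4 d = e^2.\<close>
  define d where "d = e\<^sup>2 / 4"
  have d: "0 < d" using e by (simp add: d_def)
  obtain U where U: "open U" "B \<subseteq> U" "emeasure lborel (U - B) < d"
    using outer_regular_lborel[OF B d] .
  have [measurable]: "U \<in> sets borel" using U by simp
  have iB: "integrable lborel (\<lambda>x. indicator B x :: real)"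
    using fin by (simp add: integrable_indicator_iff)
  have iB': "integrable lborel (\<lambda>x. indicator B (x - w) :: real)" for w
    by (rule integrable_lborel_shift[OF iB])
  have iUB: "integrable lborel (\<lambda>x. indicator (U - B) x :: real)"
    using U by (simp add: integrable_indicator_iff order.strict_trans)
  have sB: "square_integrable (\<lambda>x. indicator B x)"
    unfolding square_integrable_def
  proof
    show "integrable lborel (\<lambda>x. (cmod (indicator B x))\<^sup>2)"
      by (rule Bochner_Integration.integrable_cong[THEN iffD1, OF refl _ iB]) (simp add: indicator_def)
  qed measurable
  have nF: "(norm F)\<^sup>2 = (\<integral>x. indicator B x \<partial>lborel)"
    unfolding F norm_abs_l2[OF sB]
    by (rule Bochner_Integration.integral_cong) (auto simp: indicator_def)
  have inn: "Re (cinner F (l2_shift w F)) = (\<integral>x. indicator B x * indicator B (x - w) \<partial>lborel)" for w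
  proof -
    have "cinner F (l2_shift w F) = (\<integral>x. complex_of_real (indicator B x * indicator B (x - w)) \<partial>lborel)"
      unfolding F l2_shift_abs[OF sB] cinner_abs_l2[OF sB square_integrable_shift[OF sB]]
      by (rule Bochner_Integration.integral_cong) (auto simp: indicator_def)
    then show ?thesis by (metis Re_complex_of_real integral_complex_of_real)
  qed
  have lower: "(\<integral>x. indicator B x * indicator U (x + w) \<partial>lborel) - d \<le> Re (cinner F (l2_shift w F))" for w
  proof -
    have "(\<integral>x. indicator B x * indicator U (x + w) \<partial>lborel)
        = (\<integral>x. indicator B (x - w) * indicator U x \<partial>lborel :: real)"
      using integral_lborel_shift[of "\<lambda>x. indicator B x * indicator U (x + w) :: real" w] by simp
    also have "\<dots> \<le> (\<integral>x. indicator B x * indicator B (x - w) + indicator (U - B) x \<partial>lborel)"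
    proof (rule integral_mono)
      show "integrable lborel (\<lambda>x. indicator B (x - w) * indicator U x :: real)"
        by (rule Bochner_Integration.integrable_bound[OF iB'[of w]]) (auto simp: indicator_def)
      show "integrable lborel (\<lambda>x. indicator B x * indicator B (x - w) + indicator (U - B) x :: real)"
        by (intro Bochner_Integration.integrable_add iUB Bochner_Integration.integrable_bound[OF iB])
          (auto simp: indicator_def)
    qed (auto simp: indicator_def)
    also have "\<dots> = Re (cinner F (l2_shift w F)) + (\<integral>x. indicator (U - B) x \<partial>lborel)"
      unfolding inn
      by (intro Bochner_Integration.integral_add iUB Bochner_Integration.integrable_bound[OF iB])
          (auto simp: indicator_def)
    also have "(\<integral>x. indicator (U - B) x \<partial>lborel) \<le> d"
    proof -
      have "ennreal (measure lborel (U - B)) \<le> ennreal d"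
        using U(3) by (subst emeasure_eq_ennreal_measure[symmetric]) auto
      then show ?thesis using d by (simp add: ennreal_le_iff)
    qed
    finally show ?thesis by simp
  qed
  have "(\<lambda>n. \<integral>x. indicator B x * indicator U (x + v n) \<partial>lborel) \<longlonglongrightarrow> (\<integral>x. indicator B x \<partial>lborel :: real)"
  proof (rule integral_dominated_convergence[OF _ _ iB])
    show "AE x in lborel. (\<lambda>n. indicator B x * indicator U (x + v n)) \<longlonglongrightarrow> (indicator B x :: real)"
    proof (rule AE_I2)
      fix x :: 'a
      show "(\<lambda>n. indicator B x * indicator U (x + v n)) \<longlonglongrightarrow> (indicator B x :: real)"
      proof (cases "x \<in> B")
        case True
        \<comment> \<open>Openness of \<open>U\<close> gives pointwise convergence; \<open>B\<close>
          itself may have empty interior.\<close>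
        then have "x \<in> U" using U by auto
        moreover have "(\<lambda>n. x + v n) \<longlonglongrightarrow> x + 0" by (intro tendsto_intros v)
        ultimately have "\<forall>\<^sub>F n in sequentially. x + v n \<in> U"
          using U(1) by (auto dest: topological_tendstoD)
        then have "\<forall>\<^sub>F n in sequentially. indicator B x * indicator U (x + v n) = (indicator B x :: real)"
          by eventually_elim (auto simp: indicator_def)
        then show ?thesis by (rule tendsto_eventually)
      qed simp
    qed
  qed (auto simp: indicator_def)
  from LIMSEQ_D[OF this d] obtain N
    where N: "\<And>n. n \<ge> N \<Longrightarrow> \<bar>(\<integral>x. indicator B x * indicator U (x + v n) \<partial>lborel) - (norm F)\<^sup>2\<bar> < d"
    by (auto simp: nF)
  have "norm (l2_shift (v n) F - F) < e" if "n \<ge> N" for n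
  proof -
    have "(norm (l2_shift (v n) F - F))\<^sup>2 = 2 * (norm F)\<^sup>2 - 2 * Re (cinner F (l2_shift (v n) F))"
    proof -
      have "(norm (l2_shift (v n) F - F))\<^sup>2
          = (norm (l2_shift (v n) F))\<^sup>2 - 2 * inner F (l2_shift (v n) F) + (norm F)\<^sup>2"
        by (simp add: power2_norm_eq_inner inner_diff_left inner_diff_right inner_commute
            del: norm_l2_shift)
      then show ?thesis by (simp add: inner_l2_def)
    qed
    also have "\<dots> < 4 * d"
      using N[OF that] lower[of "v n"] by linarith
    finally have "(norm (l2_shift (v n) F - F))\<^sup>2 < e\<^sup>2" by (simp add: d_def)
    then show ?thesis by (rule power_less_imp_less_base) (use e in simp)
  qed
  then show "\<exists>N. \<forall>n\<ge>N. norm (l2_shift (v n) F - F) < e" by blast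
qed

text \<open>A square integrable simple function is a finite combination of indicators, and each
  nonzero value is taken on a set of finite measure.\<close>

lemma l2_shift_simple_LIMSEQ:
  fixes v :: "nat \<Rightarrow> 'a::euclidean_space"
  assumes s: "simple_function lborel s" "square_integrable s" and v: "v \<longlonglongrightarrow> 0"
  shows "(\<lambda>n. l2_shift (v n) (abs_l2 s)) \<longlonglongrightarrow> abs_l2 s"
proof -
  define p where "p Y x = (\<Sum>y\<in>Y. y * indicator (s -` {y}) x)" for Y :: "complex set" and x
  have fin: "finite (s ` UNIV)" using s(1) by (simp add: simple_function_def)
  have "square_integrable (p Y) \<and> (\<lambda>n. l2_shift (v n) (abs_l2 (p Y))) \<longlonglongrightarrow> abs_l2 (p Y)"
    if "finite Y" "Y \<subseteq> s ` UNIV" for Y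
    using that
  proof (induction Y)
    case empty
    have "abs_l2 (\<lambda>_::'a. 0::complex) = 0" by (simp add: zero_l2.abs_eq)
    moreover have "l2_shift w (0 :: 'a l2) = 0" for w
      using l2_shift_diff[of w 0 0] by simp
    ultimately show ?case by (simp add: p_def[abs_def] square_integrable_0)
  next
    case (insert y Y)
    then have IH: "square_integrable (p Y)" "(\<lambda>n. l2_shift (v n) (abs_l2 (p Y))) \<longlonglongrightarrow> abs_l2 (p Y)"
      by auto
    show ?case
    \<comment> \<open>The level set of 0 may have infinite measure, but its term vanishes and is
      dropped.\<close>
    proof (cases "y = 0")
      case True
      then have "p (insert y Y) = p Y" 
        unfolding p_def[abs_def] sum.insert[OF insert(1,2)] by (simp only: True mult_zero_left add_0)
      then show ?thesis using IH by simp
    next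
      case False
      let ?B = "s -` {y}"
      have B[measurable]: "?B \<in> sets borel"
        using simple_functionD(2)[OF s(1), of "{y}"] by simp
      have "integrable lborel (\<lambda>x. (cmod (s x))\<^sup>2)"
        using s(2) by (simp add: square_integrable_def)
      then have "integrable lborel (\<lambda>x. (cmod y)\<^sup>2 * indicator ?B x)"
      proof (rule Bochner_Integration.integrable_bound)
        show "(\<lambda>x. (cmod y)\<^sup>2 * indicator ?B x) \<in> borel_measurable lborel" by measurable
      qed (auto simp: indicator_def)
      then have iB: "integrable lborel (\<lambda>x. indicator ?B x :: real)"
        using False by simp
      then have fB: "emeasure lborel ?B < \<infinity>"
        by (simp add: integrable_indicator_iff)
      have sB: "square_integrable (\<lambda>x. indicator ?B x)"
        unfolding square_integrable_def
      proof
        show "integrable lborel (\<lambda>x. (cmod (indicator ?B x))\<^sup>2)"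
          by (rule Bochner_Integration.integrable_cong[THEN iffD1, OF refl _ iB]) (simp add: indicator_def)
      qed measurable
      have p: "p (insert y Y) = (\<lambda>x. y * indicator ?B x + p Y x)"
        unfolding p_def[abs_def] sum.insert[OF insert(1,2)] ..
      have eq: "abs_l2 (p (insert y Y)) = cscale y (abs_l2 (indicator ?B)) + abs_l2 (p Y)"
        using sB IH(1) by (simp add: p cscale_abs_l2 add_abs_l2 square_integrable_scale)
      have lim: "(\<lambda>n. l2_shift (v n) (abs_l2 (indicator ?B))) \<longlonglongrightarrow> abs_l2 (indicator ?B)"
        by (rule l2_shift_indicator_LIMSEQ[OF B fB v]) simp
      have "(\<lambda>n. cscale y (l2_shift (v n) (abs_l2 (indicator ?B)))) \<longlonglongrightarrow> cscale y (abs_l2 (indicator ?B))"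
        by (rule bounded_linear.tendsto[OF bounded_linear_cscale lim])
      with IH(2) have "(\<lambda>n. l2_shift (v n) (abs_l2 (p (insert y Y)))) \<longlonglongrightarrow> abs_l2 (p (insert y Y))"
        unfolding eq l2_shift_add l2_shift_cscale by (rule tendsto_add[rotated])
      moreover have "square_integrable (p (insert y Y))"
        unfolding p by (intro square_integrable_add square_integrable_scale sB IH)
      ultimately show ?thesis by blast
    qed
  qed
  moreover have "p (s ` UNIV) = s"
  proof
    fix x
    have "p (s ` UNIV) x = (\<Sum>y\<in>s ` UNIV. if y = s x then y else 0)"
      unfolding p_def by (rule sum.cong) (auto simp: indicator_def)
    then show "p (s ` UNIV) x = s x" using fin by simp
  qed
  ultimately show ?thesis using fin by force
qed

text \<open>Dominated convergence for simple functions with |s i| at most 2 |f|. Then |s i - f| is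
  at most 3 |f|, which explains the majorant 9 |f|^2.\<close>

lemma l2_simple_dense:
  fixes F :: "'a::euclidean_space l2"
  assumes "0 < e"
  obtains s where "simple_function lborel s" "square_integrable s" "norm (abs_l2 s - F) < e"
proof -
  obtain f where F: "F = abs_l2 f" and f: "square_integrable f" by (rule l2_cases)
  have fm[measurable]: "f \<in> borel_measurable lborel" using f by (simp add: square_integrable_def)
  obtain s where s: "\<And>i. simple_function lborel (s i)" "\<And>x. (\<lambda>i. s i x) \<longlonglongrightarrow> f x"
      "\<And>i x. dist (s i x) 0 \<le> 2 * dist (f x) 0"
    using borel_measurable_implies_sequence_metric[OF fm, of 0] by auto
  have [measurable]: "s i \<in> borel_measurable lborel" for i
    using s(1) by (rule borel_measurable_simple_function)
  have i9: "integrable lborel (\<lambda>x. 9 * (cmod (f x))\<^sup>2)"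
    using f by (simp add: square_integrable_def)
  have sq: "(cmod (s i x))\<^sup>2 \<le> 9 * (cmod (f x))\<^sup>2" "(cmod (s i x - f x))\<^sup>2 \<le> 9 * (cmod (f x))\<^sup>2" for i x
  proof -
    have "cmod (s i x) \<le> 2 * cmod (f x)"
      using s(3)[of i x] by simp
    then have "cmod (s i x) \<le> 3 * cmod (f x)" "cmod (s i x - f x) \<le> 3 * cmod (f x)"
      using norm_triangle_ineq4[of "s i x" "f x"] norm_ge_zero[of "f x"] by linarith+
    from this[THEN power_mono, of 2] show "(cmod (s i x))\<^sup>2 \<le> 9 * (cmod (f x))\<^sup>2"
      "(cmod (s i x - f x))\<^sup>2 \<le> 9 * (cmod (f x))\<^sup>2"
      by (simp_all add: power_mult_distrib)
  qed
  have ss: "square_integrable (s i)" for i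
    unfolding square_integrable_def
    by (intro conjI Bochner_Integration.integrable_bound[OF i9]) (use sq in auto)
  have "(\<lambda>i. \<integral>x. (cmod (s i x - f x))\<^sup>2 \<partial>lborel) \<longlonglongrightarrow> (\<integral>x. 0 \<partial>(lborel :: 'a measure))"
  proof (rule integral_dominated_convergence[OF _ _ i9])
    show "AE x in lborel. (\<lambda>i. (cmod (s i x - f x))\<^sup>2) \<longlonglongrightarrow> 0"
    proof (rule AE_I2)
      fix x
      have "(\<lambda>i. (cmod (s i x - f x))\<^sup>2) \<longlonglongrightarrow> (cmod (f x - f x))\<^sup>2"
        by (intro tendsto_intros s)
      then show "(\<lambda>i. (cmod (s i x - f x))\<^sup>2) \<longlonglongrightarrow> 0" by simp
    qed
  qed (use sq in auto)
  then have "(\<lambda>i. (norm (abs_l2 (s i) - F))\<^sup>2) \<longlonglongrightarrow> 0"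
    by (simp add: F diff_abs_l2 ss f norm_abs_l2 square_integrable_diff)
  from LIMSEQ_D[OF this, of "e\<^sup>2"] assms obtain i where "(norm (abs_l2 (s i) - F))\<^sup>2 < e\<^sup>2"
    by auto
  then have "norm (abs_l2 (s i) - F) < e"
    by (rule power_less_imp_less_base) (use assms in simp)
  then show thesis using that s(1) ss by blast
qed

text \<open>Translations are isometries, so the error of replacing \<open>F\<close> by a simple
  function enters twice, uniformly in \<open>n\<close>.\<close>

lemma l2_shift_LIMSEQ:
  fixes v :: "nat \<Rightarrow> 'a::euclidean_space"
  assumes v: "v \<longlonglongrightarrow> 0"
  shows "(\<lambda>n. l2_shift (v n) F) \<longlonglongrightarrow> F"
proof (rule LIMSEQ_I)
  fix e :: real assume e: "0 < e"
  obtain s where s: "simple_function lborel s" "square_integrable s" "norm (abs_l2 s - F) < e / 3"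
    using l2_simple_dense[of "e/3" F] e by auto
  let ?S = "abs_l2 s"
  obtain N where N: "\<And>n. n \<ge> N \<Longrightarrow> norm (l2_shift (v n) ?S - ?S) < e / 3"
    using LIMSEQ_D[OF l2_shift_simple_LIMSEQ[OF s(1,2) v], of "e/3"] e by auto
  have "norm (l2_shift (v n) F - F) < e" if "n \<ge> N" for n
  proof -
    have "l2_shift (v n) F - F = (l2_shift (v n) ?S - ?S) + ((?S - F) - l2_shift (v n) (?S - F))"
      by (simp add: l2_shift_diff)
    also have "norm \<dots> \<le> norm (l2_shift (v n) ?S - ?S) + (norm (?S - F) + norm (l2_shift (v n) (?S - F)))"
      by (intro norm_triangle_le add_left_mono norm_triangle_ineq4)
    also have "\<dots> < e" using N[OF that] s(3) by simp
    finally show ?thesis .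
  qed
  then show "\<exists>N. \<forall>n\<ge>N. norm (l2_shift (v n) F - F) < e" by blast
qed

lemma continuous_on_l2_shift: "continuous_on UNIV (\<lambda>v. l2_shift v F)"
  unfolding continuous_on_sequentially
proof (intro allI ballI impI)
  fix x :: "nat \<Rightarrow> 'a" and a
  assume "(\<forall>n. x n \<in> UNIV) \<and> x \<longlonglongrightarrow> a"
  then have "(\<lambda>n. x n - a) \<longlonglongrightarrow> 0" by (simp add: LIM_zero)
  then have "(\<lambda>n. l2_shift (x n - a) (l2_shift a F)) \<longlonglongrightarrow> l2_shift a F"
    by (rule l2_shift_LIMSEQ)
  then show "((\<lambda>v. l2_shift v F) \<circ> x) \<longlonglongrightarrow> l2_shift a F"
    by (simp add: l2_shift_shift o_def)
qed


subsection \<open>A semigroup of isometries with vanishing adjoints\<close>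

text \<open>Translating the whole space would be unitary, with adjoints that preserve the norm.
  Tearing the two halves apart leaves a gap and gives a proper isometry for \<open>a > 0\<close> and
  unit \<open>b\<close>, a continuous analogue of the unilateral shift.\<close>

definition l2_push :: "'a::euclidean_space \<Rightarrow> real \<Rightarrow> 'a l2 \<Rightarrow> 'a l2" where
  "l2_push b a f = l2_shift (a *\<^sub>R b) (l2_half b f) + l2_shift (- (a *\<^sub>R b)) (f - l2_half b f)"

text \<open>For unit \<open>b\<close> and nonnegative \<open>a\<close> this erases the function on
  the slab where \<open>x \<bullet> b\<close> lies between \<open>-a\<close> and \<open>a\<close>
  and moves the two remaining pieces back together.\<close>

definition l2_pull :: "'a::euclidean_space \<Rightarrow> real \<Rightarrow> 'a l2 \<Rightarrow> 'a l2" where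
  "l2_pull b a f =
     l2_half b (l2_shift (- (a *\<^sub>R b)) f) + (l2_shift (a *\<^sub>R b) f - l2_half b (l2_shift (a *\<^sub>R b) f))"

lemma cinner_l2_push_left: "cinner (l2_push b a f) g = cinner f (l2_pull b a g)"
  by (simp add: l2_push_def l2_pull_def cinner_add_left cinner_add_right cinner_diff_left
      cinner_diff_right cinner_l2_shift_left cinner_l2_half_left)

lemma l2_push_add: "l2_push b a (f + g) = l2_push b a f + l2_push b a g"
  by (simp add: l2_push_def l2_half_add l2_shift_add l2_shift_diff)

lemma l2_push_cscale: "l2_push b a (cscale c f) = cscale c (l2_push b a f)"
  by (simp add: l2_push_def l2_half_cscale l2_shift_cscale l2_shift_diff cscale_diff_right cscale_add_right)

lemma l2_pull_add: "l2_pull b a (f + g) = l2_pull b a f + l2_pull b a g"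
  by (simp add: l2_pull_def l2_half_add l2_shift_add)

lemma l2_pull_cscale: "l2_pull b a (cscale c f) = cscale c (l2_pull b a f)"
  by (simp add: l2_pull_def l2_half_cscale l2_shift_cscale cscale_diff_right cscale_add_right)

lemma l2_push_0 [simp]: "l2_push b 0 f = f"
  by (simp add: l2_push_def)

lemma l2_pull_0 [simp]: "l2_pull b 0 f = f"
  by (simp add: l2_pull_def)

text \<open>Each piece moved out and back is restored. The cross terms displace a piece by
  \<open>2 * a\<close> further away from the opposite half space, so the cut-offs kill them; this is
  the content of the facts \<open>1\<close> and \<open>2\<close>.\<close>

lemma l2_pull_push:
  assumes "0 \<le> a" "b \<bullet> b = 1"
  shows "l2_pull b a (l2_push b a f) = f"
proof -
  let ?v = "a *\<^sub>R b"
  have 1: "l2_half b (l2_shift (- ?v) (l2_shift (- ?v) g)) =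
      l2_half b (l2_shift (- ?v) (l2_shift (- ?v) (l2_half b g)))" for g
    using l2_half_shift_minus[of "2 * a" b g] assms
    by (simp add: l2_shift_shift scaleR_2[symmetric] scaleR_left_distrib[symmetric])
  have 2: "l2_half b (l2_shift ?v (l2_shift ?v (l2_half b g))) = l2_shift ?v (l2_shift ?v (l2_half b g))" for g
    using l2_half_shift_half[of "2 * a" b g] assms
    by (simp add: l2_shift_shift scaleR_2[symmetric] scaleR_left_distrib[symmetric])
  have 3: "l2_shift (- ?v) (l2_shift ?v g) = g" "l2_shift ?v (l2_shift (- ?v) g) = g" for g
    by (simp_all add: l2_shift_shift)
  show ?thesis
    unfolding l2_pull_def l2_push_def
    by (simp add: l2_shift_add l2_shift_diff l2_half_add l2_half_diff 3 2)
      (simp add: 1[of f])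
qed

lemma norm_l2_push:
  assumes "0 \<le> a" "b \<bullet> b = 1"
  shows "norm (l2_push b a f) = norm f"
  by (simp add: norm_l2_def inner_l2_def cinner_l2_push_left l2_pull_push[OF assms])

text \<open>Adjoint of an isometry: ||W f||^2 is the inner product of V W f with f, and
  Cauchy-Schwarz finishes.\<close>

lemma norm_l2_pull_le:
  assumes "0 \<le> a" "b \<bullet> b = 1"
  shows "norm (l2_pull b a f) \<le> norm f"
proof -
  have "(norm (l2_pull b a f))\<^sup>2 = inner (l2_push b a (l2_pull b a f)) f"
    by (simp add: power2_norm_eq_inner inner_l2_def cinner_l2_push_left)
  also have "\<dots> \<le> norm (l2_push b a (l2_pull b a f)) * norm f"
    by (rule norm_cauchy_schwarz)
  finally have "norm (l2_pull b a f) * norm (l2_pull b a f) \<le> norm (l2_pull b a f) * norm f"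
    by (simp add: norm_l2_push[OF assms] power2_eq_square)
  then show ?thesis
    by (cases "l2_pull b a f = 0") auto
qed

lemma bounded_linear_l2_half: "bounded_linear (l2_half b)"
proof (rule bounded_linear_intro[of _ 1])
  show "l2_half b (r *\<^sub>R f) = r *\<^sub>R l2_half b f" for r f
    by (simp add: scaleR_l2_def l2_half_cscale)
qed (simp_all add: l2_half_add norm_l2_half_le)

lemma continuous_on_l2_push: "continuous_on UNIV (\<lambda>a. l2_push b a f)"
  unfolding l2_push_def
  by (intro continuous_intros continuous_on_compose2[OF continuous_on_l2_shift]) auto

lemma continuous_on_l2_pull: "continuous_on UNIV (\<lambda>a. l2_pull b a f)"
  unfolding l2_pull_def
  by (intro continuous_intros continuous_on_compose2[OF continuous_on_l2_shift]
      bounded_linear.continuous_on[OF bounded_linear_l2_half]) auto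

text \<open>After a change of variables the two orthogonal pieces carry exactly the mass of
  \<open>f\<close> on the tails \<open>a < x \<bullet> b\<close> and
  \<open>x \<bullet> b \<le> - a\<close>, which vanishes by dominated convergence.\<close>

lemma l2_pull_tendsto_0:
  assumes b: "b \<bullet> b = 1"
  shows "((\<lambda>a. l2_pull b a f) \<longlongrightarrow> 0) at_top"
proof (cases f rule: l2_cases)
  case (1 g)
  have [measurable]: "g \<in> borel_measurable borel" using 1 by (simp add: square_integrable_def)
  have ig: "integrable lborel (\<lambda>x. (cmod (g x))\<^sup>2)" using 1 by (simp add: square_integrable_def)
  note sh = square_integrable_shift[OF 1(2)]
  have lim: "((\<lambda>a. \<integral>x. indicator (S a) x * (cmod (g x))\<^sup>2 \<partial>lborel) \<longlongrightarrow> 0) at_top"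
    if [measurable]: "\<And>a. S a \<in> sets borel" and S: "\<And>a x. x \<in> S a \<Longrightarrow> a \<le> \<bar>x \<bullet> b\<bar>" for S :: "real \<Rightarrow> 'a set"
  proof -
    have "((\<lambda>a. \<integral>x. indicator (S a) x * (cmod (g x))\<^sup>2 \<partial>lborel) \<longlongrightarrow> (\<integral>x. 0 \<partial>(lborel :: 'a measure))) at_top"
    proof (rule integral_dominated_convergence_at_top[OF _ _ ig])
      show "AE x in lborel. ((\<lambda>a. indicator (S a) x * (cmod (g x))\<^sup>2) \<longlongrightarrow> 0) at_top"
      proof (rule AE_I2)
        fix x
        have "\<forall>\<^sub>F a in at_top. indicator (S a) x * (cmod (g x))\<^sup>2 = 0"
          using eventually_gt_at_top[of "\<bar>x \<bullet> b\<bar>"]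
          by eventually_elim (use S in \<open>force simp: indicator_def\<close>)
        then show "((\<lambda>a. indicator (S a) x * (cmod (g x))\<^sup>2) \<longlongrightarrow> 0) at_top"
          by (rule tendsto_eventually)
      qed
      show "\<forall>\<^sub>F a in at_top. AE x in lborel. norm (indicator (S a) x * (cmod (g x))\<^sup>2) \<le> (cmod (g x))\<^sup>2"
        by (auto simp: indicator_def)
    qed measurable
    then show ?thesis by simp
  qed
  have n1: "(norm (l2_half b (l2_shift (- (a *\<^sub>R b)) f)))\<^sup>2
      = (\<integral>x. indicator {x. a < x \<bullet> b} x * (cmod (g x))\<^sup>2 \<partial>lborel)" for a
  proof -
    have "(norm (l2_half b (l2_shift (- (a *\<^sub>R b)) f)))\<^sup>2
        = (\<integral>x. (cmod (indicator {x. 0 < x \<bullet> b} x * g (x - - (a *\<^sub>R b))))\<^sup>2 \<partial>lborel)"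
      by (simp only: 1(1) l2_shift_abs[OF 1(2)] l2_half_abs[OF sh]
          norm_abs_l2[OF square_integrable_half[OF sh]])
    also have "\<dots> = (\<integral>x. indicator {x. a < x \<bullet> b} (x - - (a *\<^sub>R b)) * (cmod (g (x - - (a *\<^sub>R b))))\<^sup>2 \<partial>lborel)"
      by (rule Bochner_Integration.integral_cong) (auto simp: indicator_def inner_add_left b)
    also have "\<dots> = (\<integral>x. indicator {x. a < x \<bullet> b} x * (cmod (g x))\<^sup>2 \<partial>lborel)"
      by (rule integral_lborel_shift) measurable
    finally show ?thesis .
  qed
  have n2: "(norm (l2_shift (a *\<^sub>R b) f - l2_half b (l2_shift (a *\<^sub>R b) f)))\<^sup>2
      = (\<integral>x. indicator {x. x \<bullet> b \<le> - a} x * (cmod (g x))\<^sup>2 \<partial>lborel)" for a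
  proof -
    have "(norm (l2_shift (a *\<^sub>R b) f - l2_half b (l2_shift (a *\<^sub>R b) f)))\<^sup>2
        = (\<integral>x. (cmod (g (x - a *\<^sub>R b) - indicator {x. 0 < x \<bullet> b} x * g (x - a *\<^sub>R b)))\<^sup>2 \<partial>lborel)"
      by (simp only: 1(1) l2_shift_abs[OF 1(2)] l2_half_abs[OF sh]
          diff_abs_l2[OF sh square_integrable_half[OF sh]]
          norm_abs_l2[OF square_integrable_diff[OF sh square_integrable_half[OF sh]]])
    also have "\<dots> = (\<integral>x. indicator {x. x \<bullet> b \<le> - a} (x - a *\<^sub>R b) * (cmod (g (x - a *\<^sub>R b)))\<^sup>2 \<partial>lborel)"
      by (rule Bochner_Integration.integral_cong) (auto simp: indicator_def inner_diff_left b)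
    also have "\<dots> = (\<integral>x. indicator {x. x \<bullet> b \<le> - a} x * (cmod (g x))\<^sup>2 \<partial>lborel)"
      by (rule integral_lborel_shift) measurable
    finally show ?thesis .
  qed
  have sq: "(h \<longlongrightarrow> 0) at_top" if "((\<lambda>a. (norm (h a))\<^sup>2) \<longlongrightarrow> 0) at_top" for h :: "real \<Rightarrow> 'a l2"
    using tendsto_real_sqrt[OF that] by (simp add: tendsto_norm_zero_iff)
  have "((\<lambda>a. l2_half b (l2_shift (- (a *\<^sub>R b)) f)) \<longlongrightarrow> 0) at_top"
    by (rule sq, unfold n1, rule lim) auto
  moreover have "((\<lambda>a. l2_shift (a *\<^sub>R b) f - l2_half b (l2_shift (a *\<^sub>R b) f)) \<longlongrightarrow> 0) at_top"
    by (rule sq, unfold n2, rule lim) auto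
  ultimately show ?thesis
    unfolding l2_pull_def using tendsto_add by fastforce
qed

section \<open>Unitary operators\<close>

definition unitary_inv :: "('l::euclidean_space l2 \<Rightarrow>\<^sub>L 'l l2) \<Rightarrow> ('l l2 \<Rightarrow>\<^sub>L 'l l2)" where
  "unitary_inv T = Blinfun (inv_into UNIV (blinfun_apply T))"

lemma unitary_op_isometry:
  assumes "unitary_op T"
  shows "norm (blinfun_apply T f) = norm f"
  using assms by (simp add: unitary_op_def norm_l2_def inner_l2_def)

lemma unitary_op_bij:
  assumes "unitary_op T"
  shows "bij (blinfun_apply T)"
proof (rule bijI)
  show "inj (blinfun_apply T)"
  proof (rule injI)
    fix f g assume "blinfun_apply T f = blinfun_apply T g"
    then have "blinfun_apply T (f - g) = 0" by (simp add: blinfun.diff_right)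
    then show "f = g" using unitary_op_isometry[OF assms, of "f - g"] by simp
  qed
qed (use assms in \<open>simp add: unitary_op_def\<close>)

lemma unitary_op_inv_simps:
  assumes "unitary_op T"
  shows "blinfun_apply T (inv_into UNIV (blinfun_apply T) f) = f" "inv_into UNIV (blinfun_apply T) (blinfun_apply T f) = f"
  using unitary_op_bij[OF assms] by (simp_all add: bij_is_surj bij_is_inj surj_f_inv_f)

text \<open>Preservation of \<open>cinner\<close> supplies the bound, and the right inverse
  \<open>S'\<close> supplies surjectivity.\<close>

lemma unitary_opI:
  assumes "\<And>f g. S (f + g) = S f + S g" "\<And>c f. S (cscale c f) = cscale c (S f)"
    and "\<And>f g. cinner (S f) (S g) = cinner f g" "\<And>f. S (S' f) = f"
  shows "bounded_linear S" "unitary_op (Blinfun S)"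
proof -
  show bl: "bounded_linear S"
  proof (rule bounded_linear_intro[of _ 1])
    show "S (r *\<^sub>R f) = r *\<^sub>R S f" for r f by (simp add: scaleR_l2_def assms)
    show "norm (S f) \<le> norm f * 1" for f by (simp add: norm_l2_def inner_l2_def assms)
  qed (rule assms)
  have "surj S" by (rule surjI[of S S']) (rule assms)
  with bl show "unitary_op (Blinfun S)"
    using assms by (simp add: unitary_op_def clinear_op_def bounded_linear_Blinfun_apply)
qed

lemma
  assumes "unitary_op T"
  shows unitary_inv_apply: "blinfun_apply (unitary_inv T) f = inv_into UNIV (blinfun_apply T) f"
    and unitary_op_unitary_inv: "unitary_op (unitary_inv T)"
proof -
  note T = unitary_op_inv_simps[OF assms]
  have c: "blinfun_apply T (cscale c f) = cscale c (blinfun_apply T f)" for c f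
    using assms by (simp add: unitary_op_def clinear_op_def)
  have i: "cinner (blinfun_apply T f) (blinfun_apply T g) = cinner f g" for f g
    using assms by (simp add: unitary_op_def)
  let ?S = "inv_into UNIV (blinfun_apply T)"
  have 1: "?S (f + g) = ?S f + ?S g" for f g by (metis T blinfun.add_right)
  have 2: "?S (cscale c f) = cscale c (?S f)" for c f by (metis T c)
  have 3: "cinner (?S f) (?S g) = cinner f g" for f g by (metis T i)
  note unitary_opI[of ?S, OF 1 2 3 T(2)]
  then show "blinfun_apply (unitary_inv T) f = inv_into UNIV (blinfun_apply T) f" "unitary_op (unitary_inv T)"
    by (simp_all add: unitary_inv_def bounded_linear_Blinfun_apply)
qed

lemma unitary_inv_simps [simp]:
  assumes "unitary_op T"
  shows "blinfun_apply T (blinfun_apply (unitary_inv T) f) = f"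
    "blinfun_apply (unitary_inv T) (blinfun_apply T f) = f"
  by (simp_all add: assms unitary_inv_apply unitary_op_inv_simps)

lemma unitary_op_compose:
  assumes "unitary_op S" "unitary_op T"
  shows "unitary_op (S o\<^sub>L T)"
proof -
  have "surj (blinfun_apply S \<circ> blinfun_apply T)"
    using assms by (intro comp_surj) (auto simp: unitary_op_def)
  then show ?thesis using assms by (simp add: unitary_op_def clinear_op_def o_def)
qed

lemma unitary_op_id [simp]: "unitary_op id_blinfun"
  by (simp add: unitary_op_def clinear_op_def surj_def)

lemma unitary_inv_eqI:
  assumes "unitary_op T" "T o\<^sub>L S = id_blinfun"
  shows "unitary_inv T = S"
proof -
  have "blinfun_apply T (blinfun_apply S f) = f" for f
    using arg_cong[OF assms(2), of "\<lambda>B. blinfun_apply B f"] by simp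
  then show ?thesis
    using unitary_inv_simps(2)[OF assms(1)] by (intro blinfun_eqI) metis
qed

lemma cinner_unitary_inv:
  assumes "unitary_op T"
  shows "cinner f (blinfun_apply (unitary_inv T) g) = cinner (blinfun_apply T f) g"
proof -
  have "cinner (blinfun_apply T f) (blinfun_apply T (blinfun_apply (unitary_inv T) g)) =
      cinner f (blinfun_apply (unitary_inv T) g)"
    using assms unfolding unitary_op_def by blast
  then show ?thesis by (simp only: unitary_inv_simps(1)[OF assms])
qed

text \<open>Pointwise convergence suffices for a moving argument because nonexpansive maps do not
  enlarge the error \<open>x i - l\<close>. This replaces norm convergence of operators wherever
  strongly continuous families are composed.\<close>

lemma tendsto_contraction_apply:
  fixes T :: "'i \<Rightarrow> 'a::real_normed_vector \<Rightarrow> 'b::real_normed_vector"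
  assumes T: "\<forall>\<^sub>F i in F. \<forall>x y. norm (T i x - T i y) \<le> norm (x - y)"
    and x: "(x \<longlongrightarrow> l) F" and y: "((\<lambda>i. T i l) \<longlongrightarrow> y) F"
  shows "((\<lambda>i. T i (x i)) \<longlongrightarrow> y) F"
proof -
  have "((\<lambda>i. T i (x i) - T i l) \<longlongrightarrow> 0) F"
  proof (rule Lim_null_comparison)
    show "\<forall>\<^sub>F i in F. norm (T i (x i) - T i l) \<le> norm (x i - l)"
      using T by eventually_elim simp
    show "((\<lambda>i. norm (x i - l)) \<longlongrightarrow> 0) F"
      using x by (simp add: LIM_zero tendsto_norm_zero)
  qed
  from tendsto_add[OF this y] show ?thesis by simp
qed

lemma unitary_op_nonexpansive:
  "unitary_op T \<Longrightarrow> norm (blinfun_apply T x - blinfun_apply T y) \<le> norm (x - y)"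
  by (simp add: unitary_op_isometry flip: blinfun.diff_right)

lemma continuous_on_unitary_apply:
  assumes u: "\<And>r. r \<in> S \<Longrightarrow> unitary_op (u r)" "\<And>f. continuous_on S (\<lambda>r. blinfun_apply (u r) f)"
    and x: "continuous_on S x"
  shows "continuous_on S (\<lambda>r. blinfun_apply (u r) (x r))"
  unfolding continuous_on_def
proof
  fix r assume r: "r \<in> S"
  show "((\<lambda>r. blinfun_apply (u r) (x r)) \<longlongrightarrow> blinfun_apply (u r) (x r)) (at r within S)"
  proof (rule tendsto_contraction_apply[where T = "\<lambda>r. blinfun_apply (u r)" and x = x])
    show "\<forall>\<^sub>F i in at r within S. \<forall>f g. norm (blinfun_apply (u i) f - blinfun_apply (u i) g) \<le> norm (f - g)"
      unfolding eventually_at_topological using u(1) unitary_op_nonexpansive by blast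
    show "(x \<longlongrightarrow> x r) (at r within S)"
      using x r by (simp add: continuous_on_def)
    show "((\<lambda>s. blinfun_apply (u s) (x r)) \<longlongrightarrow> blinfun_apply (u r) (x r)) (at r within S)"
      using u(2)[of "x r"] r by (simp only: continuous_on_def)
  qed
qed

text \<open>With \<open>g\<close> the value of the inverse at \<open>r\<close>, the isometry
  \<open>u s\<close> turns the distance between the inverse values at \<open>s\<close> and
  \<open>r\<close> into the norm of \<open>f - u s g\<close>, which is governed by strong continuity
  of \<open>u\<close> at the single vector \<open>g\<close>.\<close>

lemma continuous_on_unitary_inv:
  assumes u: "\<And>r. r \<in> S \<Longrightarrow> unitary_op (u r)" "\<And>f. continuous_on S (\<lambda>r. blinfun_apply (u r) f)"
  shows "continuous_on S (\<lambda>r. blinfun_apply (unitary_inv (u r)) f)"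
  unfolding continuous_on_def
proof
  fix r assume r: "r \<in> S"
  have "((\<lambda>s. blinfun_apply (unitary_inv (u s)) f - blinfun_apply (unitary_inv (u r)) f) \<longlongrightarrow> 0) (at r within S)"
  proof (rule Lim_null_comparison)
    let ?g = "blinfun_apply (unitary_inv (u r)) f"
    have "norm (blinfun_apply (unitary_inv (u s)) f - ?g) \<le> norm (f - blinfun_apply (u s) ?g)" if "s \<in> S" for s
    proof -
      have "blinfun_apply (u s) (blinfun_apply (unitary_inv (u s)) f - ?g) = f - blinfun_apply (u s) ?g"
        using u(1)[OF that] by (simp add: blinfun.diff_right)
      then show ?thesis
        using unitary_op_isometry[OF u(1)[OF that], of "blinfun_apply (unitary_inv (u s)) f - ?g"] by simp
    qed
    then show "\<forall>\<^sub>F s in at r within S. norm (blinfun_apply (unitary_inv (u s)) f - ?g)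
        \<le> norm (f - blinfun_apply (u s) ?g)"
      unfolding eventually_at_topological by blast
    have "((\<lambda>s. f - blinfun_apply (u s) ?g) \<longlongrightarrow> f - blinfun_apply (u r) ?g) (at r within S)"
      using u(2)[of ?g] r by (intro tendsto_diff tendsto_const) (simp add: continuous_on_def)
    then show "((\<lambda>s. norm (f - blinfun_apply (u s) ?g)) \<longlongrightarrow> 0) (at r within S)"
      using u(1)[OF r] by (simp add: tendsto_norm_zero)
  qed
  then show "((\<lambda>s. blinfun_apply (unitary_inv (u s)) f) \<longlongrightarrow> blinfun_apply (unitary_inv (u r)) f) (at r within S)"
    by (rule LIM_zero_cancel)
qed

subsection \<open>Contracting the unitary group in the strong topology\<close>

text \<open>A direction exists because \<open>Basis\<close> of a Euclidean space is nonempty; this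
  is where L must have positive dimension.\<close>

definition l2_axis :: "'l::euclidean_space" where
  "l2_axis = (SOME b. b \<in> Basis)"

lemma l2_axis_norm: "(l2_axis :: 'l::euclidean_space) \<bullet> l2_axis = 1"
proof -
  have "(l2_axis :: 'l) \<in> Basis"
    unfolding l2_axis_def by (simp add: some_in_eq)
  then show ?thesis by simp
qed

text \<open>
  With \<open>V\<close> the push by \<open>t / (1 - t)\<close> and \<open>W\<close> its adjoint, this is \<open>V u W + (1 - V W)\<close>, which acts as a copy
  of \<open>u\<close> on the range of \<open>V\<close> and trivially on its complement. As \<open>t \<longrightarrow> 1\<close>, the range of \<open>V\<close> escapes to
  infinity.
\<close>

definition contract_fun :: "real \<Rightarrow> ('l::euclidean_space l2 \<Rightarrow>\<^sub>L 'l l2) \<Rightarrow> 'l l2 \<Rightarrow> 'l l2" where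
  "contract_fun t u f = (if t < 1
     then f + l2_push l2_axis (t / (1 - t))
       (u (l2_pull l2_axis (t / (1 - t)) f) - l2_pull l2_axis (t / (1 - t)) f)
     else f)"

definition contract :: "real \<Rightarrow> ('l::euclidean_space l2 \<Rightarrow>\<^sub>L 'l l2) \<Rightarrow> 'l l2 \<Rightarrow>\<^sub>L 'l l2" where
  "contract t u = Blinfun (contract_fun t u)"

lemma cinner_l2_push_right: "cinner g (l2_push b a f) = cinner (l2_pull b a g) f"
proof -
  have "cinner g (l2_push b a f) = cnj (cinner (l2_push b a f) g)" by (rule cinner_commute)
  also have "\<dots> = cnj (cinner f (l2_pull b a g))" by (simp only: cinner_l2_push_left)
  also have "\<dots> = cinner (l2_pull b a g) f" by (rule cinner_commute[symmetric])
  finally show ?thesis .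
qed

lemma l2_pull_diff: "l2_pull b a (f - g) = l2_pull b a f - l2_pull b a g"
  by (metis add_diff_cancel_right' l2_pull_add diff_add_cancel)

lemma l2_push_diff: "l2_push b a (f - g) = l2_push b a f - l2_push b a g"
  by (metis add_diff_cancel_right' l2_push_add diff_add_cancel)

text \<open>Every identity reduces to adjointness of \<open>?V\<close> and \<open>?W\<close> and to
  \<open>WV\<close>. The parameter \<open>t / (1 - t)\<close> must be nonnegative for the latter,
  and it is infinite at \<open>t = 1\<close>, where the operator is set to the identity.\<close>

lemma
  assumes t: "0 \<le> t" and u: "unitary_op u"
  shows contract_apply: "blinfun_apply (contract t u) = contract_fun t u"
    and unitary_op_contract: "unitary_op (contract t u)"
proof -
  let ?V = "l2_push (l2_axis :: 'a) (t / (1 - t))" and ?W = "l2_pull (l2_axis :: 'a) (t / (1 - t))"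
  have WV: "?W (?V f) = f" if "t < 1" for f
    using that t by (intro l2_pull_push l2_axis_norm) auto
  have V: "cinner (?V f) g = cinner f (?W g)" "cinner g (?V f) = cinner (?W g) f" for f g
    by (rule cinner_l2_push_left, rule cinner_l2_push_right)
  have ui: "cinner (blinfun_apply u f) (blinfun_apply u g) = cinner f g" for f g
    using u by (simp add: unitary_op_def)
  have uc: "blinfun_apply u (cscale c f) = cscale c (blinfun_apply u f)" for c f
    using u by (simp add: unitary_op_def clinear_op_def)
  have 1: "contract_fun t u (f + g) = contract_fun t u f + contract_fun t u g" for f g
  proof (cases "t < 1")
    case True
    have "contract_fun t u h = h + (?V (blinfun_apply u (?W h)) - ?V (?W h))" for h
      using True by (simp only: contract_fun_def if_True l2_push_diff)
    then show ?thesis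
      by (simp only: l2_pull_add l2_push_add blinfun.add_right) (simp only: algebra_simps)
  qed (simp add: contract_fun_def)
  have 2: "contract_fun t u (cscale c f) = cscale c (contract_fun t u f)" for c f
  proof (cases "t < 1")
    case True
    then show ?thesis
      by (simp only: contract_fun_def if_True l2_pull_cscale l2_push_cscale l2_push_diff uc
          cscale_add_right cscale_diff_right)
  qed (simp add: contract_fun_def)
  have 3: "cinner (contract_fun t u f) (contract_fun t u g) = cinner f g" for f g
  proof (cases "t < 1")
    case True
    define x where "x = blinfun_apply u (?W f) - ?W f"
    define y where "y = blinfun_apply u (?W g) - ?W g"
    have "contract_fun t u f = f + ?V x" "contract_fun t u g = g + ?V y"
      using True by (simp_all add: contract_fun_def x_def y_def)
    then have "cinner (contract_fun t u f) (contract_fun t u g) =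
        cinner f g + cinner x (?W g) + (cinner (?W f) y + cinner x y)"
      (is "_ = _ + ?p + ?q") by (simp only: cinner_add_left cinner_add_right V l2_pull_add WV[OF True])
    \<comment> \<open>Since \<open>?W f + x = u (?W f)\<close> and likewise for \<open>g\<close>,
      the extra terms are the inner product after applying \<open>u\<close> minus the one
      before.\<close>
    moreover have "?p + ?q = 0"
      by (simp add: x_def y_def cinner_diff_left cinner_diff_right ui)
    ultimately show ?thesis by (simp only: add.assoc add_0_right)
  qed (simp add: contract_fun_def)
  \<comment> \<open>Contracting the inverse inverts the contraction, because \<open>?W\<close>
    recovers the part that \<open>u\<close> has moved.\<close>
  have 4: "contract_fun t u (contract_fun t (unitary_inv u) f) = f" for f
  proof (cases "t < 1")
    case True
    define x where "x = blinfun_apply (unitary_inv u) (?W f)"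
    have x: "contract_fun t (unitary_inv u) f = f + ?V (x - ?W f)"
      using True by (simp add: contract_fun_def x_def)
    have "?W (f + ?V (x - ?W f)) = x"
      by (simp add: l2_pull_add WV[OF True])
    then have "contract_fun t u (f + ?V (x - ?W f)) = f + ?V (x - ?W f) + ?V (blinfun_apply u x - x)"
      using True by (simp add: contract_fun_def)
    also have "blinfun_apply u x = ?W f" using u by (simp add: x_def)
    finally show ?thesis unfolding x by (simp add: l2_push_diff)
  qed (simp add: contract_fun_def)
  note unitary_opI[of "contract_fun t u", OF 1 2 3 4]
  then show "blinfun_apply (contract t u) = contract_fun t u" "unitary_op (contract t u)"
    by (simp_all add: contract_def bounded_linear_Blinfun_apply)
qed

lemma contract_0: "unitary_op u \<Longrightarrow> contract 0 u = u"
  by (rule blinfun_eqI) (simp add: contract_apply contract_fun_def)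

lemma contract_1: "unitary_op u \<Longrightarrow> contract 1 u = id_blinfun"
  by (rule blinfun_eqI) (simp add: contract_apply contract_fun_def)

lemma tendsto_nonexpansive_family:
  fixes T :: "real \<Rightarrow> 'a::real_normed_vector \<Rightarrow> 'b::real_normed_vector"
  assumes T: "\<And>a x y. 0 \<le> a \<Longrightarrow> norm (T a x - T a y) \<le> norm (x - y)"
    and c: "\<And>x. continuous_on UNIV (\<lambda>a. T a x)"
    and a: "(a \<longlongrightarrow> a0) F" "\<forall>\<^sub>F i in F. 0 \<le> a i" and x: "(x \<longlongrightarrow> l) F"
  shows "((\<lambda>i. T (a i) (x i)) \<longlongrightarrow> T a0 l) F"
proof (rule tendsto_contraction_apply[OF _ x])
  show "\<forall>\<^sub>F i in F. \<forall>x y. norm (T (a i) x - T (a i) y) \<le> norm (x - y)"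
    using a(2) by eventually_elim (use T in blast)
  show "((\<lambda>i. T (a i) l) \<longlongrightarrow> T a0 l) F"
    using continuous_on_tendsto_compose[OF c a(1), of l] by simp
qed

text \<open>For \<open>t r < 1\<close> this is a composition of nonexpansive, strongly continuous
  maps. At \<open>t r = 1\<close> the parameter blows up, but the operator differs from the identity
  on \<open>f\<close> by at most twice the norm of the pulled back vector, a bound independent of
  \<open>u\<close>.\<close>

lemma continuous_on_contract:
  fixes u :: "'p::topological_space \<Rightarrow> 'l::euclidean_space l2 \<Rightarrow>\<^sub>L 'l l2"
  assumes u: "\<And>r. r \<in> S \<Longrightarrow> unitary_op (u r)" "\<And>f. continuous_on S (\<lambda>r. blinfun_apply (u r) f)"
    and t: "continuous_on S t" "\<And>r. r \<in> S \<Longrightarrow> 0 \<le> t r \<and> t r \<le> 1"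
  shows "continuous_on S (\<lambda>r. blinfun_apply (contract (t r) (u r)) f)"
proof -
  let ?V = "l2_push (l2_axis :: 'l)" and ?W = "l2_pull (l2_axis :: 'l)"
  have V: "norm (?V a x - ?V a y) \<le> norm (x - y)" if "0 \<le> a" for a x y
    using that by (simp add: norm_l2_push l2_axis_norm flip: l2_push_diff)
  have W: "norm (?W a x - ?W a y) \<le> norm (x - y)" if "0 \<le> a" for a x y
    using that by (simp add: norm_l2_pull_le l2_axis_norm flip: l2_pull_diff)
  have "continuous_on S (\<lambda>r. contract_fun (t r) (u r) f)"
    unfolding continuous_on_def
  proof
    fix r assume r: "r \<in> S"
    define a where "a s = t s / (1 - t s)" for s
    let ?F = "at r within S"
    have inS: "\<forall>\<^sub>F s in ?F. s \<in> S" unfolding eventually_at_topological by blast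
    have tr: "(t \<longlongrightarrow> t r) ?F" using t(1) r by (simp add: continuous_on_def)
    have a0: "0 \<le> a s" if "s \<in> S" for s using t(2)[OF that] by (simp add: a_def)
    show "((\<lambda>s. contract_fun (t s) (u s) f) \<longlongrightarrow> contract_fun (t r) (u r) f) ?F"
    proof (cases "t r < 1")
      case True
      have ev: "\<forall>\<^sub>F s in ?F. t s < 1" by (rule order_tendstoD(2)[OF tr True])
      have ar: "(a \<longlongrightarrow> a r) ?F"
        unfolding a_def using True by (intro tendsto_intros tr) simp
      have an: "\<forall>\<^sub>F s in ?F. 0 \<le> a s" using inS by eventually_elim (rule a0)
      have Wl: "((\<lambda>s. ?W (a s) f) \<longlongrightarrow> ?W (a r) f) ?F"
        by (rule tendsto_nonexpansive_family[where T = ?W, OF W continuous_on_l2_pull ar an tendsto_const])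
      have ul: "((\<lambda>s. blinfun_apply (u s) (?W (a s) f)) \<longlongrightarrow> blinfun_apply (u r) (?W (a r) f)) ?F"
      proof (rule tendsto_contraction_apply[where T = "\<lambda>s. blinfun_apply (u s)", OF _ Wl])
        show "\<forall>\<^sub>F s in ?F. \<forall>x y. norm (blinfun_apply (u s) x - blinfun_apply (u s) y) \<le> norm (x - y)"
          using inS by eventually_elim (use u(1) unitary_op_nonexpansive in blast)
        show "((\<lambda>s. blinfun_apply (u s) (?W (a r) f)) \<longlongrightarrow> blinfun_apply (u r) (?W (a r) f)) ?F"
          using r u(2) by (simp only: continuous_on_def)
      qed
      have "((\<lambda>s. f + ?V (a s) (blinfun_apply (u s) (?W (a s) f) - ?W (a s) f)) \<longlongrightarrow>
          f + ?V (a r) (blinfun_apply (u r) (?W (a r) f) - ?W (a r) f)) ?F"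
        by (intro tendsto_add tendsto_const
            tendsto_nonexpansive_family[where T = ?V, OF V continuous_on_l2_push ar an] tendsto_diff ul Wl)
      moreover have "\<forall>\<^sub>F s in ?F. f + ?V (a s) (blinfun_apply (u s) (?W (a s) f) - ?W (a s) f)
          = contract_fun (t s) (u s) f"
        using ev by eventually_elim (simp add: contract_fun_def a_def)
      ultimately have "((\<lambda>s. contract_fun (t s) (u s) f) \<longlongrightarrow>
          f + ?V (a r) (blinfun_apply (u r) (?W (a r) f) - ?W (a r) f)) ?F"
        by (rule Lim_transform_eventually)
      then show ?thesis using True by (simp add: contract_fun_def a_def)
    next
      case False
      have small: "\<exists>c\<ge>0. \<forall>a\<ge>c. norm (?W a f) < e" if e0: "0 < e" for e :: real
      proof -
        obtain N where "\<forall>a\<ge>N. norm (?W a f) < e"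
          using tendstoD[OF l2_pull_tendsto_0[OF l2_axis_norm, of f] e0]
          by (auto simp: eventually_at_top_linorder dist_norm)
        then show ?thesis by (intro exI[of _ "max 0 N"]) simp
      qed
      have "((\<lambda>s. contract_fun (t s) (u s) f) \<longlongrightarrow> f) ?F"
      proof (rule tendstoI)
        fix e :: real assume e: "0 < e"
        then obtain c where c: "0 \<le> c" "\<And>a. c \<le> a \<Longrightarrow> norm (?W a f) < e / 2"
          using small[of "e / 2"] by auto
        \<comment> \<open>The map \<open>t / (1 - t)\<close> takes the value \<open>c\<close>
          exactly at \<open>c / (1 + c)\<close>, so parameters beyond this threshold push at least
          as far as \<open>c\<close>.\<close>
        have "c / (1 + c) < 1" using c(1) by simp
        then have "c / (1 + c) < t r" using False by linarith
        from order_tendstoD(1)[OF tr this] inS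
        show "\<forall>\<^sub>F s in ?F. dist (contract_fun (t s) (u s) f) f < e"
        proof eventually_elim
          case (elim s)
          show ?case
          proof (cases "t s < 1")
            case True
            have "c \<le> a s" using elim(1) True c(1) by (simp add: a_def field_simps)
            then have w: "norm (?W (a s) f) < e / 2" by (rule c)
            have "contract_fun (t s) (u s) f = f + ?V (a s) (blinfun_apply (u s) (?W (a s) f) - ?W (a s) f)"
              using True by (simp add: contract_fun_def a_def)
            then have "dist (contract_fun (t s) (u s) f) f
                = norm (blinfun_apply (u s) (?W (a s) f) - ?W (a s) f)"
              by (simp add: dist_norm norm_l2_push[OF a0[OF elim(2)] l2_axis_norm])
            also have "\<dots> \<le> norm (blinfun_apply (u s) (?W (a s) f)) + norm (?W (a s) f)"
              by (rule norm_triangle_ineq4)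
            also have "\<dots> = norm (?W (a s) f) + norm (?W (a s) f)"
              by (simp add: unitary_op_isometry[OF u(1)[OF elim(2)]])
            also have "\<dots> < e" using w by simp
            finally show ?thesis .
          qed (use e in \<open>simp add: contract_fun_def\<close>)
        qed
      qed
      then show ?thesis using False by (simp add: contract_fun_def)
    qed
  qed
  then show ?thesis
    by (rule continuous_on_eq) (use u t in \<open>simp add: contract_apply\<close>)
qed

section \<open>Compact operators\<close>

lemma compact_closure_if_subset:
  fixes A :: "'a::t2_space set"
  assumes "A \<subseteq> K" "compact K"
  shows "compact (closure A)"
  using assms by (metis closure_minimal compact_imp_closed compact_Int_closed closed_closure inf.absorb_iff2)

lemma compact_opsI:
  assumes "clinear_op T" "blinfun_apply T ` cball 0 1 \<subseteq> K" "compact K"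
  shows "T \<in> compact_ops"
  using assms compact_closure_if_subset by (auto simp: compact_ops_def)

lemma compact_opsE:
  assumes "T \<in> compact_ops"
  obtains K where "clinear_op T" "\<And>x. norm x \<le> 1 \<Longrightarrow> blinfun_apply T x \<in> K" "compact K"
proof
  show "blinfun_apply T x \<in> closure (blinfun_apply T ` cball 0 1)" if "norm x \<le> 1" for x
    using that closure_subset by fastforce
qed (use assms in \<open>auto simp: compact_ops_def\<close>)

lemma cscale_op_apply [simp]: "blinfun_apply (cscale_op c T) f = cscale c (blinfun_apply T f)"
  unfolding cscale_op_def
  by (subst bounded_linear_Blinfun_apply)
    (simp_all add: bounded_linear_compose[OF bounded_linear_cscale blinfun.bounded_linear_right])

lemma subspace_compact_ops: "subspace compact_ops"
proof (rule subspaceI)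
  have "cscale c 0 = (0 :: 'a l2)" for c :: complex
    using bounded_linear.linear[OF bounded_linear_cscale, THEN linear_0] .
  then show "(0 :: 'a l2 \<Rightarrow>\<^sub>L 'a l2) \<in> compact_ops"
    by (intro compact_opsI[of _ "{0}"]) (auto simp: clinear_op_def)
next
  fix S T :: "'a l2 \<Rightarrow>\<^sub>L 'a l2"
  assume "S \<in> compact_ops" "T \<in> compact_ops"
  then obtain K K' where S: "clinear_op S" "\<And>x. norm x \<le> 1 \<Longrightarrow> blinfun_apply S x \<in> K" "compact K"
    and T: "clinear_op T" "\<And>x. norm x \<le> 1 \<Longrightarrow> blinfun_apply T x \<in> K'" "compact K'"
    by (meson compact_opsE)
  show "S + T \<in> compact_ops"
  proof (rule compact_opsI[of _ "{x + y |x y. x \<in> K \<and> y \<in> K'}"])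
    show "blinfun_apply (S + T) ` cball 0 1 \<subseteq> {x + y |x y. x \<in> K \<and> y \<in> K'}"
      using S(2) T(2) by (force simp: blinfun.add_left)
  qed (use S T in \<open>simp_all add: clinear_op_def blinfun.add_left cscale_add_right compact_sums\<close>)
next
  fix c :: real and T :: "'a l2 \<Rightarrow>\<^sub>L 'a l2"
  assume "T \<in> compact_ops"
  then obtain K where T: "clinear_op T" "\<And>x. norm x \<le> 1 \<Longrightarrow> blinfun_apply T x \<in> K" "compact K"
    by (meson compact_opsE)
  show "c *\<^sub>R T \<in> compact_ops"
  proof (rule compact_opsI[of _ "(\<lambda>x. c *\<^sub>R x) ` K"])
    show "blinfun_apply (c *\<^sub>R T) ` cball 0 1 \<subseteq> (\<lambda>x. c *\<^sub>R x) ` K"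
      using T(2) by (auto simp: blinfun.scaleR_left)
  qed (use T in \<open>simp_all add: clinear_op_def blinfun.scaleR_left cscale_scaleR compact_scaling\<close>)
qed

lemma cscale_op_compact_ops:
  assumes "T \<in> compact_ops"
  shows "cscale_op c T \<in> compact_ops"
proof -
  obtain K where T: "clinear_op T" "\<And>x. norm x \<le> 1 \<Longrightarrow> blinfun_apply T x \<in> K" "compact K"
    using assms by (meson compact_opsE)
  show ?thesis
  proof (rule compact_opsI[of _ "cscale c ` K"])
    show "compact (cscale c ` K)"
      by (intro compact_continuous_image T linear_continuous_on bounded_linear_cscale)
  qed (use T in \<open>auto simp: clinear_op_def cscale_cscale mult.commute\<close>)
qed

text \<open>Compactness is tested by total boundedness: a finite net for the image of the unit ball
  under a nearby \<open>T n\<close> is, with a larger radius, a net for the image under the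
  limit.\<close>

lemma closed_compact_ops: "closed (compact_ops :: ('l::euclidean_space l2 \<Rightarrow>\<^sub>L 'l l2) set)"
  unfolding closed_sequential_limits
proof (intro allI impI, elim conjE)
  fix T :: "nat \<Rightarrow> 'l l2 \<Rightarrow>\<^sub>L 'l l2" and S
  assume T: "\<forall>n. T n \<in> compact_ops" and lim: "T \<longlonglongrightarrow> S"
  have "clinear_op S"
    unfolding clinear_op_def
  proof (intro allI)
    fix c f
    have "(\<lambda>n. blinfun_apply (T n) (cscale c f)) \<longlonglongrightarrow> blinfun_apply S (cscale c f)"
      by (intro blinfun.tendsto lim tendsto_const)
    moreover have "(\<lambda>n. cscale c (blinfun_apply (T n) f)) \<longlonglongrightarrow> cscale c (blinfun_apply S f)"
      by (intro bounded_linear.tendsto[OF bounded_linear_cscale] blinfun.tendsto lim tendsto_const)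
    moreover have "blinfun_apply (T n) (cscale c f) = cscale c (blinfun_apply (T n) f)" for n
      using T by (auto simp: compact_ops_def clinear_op_def)
    ultimately show "blinfun_apply S (cscale c f) = cscale c (blinfun_apply S f)"
      using LIMSEQ_unique by simp
  qed
  moreover have "compact (closure (blinfun_apply S ` cball 0 1))"
    unfolding compact_eq_totally_bounded
  proof (intro conjI allI impI)
    \<comment> \<open>Completeness of L^2 enters here; total boundedness alone would not give
      compactness.\<close>
    show "complete (closure (blinfun_apply S ` cball 0 1))"
      by (simp add: complete_eq_closed)
    fix e :: real assume e: "0 < e"
    then obtain n where n: "norm (T n - S) < e / 4"
      using LIMSEQ_D[OF lim, of "e / 4"] by auto
    obtain K where K: "\<And>x. norm x \<le> 1 \<Longrightarrow> blinfun_apply (T n) x \<in> K" "compact K"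
      using T by (meson compact_opsE)
    obtain k where k: "finite k" "K \<subseteq> (\<Union>x\<in>k. ball x (e / 4))"
      using K(2) e unfolding compact_eq_totally_bounded by (metis zero_less_divide_iff zero_less_numeral)
    have "blinfun_apply S ` cball 0 1 \<subseteq> (\<Union>x\<in>k. cball x (e / 2))"
    proof clarsimp
      fix x :: "'l l2" assume x: "norm x \<le> 1"
      then obtain y where y: "y \<in> k" "dist y (blinfun_apply (T n) x) < e / 4"
        using K(1)[OF x] k(2) by auto
      have "norm (blinfun_apply (T n - S) x) \<le> norm (T n - S) * norm x"
        by (rule norm_blinfun)
      also have "\<dots> \<le> norm (T n - S) * 1" by (rule mult_left_mono[OF x]) simp
      finally have "dist (blinfun_apply (T n) x) (blinfun_apply S x) < e / 4"
        using n by (simp add: blinfun.diff_left dist_norm)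
      with y(2) have "dist y (blinfun_apply S x) \<le> e / 2"
        using dist_triangle[of y "blinfun_apply S x" "blinfun_apply (T n) x"] by linarith
      then show "\<exists>y\<in>k. dist y (blinfun_apply S x) * 2 \<le> e" using y(1) by auto
    qed
    then have "closure (blinfun_apply S ` cball 0 1) \<subseteq> (\<Union>x\<in>k. cball x (e / 2))"
      by (rule closure_minimal) (use k(1) in \<open>auto intro!: closed_UN\<close>)
    also have "\<dots> \<subseteq> (\<Union>x\<in>k. ball x e)" using e by (force)
    finally show "\<exists>k. finite k \<and> closure (blinfun_apply S ` cball 0 1) \<subseteq> (\<Union>x\<in>k. ball x e)"
      using k(1) by blast
  qed
  ultimately show "S \<in> compact_ops" by (simp add: compact_ops_def)
qed

lemma complete_compact_ops: "complete (compact_ops :: ('l::euclidean_space l2 \<Rightarrow>\<^sub>L 'l l2) set)"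
  by (simp add: complete_eq_closed closed_compact_ops)

subsection \<open>Conjugation by unitary operators\<close>

definition unitary_conj ::
  "('l::euclidean_space l2 \<Rightarrow>\<^sub>L 'l l2) \<Rightarrow> ('l l2 \<Rightarrow>\<^sub>L 'l l2) \<Rightarrow> ('l l2 \<Rightarrow>\<^sub>L 'l l2)" where
  "unitary_conj u a = u o\<^sub>L a o\<^sub>L unitary_inv u"

lemma unitary_conj_apply [simp]:
  "blinfun_apply (unitary_conj u a) f = blinfun_apply u (blinfun_apply a (blinfun_apply (unitary_inv u) f))"
  by (simp add: unitary_conj_def)

text \<open>\<open>Blinfun\<close> is unspecified off the bounded linear maps, so the function
  inside \<open>Ad_rep\<close> has to be recognized as a composition of bounded operators.\<close>

lemma Ad_rep_eq_unitary_conj: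
  assumes "unitary_op (\<sigma> g)"
  shows "Ad_rep \<sigma> g a = unitary_conj (\<sigma> g) a"
proof -
  have "Ad_rep \<sigma> g a = Blinfun (blinfun_apply (unitary_conj (\<sigma> g) a))"
    unfolding Ad_rep_def
    by (rule arg_cong[of _ _ Blinfun], rule ext) (simp add: unitary_inv_apply[OF assms])
  then show ?thesis by (simp add: Blinfun_inverse blinfun_apply_inverse)
qed

lemma unitary_inv_compose_distrib:
  assumes "unitary_op u" "unitary_op v"
  shows "unitary_inv (u o\<^sub>L v) = unitary_inv v o\<^sub>L unitary_inv u"
  by (rule unitary_inv_eqI) (use assms in \<open>auto intro!: blinfun_eqI simp: unitary_op_compose\<close>)

lemma unitary_conj_compose:
  assumes "unitary_op u" "unitary_op v"
  shows "unitary_conj (u o\<^sub>L v) a = unitary_conj u (unitary_conj v a)"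
  by (rule blinfun_eqI) (simp add: assms unitary_inv_compose_distrib)

lemma unitary_inv_unitary_inv:
  assumes "unitary_op u"
  shows "unitary_inv (unitary_inv u) = u"
  by (rule unitary_inv_eqI) (use assms in \<open>auto intro!: blinfun_eqI simp: unitary_op_unitary_inv\<close>)

lemma unitary_conj_inverse:
  assumes "unitary_op u"
  shows "unitary_conj u (unitary_conj (unitary_inv u) a) = a"
    "unitary_conj (unitary_inv u) (unitary_conj u a) = a"
  by (rule blinfun_eqI; simp add: assms unitary_inv_unitary_inv)+

lemma unitary_conj_add: "unitary_conj u (a + b) = unitary_conj u a + unitary_conj u b"
  by (rule blinfun_eqI) (simp add: blinfun.add_left blinfun.add_right)

lemma unitary_conj_cscale_op:
  assumes "unitary_op u"
  shows "unitary_conj u (cscale_op c a) = cscale_op c (unitary_conj u a)"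
  using assms by (intro blinfun_eqI) (simp add: unitary_op_def clinear_op_def)

lemma norm_unitary_conj_le:
  assumes "unitary_op u"
  shows "norm (unitary_conj u a) \<le> norm a"
proof (rule norm_blinfun_bound)
  fix f
  have "norm (blinfun_apply (unitary_conj u a) f) = norm (blinfun_apply a (blinfun_apply (unitary_inv u) f))"
    by (simp add: unitary_op_isometry[OF assms])
  also have "\<dots> \<le> norm a * norm (blinfun_apply (unitary_inv u) f)" by (rule norm_blinfun)
  also have "\<dots> = norm a * norm f"
    by (simp add: unitary_op_isometry[OF unitary_op_unitary_inv[OF assms]])
  finally show "norm (blinfun_apply (unitary_conj u a) f) \<le> norm a * norm f" .
qed simp

lemma norm_unitary_conj:
  assumes "unitary_op u"
  shows "norm (unitary_conj u a) = norm a"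
  using norm_unitary_conj_le[OF assms, of a]
    norm_unitary_conj_le[OF unitary_op_unitary_inv[OF assms], of "unitary_conj u a"]
  by (simp add: unitary_conj_inverse[OF assms])

lemma unitary_conj_compact_ops:
  assumes u: "unitary_op u" and "a \<in> compact_ops"
  shows "unitary_conj u a \<in> compact_ops"
proof -
  obtain K where K: "clinear_op a" "\<And>x. norm x \<le> 1 \<Longrightarrow> blinfun_apply a x \<in> K" "compact K"
    using assms(2) by (meson compact_opsE)
  show ?thesis
  proof (rule compact_opsI[of _ "blinfun_apply u ` K"])
    show "clinear_op (unitary_conj u a)"
      using K(1) u unitary_op_unitary_inv[OF u] by (simp add: clinear_op_def unitary_op_def)
    show "blinfun_apply (unitary_conj u a) ` cball 0 1 \<subseteq> blinfun_apply u ` K"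
      using K(2) unitary_op_isometry[OF unitary_op_unitary_inv[OF u]] by auto
    show "compact (blinfun_apply u ` K)"
      by (intro compact_continuous_image K linear_continuous_on blinfun.bounded_linear_right)
  qed
qed

subsection \<open>Norm continuity of conjugation\<close>

lemma norm_blinfun_le_unit:
  fixes T :: "'a::real_normed_vector \<Rightarrow>\<^sub>L 'b::real_normed_vector"
  assumes "0 \<le> b" "\<And>x. norm x \<le> 1 \<Longrightarrow> norm (blinfun_apply T x) \<le> b"
  shows "norm T \<le> b"
proof (rule norm_blinfun_bound[OF assms(1)])
  fix x :: 'a
  show "norm (blinfun_apply T x) \<le> b * norm x"
  proof (cases "x = 0")
    case False
    have "norm (blinfun_apply T (x /\<^sub>R norm x)) \<le> b" by (rule assms(2)) (use False in simp)
    then show ?thesis using False by (simp add: blinfun.scaleR_right field_simps)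
  qed simp
qed

text \<open>
  A unit vector that almost attains the norm of \<open>\<phi>\<close> almost represents \<open>\<phi>\<close> after rescaling, so no
  completeness is needed.
\<close>

lemma approximate_riesz:
  fixes \<phi> :: "'a::real_inner \<Rightarrow> real"
  assumes "bounded_linear \<phi>" "0 < e"
  shows "\<exists>w. \<forall>x. \<bar>\<phi> x - inner w x\<bar> \<le> e * norm x"
proof -
  interpret bounded_linear \<phi> by fact
  define N where "N = onorm \<phi>"
  have N: "\<bar>\<phi> x\<bar> \<le> N * norm x" for x
    using onorm[OF assms(1), of x] by (simp add: N_def)
  have N0: "0 \<le> N" unfolding N_def by (rule onorm_pos_le[OF assms(1)])
  show ?thesis
  proof (cases "N = 0")
    case True
    then have "\<bar>\<phi> x - inner 0 x\<bar> \<le> e * norm x" for x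
      using N[of x] assms(2) by simp
    then show ?thesis by blast
  next
    case False
    \<comment> \<open>The bound by \<open>e / (1 + N / 2)\<close> controls the final error, and
      \<open>s * s \<le> N / 2\<close> keeps \<open>N - s * s\<close> positive.\<close>
    define s where "s = min (e / (1 + N / 2)) (min 1 (N / 2))"
    have "0 < e / (1 + N / 2)" using N0 assms(2) by simp
    then have s: "0 < s" "s \<le> 1" "s \<le> N / 2" "s \<le> e / (1 + N / 2)"
      using False N0 unfolding s_def by linarith+
    then have se: "s * (1 + N / 2) \<le> e" using N0 by (simp add: pos_le_divide_eq)
    have ss: "s * s \<le> N / 2" using s by (meson mult_left_le order_trans less_imp_le)
    \<comment> \<open>\<open>N\<close> is the least bound of \<phi>, so the smaller number
      \<open>N - s * s\<close> fails somewhere. The defect is of second order in \<open>s\<close>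
      because the estimate below is divided by \<open>s\<close>.\<close>
    obtain x0 where x0: "\<bar>\<phi> x0\<bar> > (N - s * s) * norm x0"
    proof (rule ccontr)
      assume "\<not> thesis"
      then have "\<bar>\<phi> x\<bar> \<le> (N - s * s) * norm x" for x using that not_le by blast
      then have "N \<le> N - s * s"
        unfolding N_def using ss N0 by (intro onorm_bound) (auto simp: N_def[symmetric])
      then show False using mult_pos_pos[OF s(1) s(1)] by linarith
    qed
    have n0: "0 < norm x0" using x0 zero by auto
    define z where "z = (sgn (\<phi> x0) / norm x0) *\<^sub>R x0"
    have "\<phi> x0 \<noteq> 0" using x0 ss N0 n0 by (auto simp: mult_less_0_iff)
    then have nz: "norm z = 1" using n0 by (simp add: z_def abs_sgn_eq)
    have z: "\<phi> z = \<bar>\<phi> x0\<bar> / norm x0"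
      by (simp add: z_def scaleR abs_sgn mult.commute)
    have pz: "N - s * s \<le> \<phi> z"
      unfolding z using x0 n0 by (simp only: pos_le_divide_eq less_imp_le)
    have main: "\<phi> x - N * inner z x \<le> e" if x: "norm x = 1" for x
    proof -
      let ?v = "z + s *\<^sub>R x"
      \<comment> \<open>The inequality 2 p \<le> 1 + p^2 linearizes the norm near a unit vector
        without a square root.\<close>
      have "2 * norm ?v \<le> 1 + (norm ?v)\<^sup>2"
        using zero_le_power2[of "norm ?v - 1"] by (simp add: power2_eq_square algebra_simps)
      also have "(norm ?v)\<^sup>2 = 1 + 2 * s * inner z x + s * s"
      proof -
        have "(norm ?v)\<^sup>2 = (norm z)\<^sup>2 + 2 * s * inner z x + s * s * (norm x)\<^sup>2"
          by (simp add: power2_norm_eq_inner inner_add_left inner_add_right inner_commute[of x z] algebra_simps)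
        then show ?thesis using nz x by simp
      qed
      finally have nv: "norm ?v \<le> 1 + s * inner z x + s * s / 2" by simp
      have "\<phi> z + s * \<phi> x = \<phi> ?v" by (simp add: add scaleR)
      also have "\<dots> \<le> N * norm ?v" using N[of ?v] by simp
      also have "\<dots> \<le> N * (1 + s * inner z x + s * s / 2)" by (rule mult_left_mono[OF nv N0])
      finally have "s * (\<phi> x - N * inner z x) \<le> s * (s * (1 + N / 2))"
        using pz by (simp add: algebra_simps)
      then have "\<phi> x - N * inner z x \<le> s * (1 + N / 2)" using s(1) by simp
      then show ?thesis using se by linarith
    qed
    have "\<bar>\<phi> x - inner (N *\<^sub>R z) x\<bar> \<le> e * norm x" for x
    proof (cases "x = 0")
      case False
      define y where "y = x /\<^sub>R norm x"
      have y: "norm y = 1" and xy: "x = norm x *\<^sub>R y" using False by (simp_all add: y_def)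
      \<comment> \<open>The one-sided estimate at \<open>- y\<close> gives the other side.\<close>
      have "\<bar>\<phi> y - N * inner z y\<bar> \<le> e"
        using main[OF y] main[of "- y"] y by (simp add: neg abs_le_iff)
      then have "norm x * \<bar>\<phi> y - N * inner z y\<bar> \<le> norm x * e" by (rule mult_left_mono) simp
      moreover have "\<phi> x - inner (N *\<^sub>R z) x = norm x * (\<phi> y - N * inner z y)"
        by (subst (1 2) xy) (simp add: scaleR algebra_simps)
      ultimately show ?thesis by (simp add: abs_mult mult.commute)
    qed (simp add: zero)
    then show ?thesis by blast
  qed
qed

text \<open>Strong convergence is uniform on a finite net of the compact image of the unit ball. The
  unitaries are isometric, so passing from a net point to the actual vector costs at most two thirds
  of \<open>e\<close>.\<close>

lemma tendsto_unitary_compose_compact: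
  fixes u :: "'p \<Rightarrow> 'l::euclidean_space l2 \<Rightarrow>\<^sub>L 'l l2"
  assumes u: "\<forall>\<^sub>F r in F. unitary_op (u r)" "unitary_op v"
    and lim: "\<And>f. ((\<lambda>r. blinfun_apply (u r) f) \<longlongrightarrow> blinfun_apply v f) F"
    and a: "a \<in> compact_ops" and e: "0 < e"
  shows "\<forall>\<^sub>F r in F. norm ((u r - v) o\<^sub>L a) \<le> e"
proof -
  obtain K where K: "\<And>x. norm x \<le> 1 \<Longrightarrow> blinfun_apply a x \<in> K" "compact K"
    using a by (meson compact_opsE)
  obtain k where k: "finite k" "K \<subseteq> (\<Union>x\<in>k. ball x (e / 3))"
    using K(2) e unfolding compact_eq_totally_bounded by (metis zero_less_divide_iff zero_less_numeral)
  have "\<forall>\<^sub>F r in F. \<forall>y\<in>k. norm (blinfun_apply (u r) y - blinfun_apply v y) < e / 3"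
    using k(1) tendstoD[OF lim, of "e / 3"] e by (simp add: eventually_ball_finite dist_norm)
  with u(1) show ?thesis
  proof eventually_elim
    case (elim r)
    show ?case
    proof (rule norm_blinfun_le_unit)
      fix x :: "'l l2" assume "norm x \<le> 1"
      then obtain y where y: "y \<in> k" "norm (y - blinfun_apply a x) < e / 3"
        using K(1) k(2) by (fastforce simp: dist_norm)
      let ?z = "blinfun_apply a x"
      have "blinfun_apply ((u r - v) o\<^sub>L a) x =
          (blinfun_apply (u r) y - blinfun_apply v y) + (blinfun_apply v (y - ?z) - blinfun_apply (u r) (y - ?z))"
        by (simp add: blinfun.diff_left blinfun.diff_right)
      also have "norm \<dots> \<le> norm (blinfun_apply (u r) y - blinfun_apply v y)
          + (norm (blinfun_apply v (y - ?z)) + norm (blinfun_apply (u r) (y - ?z)))"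
        by (intro norm_triangle_le add_left_mono norm_triangle_ineq4)
      also have "\<dots> \<le> e"
        using elim y u(2) by (force simp: unitary_op_isometry)
      finally show "norm (blinfun_apply ((u r - v) o\<^sub>L a) x) \<le> e" .
    qed (use e in simp)
  qed
qed

text \<open>Formally the adjoint of the preceding statement. The vectors \<open>w y\<close> stand in
  for the adjoint of \<open>a\<close> applied to \<open>y\<close>, up to error \<open>d\<close>;
  strong convergence of \<open>u\<close> is needed only at these vectors for \<open>y\<close> in a
  finite net.\<close>

lemma tendsto_compact_compose_unitary_inv:
  fixes u :: "'p \<Rightarrow> 'l::euclidean_space l2 \<Rightarrow>\<^sub>L 'l l2"
  assumes u: "\<forall>\<^sub>F r in F. unitary_op (u r)" "unitary_op v"
    and lim: "\<And>f. ((\<lambda>r. blinfun_apply (u r) f) \<longlongrightarrow> blinfun_apply v f) F"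
    and a: "a \<in> compact_ops" and e: "0 < e"
  shows "\<forall>\<^sub>F r in F. norm (a o\<^sub>L (unitary_inv (u r) - unitary_inv v)) \<le> e"
proof -
  \<comment> \<open>For \<open>?y = a z\<close> and a net point \<open>y\<close>, the product of
    \<open>y\<close> with \<open>?y\<close> is at most 2 d and that of the remainder with
    \<open>?y\<close> at most d ||a||. Hence ||a z||^2 is at most d (2 + ||a||), which is to be
    (e/2)^2.\<close>
  define d where "d = (e / 2)\<^sup>2 / (2 + norm a)"
  have a2: "0 < 2 + norm a" by (simp add: add_pos_nonneg)
  have d: "0 < d" using e a2 by (simp add: d_def)
  obtain K where K: "\<And>x. norm x \<le> 1 \<Longrightarrow> blinfun_apply a x \<in> K" "compact K"
    using a by (meson compact_opsE)
  obtain k where k: "finite k" "K \<subseteq> (\<Union>x\<in>k. ball x d)"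
    using K(2) d unfolding compact_eq_totally_bounded by metis
  have "\<exists>w. \<forall>z. \<bar>inner y (blinfun_apply a z) - inner w z\<bar> \<le> d * norm z" for y
    by (rule approximate_riesz[OF _ d])
      (rule bounded_linear_compose[OF bounded_linear_inner_right blinfun.bounded_linear_right])
  then obtain w where w: "\<And>y z. \<bar>inner y (blinfun_apply a z) - inner (w y) z\<bar> \<le> d * norm z"
    by metis
  have "\<forall>\<^sub>F r in F. \<forall>y\<in>k. norm (blinfun_apply (u r) (w y) - blinfun_apply v (w y)) < d"
    using k(1) tendstoD[OF lim d] by (simp add: eventually_ball_finite dist_norm)
  with u(1) show ?thesis
  proof eventually_elim
    case (elim r)
    note ur = elim(1)
    let ?B = "unitary_inv (u r) - unitary_inv v"
    show ?case
    proof (rule norm_blinfun_le_unit)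
      fix x :: "'l l2" assume x: "norm x \<le> 1"
      \<comment> \<open>Halving brings the difference of two vectors of the unit ball back into it,
        so that \<open>K\<close> contains \<open>a z\<close>.\<close>
      define z where "z = (1/2) *\<^sub>R blinfun_apply ?B x"
      have "norm (blinfun_apply ?B x) \<le> norm (blinfun_apply (unitary_inv (u r)) x) + norm (blinfun_apply (unitary_inv v) x)"
        by (simp add: blinfun.diff_left norm_triangle_ineq4)
      also have "\<dots> \<le> 2"
        using x by (simp add: unitary_op_isometry unitary_op_unitary_inv ur u(2))
      finally have z: "norm z \<le> 1" by (simp add: z_def)
      let ?y = "blinfun_apply a z"
      obtain y where y: "y \<in> k" "norm (y - ?y) < d"
        using K(1)[OF z] k(2) by (auto simp: dist_norm)
      have adj: "inner f (blinfun_apply (unitary_inv T) g) = inner (blinfun_apply T f) g"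
        if "unitary_op T" for T f and g :: "'l l2"
        by (simp add: inner_l2_def cinner_unitary_inv[OF that])
      have "inner (w y) z = inner (blinfun_apply (u r) (w y) - blinfun_apply v (w y)) x / 2"
        by (simp add: z_def blinfun.diff_left inner_diff_left inner_diff_right adj ur u(2))
      also have "\<dots> \<le> norm (blinfun_apply (u r) (w y) - blinfun_apply v (w y)) * norm x / 2"
        by (intro divide_right_mono norm_cauchy_schwarz) simp
      also have "\<dots> \<le> d * 1 / 2"
        using elim(2) y(1) x d by (intro divide_right_mono mult_mono) auto
      finally have "inner (w y) z \<le> d" using d by simp
      moreover have "d * norm z \<le> d" using z d by simp
      ultimately have "inner y ?y \<le> 2 * d"
        using w[of y z] by linarith
      moreover have "inner (?y - y) ?y \<le> d * norm a"
      proof -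
        have "inner (?y - y) ?y \<le> norm (?y - y) * norm ?y" by (rule norm_cauchy_schwarz)
        also have "\<dots> \<le> d * norm a"
        proof (rule mult_mono)
          have "norm ?y \<le> norm a * norm z" by (rule norm_blinfun)
          also have "\<dots> \<le> norm a" using z by (simp add: mult_left_le)
          finally show "norm ?y \<le> norm a" .
        qed (use y d in \<open>auto simp: norm_minus_commute\<close>)
        finally show ?thesis .
      qed
      ultimately have "(norm ?y)\<^sup>2 \<le> d * (2 + norm a)"
        by (simp add: power2_norm_eq_inner inner_diff_left algebra_simps)
      also have "\<dots> = (e / 2)\<^sup>2" using a2 by (simp add: d_def)
      finally have "norm ?y \<le> e / 2" by (rule power2_le_imp_le) (use e in simp)
      then show "norm (blinfun_apply (a o\<^sub>L ?B) x) \<le> e"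
        by (simp add: z_def blinfun.scaleR_right)
    qed (use e in simp)
  qed
qed

text \<open>Three errors: the change of \<open>a\<close>, a difference of unitaries to the left of
  the fixed operator \<open>a r\<close>, and a difference of inverses to its right. Compactness of
  \<open>a r\<close> turns strong into norm convergence in the last two.\<close>

lemma continuous_on_unitary_conj:
  fixes u :: "'p::topological_space \<Rightarrow> 'l::euclidean_space l2 \<Rightarrow>\<^sub>L 'l l2"
  assumes u: "\<And>r. r \<in> S \<Longrightarrow> unitary_op (u r)" "\<And>f. continuous_on S (\<lambda>r. blinfun_apply (u r) f)"
    and a: "continuous_on S a" "\<And>r. r \<in> S \<Longrightarrow> a r \<in> compact_ops"
  shows "continuous_on S (\<lambda>r. unitary_conj (u r) (a r))"
  unfolding continuous_on_def
proof
  fix r assume r: "r \<in> S"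
  let ?F = "at r within S"
  have inS: "\<forall>\<^sub>F s in ?F. s \<in> S" unfolding eventually_at_topological by blast
  then have us: "\<forall>\<^sub>F s in ?F. unitary_op (u s)" by eventually_elim (rule u)
  have lim: "((\<lambda>s. blinfun_apply (u s) f) \<longlongrightarrow> blinfun_apply (u r) f) ?F" for f
    using u(2) r by (simp only: continuous_on_def)
  show "((\<lambda>r. unitary_conj (u r) (a r)) \<longlongrightarrow> unitary_conj (u r) (a r)) ?F"
  proof (rule tendstoI)
    fix e :: real assume e: "0 < e"
    then have e4: "0 < e / 4" by simp
    have "\<forall>\<^sub>F s in ?F. norm (a s - a r) < e / 4"
      using tendstoD[OF a(1)[unfolded continuous_on_def, rule_format, OF r] e4] by (simp only: dist_norm)
    with us tendsto_unitary_compose_compact[OF us u(1)[OF r] lim a(2)[OF r] e4]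
      tendsto_compact_compose_unitary_inv[OF us u(1)[OF r] lim a(2)[OF r] e4]
    show "\<forall>\<^sub>F s in ?F. dist (unitary_conj (u s) (a s)) (unitary_conj (u r) (a r)) < e"
    proof eventually_elim
      case (elim s)
      let ?b = "a r"
      have "unitary_conj (u s) (a s) - unitary_conj (u r) ?b = unitary_conj (u s) (a s - ?b)
          + ((((u s - u r) o\<^sub>L ?b) o\<^sub>L unitary_inv (u s))
          + (u r o\<^sub>L (?b o\<^sub>L (unitary_inv (u s) - unitary_inv (u r)))))"
        by (rule blinfun_eqI) (simp add: blinfun.diff_left blinfun.diff_right blinfun.add_left)
      also have "norm \<dots> \<le> norm (unitary_conj (u s) (a s - ?b))
          + (norm (((u s - u r) o\<^sub>L ?b) o\<^sub>L unitary_inv (u s))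
          + norm (u r o\<^sub>L (?b o\<^sub>L (unitary_inv (u s) - unitary_inv (u r)))))"
        by (intro norm_triangle_le add_left_mono norm_triangle_ineq)
      also have "norm (unitary_conj (u s) (a s - ?b)) < e / 4"
        using elim by (simp add: norm_unitary_conj)
      also have "norm (((u s - u r) o\<^sub>L ?b) o\<^sub>L unitary_inv (u s)) \<le> e / 4"
      proof (rule norm_blinfun_le_unit)
        fix x :: "'l l2" assume x: "norm x \<le> 1"
        have "norm (blinfun_apply ((u s - u r) o\<^sub>L ?b) (blinfun_apply (unitary_inv (u s)) x))
            \<le> norm ((u s - u r) o\<^sub>L ?b) * norm (blinfun_apply (unitary_inv (u s)) x)"
          by (rule norm_blinfun)
        also have "\<dots> \<le> e / 4 * 1"
          using elim x e by (intro mult_mono) (auto simp: unitary_op_isometry unitary_op_unitary_inv)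
        finally show "norm (blinfun_apply (((u s - u r) o\<^sub>L ?b) o\<^sub>L unitary_inv (u s)) x) \<le> e / 4"
          by simp
      qed (use e in simp)
      also have "norm (u r o\<^sub>L (?b o\<^sub>L (unitary_inv (u s) - unitary_inv (u r)))) \<le> e / 4"
      proof (rule norm_blinfun_le_unit)
        fix x :: "'l l2" assume x: "norm x \<le> 1"
        let ?C = "?b o\<^sub>L (unitary_inv (u s) - unitary_inv (u r))"
        have "norm (blinfun_apply (u r o\<^sub>L ?C) x) = norm (blinfun_apply ?C x)"
          using unitary_op_isometry[OF u(1)[OF r], of "blinfun_apply ?C x"]
          by (simp only: blinfun_apply_blinfun_compose o_apply)
        also have "\<dots> \<le> norm ?C * norm x" by (rule norm_blinfun)
        also have "\<dots> \<le> e / 4 * 1" using elim x e by (intro mult_mono) auto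
        finally show "norm (blinfun_apply (u r o\<^sub>L ?C) x) \<le> e / 4" by simp
      qed (use e in simp)
      finally show ?case using e by (simp add: dist_norm)
    qed
  qed
qed

section \<open>Gluing equivariant families of unitary operators\<close>

definition equivariant_unitary ::
  "('p::topological_space \<Rightarrow> 'g \<Rightarrow> 'p) \<Rightarrow> ('g \<Rightarrow> 'l::euclidean_space l2 \<Rightarrow>\<^sub>L 'l l2) \<Rightarrow> 'p set \<Rightarrow>
   ('p \<Rightarrow> 'l l2 \<Rightarrow>\<^sub>L 'l l2) \<Rightarrow> bool" where
  "equivariant_unitary act \<sigma> D u \<longleftrightarrow>
     (\<forall>r\<in>D. unitary_op (u r)) \<and>
     (\<forall>f. continuous_on D (\<lambda>r. blinfun_apply (u r) f)) \<and>
     (\<forall>r\<in>D. \<forall>g. u (act r g) = u r o\<^sub>L \<sigma> g)"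

text \<open>For \<open>w = \<sigma> g\<close> this says that the quotient of two equivariant
  families is constant along the orbits. Contracting it therefore keeps the glued family
  equivariant.\<close>

lemma unitary_inv_equivariant_quotient:
  assumes "unitary_op u" "unitary_op v" "unitary_op w"
  shows "(v o\<^sub>L w) o\<^sub>L unitary_inv (u o\<^sub>L w) = v o\<^sub>L unitary_inv u"
  using assms by (auto intro!: blinfun_eqI simp: unitary_inv_compose_distrib)

text \<open>
  Where both families are defined, they are interpolated by contracting their quotient. The
  parameter of the contraction is \<open>0\<close> for \<open>G \<ge> 1/2\<close> and for small \<open>F\<close>, and \<open>1\<close> where the first family
  runs out of its domain.
\<close>

lemma equivariant_unitary_extend:
  fixes act :: "'p::topological_space \<Rightarrow> 'g \<Rightarrow> 'p"
    and \<sigma> :: "'g \<Rightarrow> 'l::euclidean_space l2 \<Rightarrow>\<^sub>L 'l l2"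
  assumes \<sigma>: "\<And>g. unitary_op (\<sigma> g)"
    and G: "continuous_on UNIV G" "\<And>r g. G (act r g) = G r"
    and F: "continuous_on UNIV F" "\<And>r g. F (act r g) = F r"
    and c: "0 < c" "c < c'" "c' < (1/2::real)"
    and v: "equivariant_unitary act \<sigma> {r. c < G r} v"
    and u: "equivariant_unitary act \<sigma> {r. 0 < F r} u"
  shows "\<exists>w. equivariant_unitary act \<sigma> {r. c' < max (G r) (F r)} w \<and> (\<forall>r. 1/2 \<le> G r \<longrightarrow> w r = v r)"
proof -
  \<comment> \<open>A level strictly between the thresholds makes the regions \<open>c < G r\<close>
    and \<open>G r < m\<close> overlap.\<close>
  define m where "m = (c + c') / 2"
  have m: "c < m" "m < c'" using c by (auto simp: m_def)
  \<comment> \<open>The first factor goes from 0 at \<open>G r = 1/2\<close> to 1 at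
    \<open>m\<close>, the second from 0 at \<open>F r = c'/2\<close> to 1 at \<open>c'\<close>. They
    do not conflict on the new domain: there \<open>G r \<le> m\<close> forces
    \<open>F r > c'\<close>, where the second factor is already 1.\<close>
  define t where "t r = max 0 (min 1 ((1/2 - G r) / (1/2 - m))) * max 0 (min 1 ((F r - c'/2) / (c'/2)))" for r
  have t01: "0 \<le> t r \<and> t r \<le> 1" for r
    unfolding t_def by (auto intro!: mult_le_one)
  have tc: "continuous_on UNIV t"
    unfolding t_def using m c by (intro continuous_intros G(1) F(1)) auto
  have t0: "t r = 0" if "1/2 \<le> G r \<or> F r \<le> c'/2" for r
    using that m c by (auto simp: t_def max_def min_def field_simps)
  have t1: "t r = 1" if "G r \<le> m" "c' \<le> F r" for r
    using that m c by (auto simp: t_def max_def min_def field_simps)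
  define h where "h r = contract (t r) (v r o\<^sub>L unitary_inv (u r)) o\<^sub>L u r" for r
  define w where "w r = (if F r < c'/2 then v r else if G r < m then u r else h r)" for r
  have vU: "unitary_op (v r)" "v (act r g) = v r o\<^sub>L \<sigma> g" if "c < G r" for r g
    using v that by (auto simp: equivariant_unitary_def)
  have uU: "unitary_op (u r)" "u (act r g) = u r o\<^sub>L \<sigma> g" if "0 < F r" for r g
    using u that by (auto simp: equivariant_unitary_def)
  have qU: "unitary_op (v r o\<^sub>L unitary_inv (u r))" if "c < G r" "0 < F r" for r
    using that by (intro unitary_op_compose unitary_op_unitary_inv vU uU)
  have hv: "h r = v r" if "c < G r" "0 < F r" "t r = 0" for r
    unfolding h_def that(3) contract_0[OF qU[OF that(1,2)]]
    using uU(1)[OF that(2)] by (auto intro!: blinfun_eqI)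
  have hu: "h r = u r" if "c < G r" "0 < F r" "t r = 1" for r
    unfolding h_def that(3) contract_1[OF qU[OF that(1,2)]] by (auto intro!: blinfun_eqI)
  let ?D = "{r. c' < max (G r) (F r)}"
  let ?O1 = "?D \<inter> {r. 0 < F r} \<inter> {r. c < G r}"
  let ?O2 = "?D \<inter> {r. 0 < F r} \<inter> {r. G r < m}"
  let ?O3 = "?D \<inter> {r. F r < c'/2}"
  \<comment> \<open>If \<open>F r\<close> is at least \<open>c'/2\<close>, then \<open>u\<close> is
    defined and \<open>G r\<close> is above \<open>c\<close> or below \<open>m\<close>; otherwise
    the third set applies, and there \<open>G r > c'\<close>, so \<open>v\<close> is
    defined.\<close>
  have D: "?D = ?O1 \<union> ?O2 \<union> ?O3"
    using m c by auto
  \<comment> \<open>The three branches agree here: small \<open>F r\<close> means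
    \<open>t r = 0\<close> and \<open>h r = v r\<close>; \<open>G r < m\<close> means
    \<open>t r = 1\<close> and \<open>h r = u r\<close>.\<close>
  have w1: "w r = h r" if "r \<in> ?O1" for r
    using that hv[of r] hu[of r] t0[of r] t1[of r] m c by (auto simp: w_def)
  have w2: "w r = u r" if "r \<in> ?O2" for r
    using that m c by (auto simp: w_def)
  have w3: "w r = v r" if "r \<in> ?O3" for r
    using that by (auto simp: w_def)
  have op: "open ?D" "open {r. 0 < F r}" "open {r. c < G r}" "open {r. G r < m}" "open {r. F r < c'/2}"
    by (rule open_Collect_less; intro continuous_on_const continuous_on_max G(1) F(1))+
  have un: "unitary_op (w r)" if "r \<in> ?D" for r
  proof -
    have "r \<in> ?O1 \<union> ?O2 \<union> ?O3" using that by (subst (asm) D)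
    then consider "r \<in> ?O1" | "r \<in> ?O2" | "r \<in> ?O3" by (elim UnE)
    then show ?thesis
    proof cases
      case 1
      then show ?thesis
        unfolding w1[OF 1] h_def using t01
        by (intro unitary_op_compose unitary_op_contract qU uU) auto
    next
      case 2
      then show ?thesis unfolding w2[OF 2] by (intro uU) auto
    next
      case 3
      then show ?thesis unfolding w3[OF 3] using m c by (intro vU) auto
    qed
  qed
  have eq: "w (act r g) = w r o\<^sub>L \<sigma> g" if "r \<in> ?D" for r g
  proof -
    have "h (act r g) = h r o\<^sub>L \<sigma> g" if "c < G r" "0 < F r" for r
    proof -
      have "t (act r g) = t r" by (simp add: t_def G F)
      then have "h (act r g) = contract (t r) (v r o\<^sub>L unitary_inv (u r)) o\<^sub>L (u r o\<^sub>L \<sigma> g)"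
        using that uU(1)[of r] vU(1)[of r] \<sigma>[of g]
        by (simp add: h_def vU(2) uU(2) unitary_inv_equivariant_quotient)
      then show ?thesis by (auto simp: h_def intro!: blinfun_eqI)
    qed
    with that m c show ?thesis by (auto simp: w_def G F vU uU)
  qed
  have co: "continuous_on ?D (\<lambda>r. blinfun_apply (w r) f)" for f
  proof -
    have vc: "continuous_on {r. c < G r} (\<lambda>r. blinfun_apply (v r) f)"
      and uc: "continuous_on {r. 0 < F r} (\<lambda>r. blinfun_apply (u r) f)" for f
      using u v by (auto simp: equivariant_unitary_def)
    let ?S = "{r. 0 < F r} \<inter> {r. c < G r}"
    have uS: "continuous_on ?S (\<lambda>r. blinfun_apply (u r) f)" for f
      by (rule continuous_on_subset[OF uc]) auto
    have "continuous_on ?S (\<lambda>r. blinfun_apply (v r) (blinfun_apply (unitary_inv (u r)) f))" for f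
    proof (rule continuous_on_unitary_apply)
      show "continuous_on ?S (\<lambda>r. blinfun_apply (v r) f)" for f
        by (rule continuous_on_subset[OF vc]) auto
      show "continuous_on ?S (\<lambda>r. blinfun_apply (unitary_inv (u r)) f)"
        by (rule continuous_on_unitary_inv[OF _ uS]) (auto intro: uU)
    qed (auto intro: vU)
    then have "continuous_on ?S (\<lambda>r. blinfun_apply (contract (t r) (v r o\<^sub>L unitary_inv (u r))) f)" for f
      by (intro continuous_on_contract continuous_on_subset[OF tc] qU t01) auto
    then have "continuous_on ?S (\<lambda>r. blinfun_apply (contract (t r) (v r o\<^sub>L unitary_inv (u r))) (blinfun_apply (u r) f))"
      by (intro continuous_on_unitary_apply[OF _ _ uS] unitary_op_contract qU) (auto simp: t01)
    then have "continuous_on ?S (\<lambda>r. blinfun_apply (h r) f)"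
      by (simp add: h_def)
    then have "continuous_on ?O1 (\<lambda>r. blinfun_apply (h r) f)"
      by (rule continuous_on_subset) auto
    then have 1: "continuous_on ?O1 (\<lambda>r. blinfun_apply (w r) f)"
      by (rule continuous_on_eq) (simp only: w1)
    have 2: "continuous_on ?O2 (\<lambda>r. blinfun_apply (w r) f)"
      by (rule continuous_on_eq[OF continuous_on_subset[OF uc]]) (auto simp: w2)
    have 3: "continuous_on ?O3 (\<lambda>r. blinfun_apply (w r) f)"
      by (rule continuous_on_eq[OF continuous_on_subset[OF vc]]) (use m c in \<open>auto simp: w3\<close>)
    show ?thesis
      by (subst D) (intro continuous_on_open_Un open_Un open_Int op 1 2 3)
  qed
  have ag: "w r = v r" if "1/2 \<le> G r" for r
    using that hv[of r] t0[of r] m c by (auto simp: w_def)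
  show ?thesis
    using un eq co ag by (intro exI[of _ w]) (simp add: equivariant_unitary_def)
qed

text \<open>The family \<open>W k\<close> lives where the maximum of the first \<open>k\<close>
  cut-offs exceeds \<open>c k\<close>. Once some cut-off at \<open>r\<close> is above 1/2, so are
  all later maxima, and the extension step no longer alters the value at \<open>r\<close>. The limit
  is thus locally one of the \<open>W k\<close>.\<close>

lemma equivariant_unitary_glue:
  fixes act :: "'p::topological_space \<Rightarrow> 'g \<Rightarrow> 'p"
    and \<sigma> :: "'g \<Rightarrow> 'l::euclidean_space l2 \<Rightarrow>\<^sub>L 'l l2" and F :: "nat \<Rightarrow> 'p \<Rightarrow> real"
  assumes \<sigma>: "\<And>g. unitary_op (\<sigma> g)"
    and F: "\<And>i. continuous_on UNIV (F i)" "\<And>i r g. F i (act r g) = F i r"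
    and cover: "\<And>r. \<exists>i. 1/2 < F i r"
    and u: "\<And>i. equivariant_unitary act \<sigma> {r. 0 < F i r} (u i)"
  shows "\<exists>w. equivariant_unitary act \<sigma> UNIV w"
proof -
  \<comment> \<open>Inserting 0 gives \<open>G 0 = 0\<close> and keeps the maximum over no cut-offs
    meaningful.\<close>
  define G where "G k r = Max (insert 0 ((\<lambda>i. F i r) ` {..<k}))" for k r
  have G0: "G 0 r = 0" and GSuc: "G (Suc k) r = max (G k r) (F k r)" for k r
  proof -
    show "G 0 r = 0" by (simp add: G_def)
    have "insert 0 ((\<lambda>i. F i r) ` {..<Suc k}) = insert (F k r) (insert 0 ((\<lambda>i. F i r) ` {..<k}))"
      by (auto simp: lessThan_Suc)
    then show "G (Suc k) r = max (G k r) (F k r)"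
      by (simp add: G_def max.commute)
  qed
  have Gc: "continuous_on UNIV (G k)" for k
  proof (induction k)
    case 0
    then show ?case by (simp add: G0[abs_def])
  next
    case (Suc k)
    then show ?case unfolding GSuc[abs_def] by (intro continuous_on_max Suc F(1))
  qed
  have Gi: "G k (act r g) = G k r" for k r g
    by (simp add: G_def F)
  \<comment> \<open>Strictly increasing towards 1/2; the offset 2 in the exponent makes
    \<open>c 0 = 1/4\<close> positive.\<close>
  define c :: "nat \<Rightarrow> real" where "c k = 1/2 - (1/2) ^ (k + 2)" for k
  have c: "0 < c k" "c k < c (Suc k)" "c k < 1/2" for k
  proof -
    have "(1/2::real) ^ (k + 2) \<le> (1/2) ^ 2" by (rule power_decreasing) auto
    then show "0 < c k" by (simp add: c_def power2_eq_square)
    show "c k < c (Suc k)" "c k < 1/2" by (simp_all add: c_def)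
  qed
  have "\<exists>W. \<forall>k. equivariant_unitary act \<sigma> {r. c k < G k r} (W k) \<and>
      (\<forall>r. 1/2 \<le> G k r \<longrightarrow> W (Suc k) r = W k r)"
  proof (rule dependent_nat_choice)
    \<comment> \<open>The initial domain is empty, since \<open>G 0\<close> is 0 and
      \<open>c 0\<close> is positive.\<close>
    show "\<exists>v. equivariant_unitary act \<sigma> {r. c 0 < G 0 r} v"
      using c(1)[of 0] by (simp add: G0 equivariant_unitary_def not_less[symmetric])
    fix v k assume "equivariant_unitary act \<sigma> {r. c k < G k r} v"
    then show "\<exists>w. equivariant_unitary act \<sigma> {r. c (Suc k) < G (Suc k) r} w \<and> (\<forall>r. 1/2 \<le> G k r \<longrightarrow> w r = v r)"
      unfolding GSuc by (intro equivariant_unitary_extend[OF \<sigma> Gc Gi F c(1) c(2) c(3) _ u])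
  qed
  then obtain W where W: "\<And>k. equivariant_unitary act \<sigma> {r. c k < G k r} (W k)"
      "\<And>k r. 1/2 \<le> G k r \<Longrightarrow> W (Suc k) r = W k r"
    by blast
  have Ghalf: "1/2 < G k r" if "1/2 < F i r" "Suc i \<le> k" for i k r
    using that(2) by (induction k rule: dec_induct) (use that(1) in \<open>auto simp: GSuc\<close>)
  have stable: "W k r = W (Suc i) r" if "1/2 < F i r" "Suc i \<le> k" for i k r
    using that(2)
  proof (induction k rule: dec_induct)
    case (step k)
    then show ?case using W(2)[of k r] Ghalf[OF that(1), of k] by simp
  qed simp
  define w where "w r = W (Suc (LEAST i. 1/2 < F i r)) r" for r
  have w: "w r = W (Suc i) r" if "1/2 < F i r" for i r
    unfolding w_def by (rule stable[symmetric]) (use that LeastI[of "\<lambda>i. 1/2 < F i r"] Least_le[of "\<lambda>i. 1/2 < F i r"] in auto)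
  have O: "{r. 1/2 < F i r} \<subseteq> {r. c (Suc i) < G (Suc i) r}" for i
  proof clarify
    fix r assume "1/2 < F i r"
    then have "1/2 < G (Suc i) r" by (rule Ghalf) simp
    then show "c (Suc i) < G (Suc i) r" using c(3)[of "Suc i"] by linarith
  qed
  have "equivariant_unitary act \<sigma> UNIV w"
    unfolding equivariant_unitary_def
  proof (intro conjI ballI allI)
    fix r g
    obtain i where i: "1/2 < F i r" using cover by blast
    with O have r: "c (Suc i) < G (Suc i) r" by blast
    show "unitary_op (w r)" using W(1)[of "Suc i"] r by (simp add: w[OF i] equivariant_unitary_def)
    have "1/2 < F i (act r g)" using i by (simp add: F)
    then show "w (act r g) = w r o\<^sub>L \<sigma> g"
      using W(1)[of "Suc i"] r by (simp add: w[OF i] w equivariant_unitary_def)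
  next
    fix f
    have "continuous_on (\<Union>i. {r. 1/2 < F i r}) (\<lambda>r. blinfun_apply (w r) f)"
    proof (rule continuous_on_open_UN)
      show "open {r. 1/2 < F i r}" for i by (rule open_Collect_less[OF continuous_on_const F(1)])
      fix i
      have "continuous_on {r. 1/2 < F i r} (\<lambda>r. blinfun_apply (W (Suc i) r) f)"
        using W(1)[of "Suc i"] by (intro continuous_on_subset[OF _ O]) (simp add: equivariant_unitary_def)
      then show "continuous_on {r. 1/2 < F i r} (\<lambda>r. blinfun_apply (w r) f)"
        by (rule continuous_on_eq) (simp add: w)
    qed
    moreover have "(\<Union>i. {r. 1/2 < F i r}) = UNIV" using cover by auto
    ultimately show "continuous_on UNIV (\<lambda>r. blinfun_apply (w r) f)" by simp
  qed
  then show ?thesis by blast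
qed

section \<open>Continuity of smooth maps and local trivializations\<close>

lemma smooth_on_imp_continuous_on:
  assumes "smooth_on S f"
  shows "continuous_on S f"
  unfolding continuous_on_eq_continuous_within
proof
  fix x assume x: "x \<in> S"
  then obtain N F where N: "open N" "x \<in> N" "\<forall>k. Ck_on k F N" "\<forall>y\<in>S \<inter> N. F y = f y"
    using assms unfolding smooth_on_def by blast
  have "continuous_on N F" using N(3)[rule_format, of 0] by simp
  then have "continuous_on (S \<inter> N) F" by (rule continuous_on_subset) simp
  then have "continuous_on (S \<inter> N) f" by (rule continuous_on_eq) (use N(4) in simp)
  then have "continuous (at x within S \<inter> N) f"
    using x N(2) by (simp add: continuous_on_eq_continuous_within)
  moreover have "at x within S \<inter> N = at x within S"
    by (rule at_within_nhd[of x N]) (use N in auto)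
  ultimately show "continuous (at x within S) f" by simp
qed

text \<open>Near each point \<open>f\<close> is the local representative between the two chart maps.
  Only continuity and injectivity conditions on the charts are assumed, so that charts with values
  in the symplectic group, whose images are not open in the model space, are covered.\<close>

lemma smooth_map_on_imp_continuous_on:
  fixes A :: "('a::topological_space, 'e::real_normed_vector) chart set"
    and B :: "('b::topological_space, 'f::real_normed_vector) chart set"
  assumes f: "smooth_map_on A B S f"
    and A: "\<And>c. c \<in> A \<Longrightarrow> continuous_on (fst c) (snd c)" "\<And>c. c \<in> A \<Longrightarrow> inj_on (snd c) (fst c)"
    and B: "\<And>d. d \<in> B \<Longrightarrow> inj_on (snd d) (fst d)"
      "\<And>d. d \<in> B \<Longrightarrow> continuous_on (snd d ` fst d) (chart_inv d)"
  shows "continuous_on S f"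
  unfolding continuous_on_def
proof
  fix x assume x: "x \<in> S"
  then obtain c d N where c: "c \<in> A" and d: "d \<in> B" and N: "open N" "x \<in> N" "N \<subseteq> fst c"
    and fd: "f ` (N \<inter> S) \<subseteq> fst d" and sm: "smooth_on (snd c ` (N \<inter> S)) (snd d \<circ> f \<circ> chart_inv c)"
    using f unfolding smooth_map_on_def by blast
  have ci: "chart_inv c (snd c y) = y" if "y \<in> N \<inter> S" for y
    using that N(3) A(2)[OF c] by (auto simp: chart_inv_def)
  have di: "chart_inv d (snd d (f y)) = f y" if "y \<in> N \<inter> S" for y
    using that fd B(1)[OF d] by (auto simp: chart_inv_def)
  have "continuous_on (N \<inter> S) (\<lambda>y. chart_inv d ((snd d \<circ> f \<circ> chart_inv c) (snd c y)))"
  proof (rule continuous_on_compose2[OF B(2)[OF d]])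
    show "continuous_on (N \<inter> S) (\<lambda>y. (snd d \<circ> f \<circ> chart_inv c) (snd c y))"
      by (rule continuous_on_compose2[OF smooth_on_imp_continuous_on[OF sm]
          continuous_on_subset[OF A(1)[OF c]]]) (use N in auto)
    show "(\<lambda>y. (snd d \<circ> f \<circ> chart_inv c) (snd c y)) ` (N \<inter> S) \<subseteq> snd d ` fst d"
      using fd ci by auto
  qed
  then have "continuous_on (N \<inter> S) f"
    by (rule continuous_on_eq) (simp add: ci di)
  then have "(f \<longlongrightarrow> f x) (at x within N \<inter> S)"
    using x N(2) by (simp add: continuous_on_def)
  moreover have "at x within N \<inter> S = at x within S"
    by (rule at_within_nhd[of x N]) (use N in auto)
  ultimately show "(f \<longlongrightarrow> f x) (at x within S)" by simp
qed

section \<open>Continuity of the charts of the manifold, of the covering group and of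
  products\<close>

lemma smooth_atlas_charts:
  assumes "smooth_atlas A" "c \<in> A"
  shows "continuous_on (fst c) (snd c)" "inj_on (snd c) (fst c)"
    "continuous_on (snd c ` fst c) (chart_inv c)" "open (fst c)" "open (snd c ` fst c)"
proof -
  have h: "homeomorphism (fst c) (snd c ` fst c) (snd c) (chart_inv c)"
    and op: "open (fst c)" "open (snd c ` fst c)"
    using assms by (auto simp: smooth_atlas_def)
  from h show "continuous_on (fst c) (snd c)" "continuous_on (snd c ` fst c) (chart_inv c)"
    by (auto simp: homeomorphism_def)
  from h show "inj_on (snd c) (fst c)"
    by (auto simp: homeomorphism_def intro: inj_on_inverseI)
  show "open (fst c)" "open (snd c ` fst c)" by (rule op)+
qed

text \<open>Near \<open>lam g\<close> the inverse on \<open>W\<close> coincides with the local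
  inverse \<open>q\<close> over an evenly covered neighbourhood, as soon as \<open>q\<close> takes
  values in \<open>W\<close>; injectivity of \<open>lam\<close> on \<open>W\<close> then forces
  equality.\<close>

lemma cover_atlas_charts:
  fixes lam :: "'g::topological_space \<Rightarrow> 'e::topological_space"
  assumes cov: "covering_space UNIV lam T" and c: "c \<in> cover_atlas lam"
  shows "continuous_on (fst c) (snd c)" "inj_on (snd c) (fst c)"
    "continuous_on (snd c ` fst c) (chart_inv c)"
proof -
  obtain W where W: "c = (W, lam)" "open W" "inj_on lam W"
    using c by (auto simp: cover_atlas_def)
  show "continuous_on (fst c) (snd c)"
    using covering_space_imp_continuous[OF cov] W by (auto intro: continuous_on_subset)
  show "inj_on (snd c) (fst c)" using W by simp
  have "continuous_on (lam ` W) (inv_into W lam)"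
    unfolding continuous_on_def
  proof clarify
    fix g assume g: "g \<in> W"
    have "lam g \<in> T" using cov by (auto simp: covering_space_def)
    then obtain Q V where Q: "lam g \<in> Q" "openin (top_of_set T) Q" "\<Union>V = UNIV \<inter> lam -` Q"
      and V: "\<And>u. u \<in> V \<Longrightarrow> openin (top_of_set UNIV) u" "\<And>u. u \<in> V \<Longrightarrow> \<exists>q. homeomorphism u Q lam q"
      using cov unfolding covering_space_def by metis
    then obtain u where u: "u \<in> V" "g \<in> u" by blast
    obtain q where q: "homeomorphism u Q lam q" using V(2)[OF u(1)] by blast
    have qc: "continuous_on Q q" and qg: "q (lam g) = g" and lq: "\<And>y. y \<in> Q \<Longrightarrow> lam (q y) = y"
      using q u(2) by (auto simp: homeomorphism_def)
    obtain Q' where Q': "open Q'" "Q = T \<inter> Q'" using Q(2) by (auto simp: openin_open)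
    \<comment> \<open>Shrinking the neighbourhood by \<open>A\<close> keeps \<open>q\<close> inside
      \<open>W\<close>.\<close>
    obtain A where A: "open A" "A \<inter> Q = q -` W \<inter> Q"
      using qc W(2) by (auto simp: continuous_on_open_invariant)
    have lg: "lam g \<in> Q' \<inter> A" using Q(1) Q' A g qg by auto
    have eq: "inv_into W lam y = q y" if "y \<in> Q' \<inter> A" "y \<in> lam ` W" for y
    proof -
      have y: "y \<in> Q" using that Q'(2) cov by (auto simp: covering_space_def)
      then have "q y \<in> W" using A(2) that by auto
      then show ?thesis using lq[OF y] W(3) by (metis inv_into_f_f)
    qed
    have "lam ` W \<inter> (Q' \<inter> A) \<subseteq> Q" using Q'(2) cov by (auto simp: covering_space_def)
    then have "continuous_on (lam ` W \<inter> (Q' \<inter> A)) q" by (rule continuous_on_subset[OF qc])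
    then have "continuous_on (lam ` W \<inter> (Q' \<inter> A)) (inv_into W lam)"
      by (rule continuous_on_eq) (use eq in auto)
    then have "(inv_into W lam \<longlongrightarrow> inv_into W lam (lam g)) (at (lam g) within lam ` W \<inter> (Q' \<inter> A))"
      using lg g by (simp add: continuous_on_def)
    moreover have "at (lam g) within lam ` W \<inter> (Q' \<inter> A) = at (lam g) within lam ` W"
      by (rule at_within_nhd[of _ "Q' \<inter> A"]) (use lg Q' A in auto)
    ultimately show "(inv_into W lam \<longlongrightarrow> inv_into W lam (lam g)) (at (lam g) within lam ` W)" by simp
  qed
  then show "continuous_on (snd c ` fst c) (chart_inv c)" by (simp add: W chart_inv_def)
qed

lemma prod_atlas_charts:
  fixes A :: "('a::topological_space, 'e::topological_space) chart set"
    and B :: "('b::topological_space, 'f::topological_space) chart set"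
  assumes A: "\<And>c. c \<in> A \<Longrightarrow> continuous_on (fst c) (snd c)" "\<And>c. c \<in> A \<Longrightarrow> inj_on (snd c) (fst c)"
      "\<And>c. c \<in> A \<Longrightarrow> continuous_on (snd c ` fst c) (chart_inv c)"
    and B: "\<And>c. c \<in> B \<Longrightarrow> continuous_on (fst c) (snd c)" "\<And>c. c \<in> B \<Longrightarrow> inj_on (snd c) (fst c)"
      "\<And>c. c \<in> B \<Longrightarrow> continuous_on (snd c ` fst c) (chart_inv c)"
    and e: "e \<in> prod_atlas A B"
  shows "continuous_on (fst e) (snd e)" "inj_on (snd e) (fst e)"
    "continuous_on (snd e ` fst e) (chart_inv e)"
proof -
  obtain c d where cd: "c \<in> A" "d \<in> B" and e: "e = (fst c \<times> fst d, map_prod (snd c) (snd d))"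
    using e by (auto simp: prod_atlas_def)
  show "continuous_on (fst e) (snd e)"
    unfolding e map_prod_def case_prod_beta
    by (auto intro!: continuous_intros continuous_on_compose2[OF A(1)[OF cd(1)]]
        continuous_on_compose2[OF B(1)[OF cd(2)]])
  show inj: "inj_on (snd e) (fst e)"
    unfolding e using map_prod_inj_on[OF A(2)[OF cd(1)] B(2)[OF cd(2)]] by simp
  have im: "snd e ` fst e = (snd c ` fst c) \<times> (snd d ` fst d)"
    by (auto simp: e)
  have "continuous_on (snd e ` fst e) (\<lambda>z. (chart_inv c (fst z), chart_inv d (snd z)))"
    unfolding im
    by (auto intro!: continuous_intros continuous_on_compose2[OF A(3)[OF cd(1)]]
        continuous_on_compose2[OF B(3)[OF cd(2)]])
  then show "continuous_on (snd e ` fst e) (chart_inv e)"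
  proof (rule continuous_on_eq)
    fix z assume "z \<in> snd e ` fst e"
    then obtain x where x: "x \<in> fst e" "z = snd e x" by blast
    then have "chart_inv e z = x" using inj by (simp add: chart_inv_def)
    moreover have "(chart_inv c (fst z), chart_inv d (snd z)) = x"
      using x A(2)[OF cd(1)] B(2)[OF cd(2)] by (auto simp: e chart_inv_def)
    ultimately show "(chart_inv c (fst z), chart_inv d (snd z)) = chart_inv e z" by simp
  qed
qed

section \<open>Cut-off functions and continuous local trivializations\<close>

text \<open>A tent function in a chart, extended by zero. The ball carrying it has compact image
  \<open>C\<close>, which is closed because the manifold is Hausdorff, so the chart domain and the
  complement of \<open>C\<close> form an open cover on which continuity is checked.\<close>

lemma smooth_atlas_bump:
  fixes A :: "('m::t2_space, 'v::euclidean_space) chart set"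
  assumes A: "smooth_atlas A" and U: "open U" "m \<in> U"
  shows "\<exists>f :: 'm \<Rightarrow> real. continuous_on UNIV f \<and> f m = 1 \<and> (\<forall>x. 0 < f x \<longrightarrow> x \<in> U)"
proof -
  have "(\<Union>c\<in>A. fst c) = UNIV" using A by (simp add: smooth_atlas_def)
  then obtain c where c: "c \<in> A" "m \<in> fst c" by blast
  note ch = smooth_atlas_charts[OF A c(1)]
  let ?\<phi> = "snd c" and ?\<psi> = "chart_inv c"
  have \<psi>: "?\<psi> (?\<phi> x) = x" if "x \<in> fst c" for x
    using that ch(2) by (simp add: chart_inv_def)
  have "open (?\<psi> -` U \<inter> ?\<phi> ` fst c)"
    using ch(3,5) U(1) by (simp add: continuous_on_open_vimage)
  moreover have "?\<phi> m \<in> ?\<psi> -` U \<inter> ?\<phi> ` fst c" using c \<psi> U by auto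
  ultimately obtain e where e: "0 < e" "cball (?\<phi> m) e \<subseteq> ?\<psi> -` U \<inter> ?\<phi> ` fst c"
    using open_contains_cball by blast
  define C where "C = ?\<psi> ` cball (?\<phi> m) e"
  have "compact C"
    unfolding C_def using e(2) by (intro compact_continuous_image continuous_on_subset[OF ch(3)]) auto
  then have "closed C" by (rule compact_imp_closed)
  define f where "f x = (if x \<in> fst c then max 0 (1 - dist (?\<phi> m) (?\<phi> x) / e) else 0)" for x
  have f0: "f x = 0" if "x \<notin> C" for x
  proof (rule ccontr)
    assume "f x \<noteq> 0"
    then have x: "x \<in> fst c" and "max 0 (1 - dist (?\<phi> m) (?\<phi> x) / e) \<noteq> 0"
      unfolding f_def by presburger+
    then have "0 < 1 - dist (?\<phi> m) (?\<phi> x) / e" by linarith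
    then have "?\<phi> x \<in> cball (?\<phi> m) e" using e(1) by simp
    then have "x \<in> C" unfolding C_def using \<psi>[OF x] by (metis imageI)
    then show False using that by contradiction
  qed
  have "continuous_on (fst c) f"
  proof (rule continuous_on_eq)
    show "continuous_on (fst c) (\<lambda>x. max 0 (1 - dist (?\<phi> m) (?\<phi> x) / e))"
      by (intro continuous_intros ch(1)) (use e in auto)
  qed (simp add: f_def)
  moreover have "continuous_on (- C) f"
    by (rule continuous_on_eq[of _ "\<lambda>_. 0"]) (auto simp: f0)
  ultimately have "continuous_on (fst c \<union> - C) f"
    using ch(4) \<open>closed C\<close> by (intro continuous_on_open_Un) auto
  moreover have "C \<subseteq> fst c"
    unfolding C_def using e(2) \<psi> by auto
  then have "fst c \<union> - C = UNIV" by auto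
  moreover have "C \<subseteq> U" unfolding C_def using e(2) by auto
  then have "x \<in> U" if "0 < f x" for x using that f0[of x] by auto
  moreover have "f m = 1" using c by (simp add: f_def)
  ultimately show ?thesis by (intro exI[of _ f]) simp
qed

lemma principal_bundle_trivializations:
  fixes A :: "('m::{t2_space, second_countable_topology}, 'v::euclidean_space) chart set"
    and G :: "('g::topological_space) monoid" and lam :: "'g \<Rightarrow> 'v \<Rightarrow>\<^sub>L 'v"
    and AP :: "('p::{t2_space, second_countable_topology}, 'e::euclidean_space) chart set"
  assumes A: "smooth_atlas A" and cov: "covering_space UNIV lam T"
    and P: "principal_bundle A G (cover_atlas lam) AP \<pi> act"
  shows "continuous_on UNIV \<pi>"
    and "\<exists>U \<tau>. open U \<and> m \<in> U \<and> bij_betw \<tau> (\<pi> -` U) (U \<times> UNIV) \<and> continuous_on (\<pi> -` U) \<tau> \<and>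
      continuous_on (U \<times> UNIV) (inv_into (\<pi> -` U) \<tau>) \<and>
      (\<forall>r\<in>\<pi> -` U. fst (\<tau> r) = \<pi> r \<and> (\<forall>g. \<tau> (act r g) = (\<pi> r, snd (\<tau> r) \<otimes>\<^bsub>G\<^esub> g)))"
proof -
  have AP: "smooth_atlas AP" using P by (simp add: principal_bundle_def)
  note cA = smooth_atlas_charts[OF A] and cP = smooth_atlas_charts[OF AP]
    and cG = cover_atlas_charts[OF cov]
  note cAG = prod_atlas_charts[OF cA(1-3) cG]
  show "continuous_on UNIV \<pi>"
    by (rule smooth_map_on_imp_continuous_on[OF _ cP(1,2) cA(2,3)])
      (use P in \<open>simp_all add: principal_bundle_def\<close>)
  have "\<exists>U \<tau>. open U \<and> m \<in> U \<and>
        bij_betw \<tau> (\<pi> -` U) (U \<times> UNIV) \<and>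
        smooth_map_on AP (prod_atlas A (cover_atlas lam)) (\<pi> -` U) \<tau> \<and>
        smooth_map_on (prod_atlas A (cover_atlas lam)) AP (U \<times> UNIV) (inv_into (\<pi> -` U) \<tau>) \<and>
        (\<forall>r\<in>\<pi> -` U. fst (\<tau> r) = \<pi> r \<and>
           (\<forall>g. \<tau> (act r g) = (\<pi> r, snd (\<tau> r) \<otimes>\<^bsub>G\<^esub> g)))"
    using P by (simp add: principal_bundle_def)
  then obtain U \<tau> where U: "open U" "m \<in> U" "bij_betw \<tau> (\<pi> -` U) (U \<times> UNIV)"
      and s: "smooth_map_on AP (prod_atlas A (cover_atlas lam)) (\<pi> -` U) \<tau>"
        "smooth_map_on (prod_atlas A (cover_atlas lam)) AP (U \<times> UNIV) (inv_into (\<pi> -` U) \<tau>)"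
      and eq: "\<forall>r\<in>\<pi> -` U. fst (\<tau> r) = \<pi> r \<and> (\<forall>g. \<tau> (act r g) = (\<pi> r, snd (\<tau> r) \<otimes>\<^bsub>G\<^esub> g))"
    by blast
  have "continuous_on (\<pi> -` U) \<tau>"
    by (rule smooth_map_on_imp_continuous_on[OF s(1) cP(1,2) cAG(2,3)])
  moreover have "continuous_on (U \<times> UNIV) (inv_into (\<pi> -` U) \<tau>)"
    by (rule smooth_map_on_imp_continuous_on[OF s(2) cAG(1,2) cP(2,3)])
  ultimately show "\<exists>U \<tau>. open U \<and> m \<in> U \<and> bij_betw \<tau> (\<pi> -` U) (U \<times> UNIV) \<and> continuous_on (\<pi> -` U) \<tau> \<and>
      continuous_on (U \<times> UNIV) (inv_into (\<pi> -` U) \<tau>) \<and>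
      (\<forall>r\<in>\<pi> -` U. fst (\<tau> r) = \<pi> r \<and> (\<forall>g. \<tau> (act r g) = (\<pi> r, snd (\<tau> r) \<otimes>\<^bsub>G\<^esub> g)))"
    using U eq by blast
qed

section \<open>Trivialization of the bundle of measurements\<close>

lemma segal_shale_weilD:
  assumes "segal_shale_weil \<omega>0 G lam j L' \<sigma>"
  shows "unitary_op (\<sigma> g)" "\<sigma> \<one>\<^bsub>G\<^esub> = id_blinfun" "\<sigma> (g \<otimes>\<^bsub>G\<^esub> h) = \<sigma> g o\<^sub>L \<sigma> h"
    "continuous_on UNIV (\<lambda>g. blinfun_apply (\<sigma> g) f)"
  using assms unfolding segal_shale_weil_def by blast+

text \<open>The homomorphism property of \<sigma> makes \<sigma> composed with a group coordinate
  equivariant. Cut-offs pulled back along \<pi> are constant on orbits, as the gluing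
  requires.\<close>

lemma ex_equivariant_unitary:
  fixes A :: "('m::{t2_space, second_countable_topology}, 'v::euclidean_space) chart set"
    and G :: "('g::topological_space) monoid" and lam :: "'g \<Rightarrow> 'v \<Rightarrow>\<^sub>L 'v"
    and AP :: "('p::{t2_space, second_countable_topology}, 'e::euclidean_space) chart set"
    and \<sigma> :: "'g \<Rightarrow> 'l::euclidean_space l2 \<Rightarrow>\<^sub>L 'l l2"
  assumes A: "smooth_atlas A" and cov: "covering_space UNIV lam T"
    and P: "principal_bundle A G (cover_atlas lam) AP \<pi> act"
    and \<sigma>: "segal_shale_weil \<omega>0 G lam j L' \<sigma>"
  shows "\<exists>w. equivariant_unitary act \<sigma> UNIV w"
proof -
  note triv = principal_bundle_trivializations[OF A cov P]
  note s = segal_shale_weilD[OF \<sigma>]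
  have "\<exists>f \<gamma>. continuous_on UNIV f \<and> f m = (1::real) \<and> continuous_on {r. 0 < f (\<pi> r)} \<gamma> \<and>
      (\<forall>r. 0 < f (\<pi> r) \<longrightarrow> (\<forall>g. \<gamma> (act r g) = \<gamma> r \<otimes>\<^bsub>G\<^esub> g))" for m
  proof -
    obtain U \<tau> where U: "open U" "m \<in> U" "continuous_on (\<pi> -` U) \<tau>"
      "\<forall>r\<in>\<pi> -` U. fst (\<tau> r) = \<pi> r \<and> (\<forall>g. \<tau> (act r g) = (\<pi> r, snd (\<tau> r) \<otimes>\<^bsub>G\<^esub> g))"
      using triv(2)[of m] by blast
    obtain f :: "'m \<Rightarrow> real" where f: "continuous_on UNIV f" "f m = 1" "\<forall>x. 0 < f x \<longrightarrow> x \<in> U"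
      using smooth_atlas_bump[OF A U(1,2)] by blast
    have "continuous_on {r. 0 < f (\<pi> r)} (\<lambda>r. snd (\<tau> r))"
      by (intro continuous_on_snd continuous_on_subset[OF U(3)]) (use f in auto)
    then show ?thesis using f U(4) by (intro exI[of _ f] exI[of _ "\<lambda>r. snd (\<tau> r)"]) auto
  qed
  then obtain f \<gamma> where f: "\<And>m. continuous_on UNIV (f m)" "\<And>m. f m m = (1::real)"
    and \<gamma>: "\<And>m. continuous_on {r. 0 < f m (\<pi> r)} (\<gamma> m)"
      "\<And>m r g. 0 < f m (\<pi> r) \<Longrightarrow> \<gamma> m (act r g) = \<gamma> m r \<otimes>\<^bsub>G\<^esub> g"
    by metis
  \<comment> \<open>Second countability, through Lindelof, reduces the cut-offs to countably many,
    so that the gluing can proceed by induction on natural numbers.\<close>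
  have "\<And>S. S \<in> range (\<lambda>m. {x. 1/2 < f m x}) \<Longrightarrow> open S"
    using open_Collect_less[OF continuous_on_const f(1)] by blast
  then obtain \<F> where \<F>: "\<F> \<subseteq> range (\<lambda>m. {x. 1/2 < f m x})" "countable \<F>"
      "\<Union>\<F> = (\<Union>m. {x. 1/2 < f m x})"
    using Lindelof[of "range (\<lambda>m. {x. 1/2 < f m x})"] by metis
  then obtain C where C: "countable C" "\<F> = (\<lambda>m. {x. 1/2 < f m x}) ` C"
    by (metis countable_subset_image)
  have "x \<in> (\<Union>m. {x. 1/2 < f m x})" for x
    using f(2)[of x] by (auto intro!: exI[of _ x])
  then have cover: "\<exists>m\<in>C. 1/2 < f m x" for x
    using \<F>(3) C(2) by blast
  then have "C \<noteq> {}" by blast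
  \<comment> \<open>The enumeration may repeat members of \<open>C\<close>, which does no harm when
    gluing.\<close>
  define k where "k = from_nat_into C"
  have "range k = C" unfolding k_def by (rule range_from_nat_into[OF \<open>C \<noteq> {}\<close> C(1)])
  then have cover': "\<exists>i. 1/2 < f (k i) x" for x
    using cover[of x] by force
  have pi: "\<pi> (act r g) = \<pi> r" for r g using P by (simp add: principal_bundle_def)
  show ?thesis
  proof (rule equivariant_unitary_glue[where F = "\<lambda>i r. f (k i) (\<pi> r)" and u = "\<lambda>i r. \<sigma> (\<gamma> (k i) r)"])
    show "continuous_on UNIV (\<lambda>r. f (k i) (\<pi> r))" for i
      by (rule continuous_on_compose2[OF f(1) triv(1)]) auto
    show "equivariant_unitary act \<sigma> {r. 0 < f (k i) (\<pi> r)} (\<lambda>r. \<sigma> (\<gamma> (k i) r))" for i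
      unfolding equivariant_unitary_def
      by (auto simp: s(1,3) \<gamma>(2) intro!: continuous_on_compose2[OF s(4) \<gamma>(1)])
  qed (use cover' in \<open>auto simp: pi s(1)\<close>)
qed

section \<open>From an equivariant family to an isomorphism of Banach bundles\<close>

lemma topspace_quotient_topology: "topspace (quotient_topology X q) = q ` topspace X"
proof
  show "topspace (quotient_topology X q) \<subseteq> q ` topspace X"
    using iffD1[OF openin_quotient_topology openin_topspace] by (rule conjunct1)
  have "{x \<in> topspace X. q x \<in> q ` topspace X} = topspace X" by auto
  then have "openin (quotient_topology X q) (q ` topspace X)"
    by (simp add: openin_quotient_topology)
  then show "q ` topspace X \<subseteq> topspace (quotient_topology X q)" by (rule openin_subset)
qed

text \<open>Local triviality is condensed into its two consequences: the group is transitive on the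
  fibres of \<pi>, and \<pi> has continuous local sections.\<close>

context
  fixes G :: "('g::topological_space) monoid"
    and \<pi> :: "'p::topological_space \<Rightarrow> 'm::topological_space" and act :: "'p \<Rightarrow> 'g \<Rightarrow> 'p"
    and \<sigma> :: "'g \<Rightarrow> 'l::euclidean_space l2 \<Rightarrow>\<^sub>L 'l l2" and w :: "'p \<Rightarrow> 'l l2 \<Rightarrow>\<^sub>L 'l l2"
  assumes G: "group G" "carrier G = UNIV"
    and act: "act r \<one>\<^bsub>G\<^esub> = r" "act (act r g) h = act r (g \<otimes>\<^bsub>G\<^esub> h)" "\<pi> (act r g) = \<pi> r"
    and trans: "\<pi> r = \<pi> r' \<Longrightarrow> \<exists>g. r' = act r g"
    and pi_cont: "continuous_on UNIV \<pi>"
    and sections: "\<exists>U s. open U \<and> m \<in> U \<and> continuous_on U s \<and> (\<forall>x\<in>U. \<pi> (s x) = x)"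
    and \<sigma>: "unitary_op (\<sigma> g)" "\<sigma> \<one>\<^bsub>G\<^esub> = id_blinfun" "\<sigma> (g \<otimes>\<^bsub>G\<^esub> h) = \<sigma> g o\<^sub>L \<sigma> h"
    and w: "equivariant_unitary act \<sigma> UNIV w"
begin

private definition cls :: "'p \<Rightarrow> ('l l2 \<Rightarrow>\<^sub>L 'l l2) \<Rightarrow> ('p \<times> ('l l2 \<Rightarrow>\<^sub>L 'l l2)) set" where
  "cls r a = assoc_class G act (Ad_rep \<sigma>) (r, a)"

private definition triv :: "'p \<times> ('l l2 \<Rightarrow>\<^sub>L 'l l2) \<Rightarrow> 'm \<times> ('l l2 \<Rightarrow>\<^sub>L 'l l2)" where
  "triv z = (\<pi> (fst z), unitary_conj (w (fst z)) (snd z))"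

private lemma w_unitary: "unitary_op (w r)" and w_act: "w (act r g) = w r o\<^sub>L \<sigma> g"
  and w_cont: "continuous_on UNIV (\<lambda>r. blinfun_apply (w r) f)"
  using w by (auto simp: equivariant_unitary_def)

private lemma cls_eq: "cls r a = {(act r (inv\<^bsub>G\<^esub> g), unitary_conj (\<sigma> g) a) |g. True}"
  by (simp add: cls_def assoc_class_def G(2) Ad_rep_eq_unitary_conj[of \<sigma>, OF \<sigma>(1)])

private lemma conj_one: "unitary_conj (\<sigma> \<one>\<^bsub>G\<^esub>) a = a"
proof -
  have "unitary_inv (id_blinfun :: 'l l2 \<Rightarrow>\<^sub>L 'l l2) = id_blinfun"
    by (rule unitary_inv_eqI) (auto intro: blinfun_eqI)
  then show ?thesis by (intro blinfun_eqI) (simp add: \<sigma>(2))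
qed

private lemma conj_mult: "unitary_conj (\<sigma> (g \<otimes>\<^bsub>G\<^esub> h)) a = unitary_conj (\<sigma> g) (unitary_conj (\<sigma> h) a)"
  by (simp add: \<sigma>(3) unitary_conj_compose[OF \<sigma>(1) \<sigma>(1)])

private lemma triv_act: "triv (act r g, a) = triv (r, unitary_conj (\<sigma> g) a)"
  by (simp add: triv_def act w_act unitary_conj_compose[OF w_unitary \<sigma>(1)])

text \<open>The group element can be moved across to the operator. The substitution
  \<open>h \<otimes> inv g\<close> for \<open>h\<close> matches the two orbits member by
  member.\<close>

private lemma cls_act: "cls (act r g) a = cls r (unitary_conj (\<sigma> g) a)"
proof -
  interpret group G by (rule G)
  have "(act (act r g) (inv\<^bsub>G\<^esub> h), unitary_conj (\<sigma> h) a) \<in> cls r (unitary_conj (\<sigma> g) a)" for h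
  proof -
    let ?k = "h \<otimes>\<^bsub>G\<^esub> inv\<^bsub>G\<^esub> g"
    have "act (act r g) (inv\<^bsub>G\<^esub> h) = act r (inv\<^bsub>G\<^esub> ?k)"
      by (simp add: act inv_mult_group G(2))
    moreover have "unitary_conj (\<sigma> h) a = unitary_conj (\<sigma> ?k) (unitary_conj (\<sigma> g) a)"
      by (simp add: m_assoc G(2) flip: conj_mult)
    ultimately show ?thesis unfolding cls_eq by blast
  qed
  moreover have "(act r (inv\<^bsub>G\<^esub> k), unitary_conj (\<sigma> k) (unitary_conj (\<sigma> g) a)) \<in> cls (act r g) a" for k
  proof -
    let ?h = "k \<otimes>\<^bsub>G\<^esub> g"
    have "act (act r g) (inv\<^bsub>G\<^esub> ?h) = act r (inv\<^bsub>G\<^esub> k)"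
      by (simp add: act inv_mult_group G(2) m_assoc[symmetric])
    moreover have "unitary_conj (\<sigma> ?h) a = unitary_conj (\<sigma> k) (unitary_conj (\<sigma> g) a)"
      by (rule conj_mult)
    ultimately show ?thesis unfolding cls_eq by (metis (mono_tags, lifting) mem_Collect_eq)
  qed
  ultimately show ?thesis by (auto simp: cls_eq)
qed

private lemma triv_cong_cls:
  assumes "cls r a = cls r' a'"
  shows "triv (r, a) = triv (r', a')"
proof -
  interpret group G by (rule G)
  have "(act r (inv\<^bsub>G\<^esub> \<one>\<^bsub>G\<^esub>), unitary_conj (\<sigma> \<one>\<^bsub>G\<^esub>) a) \<in> cls r a"
    unfolding cls_eq by blast
  then have "(r, a) \<in> cls r' a'" by (simp add: assms act conj_one)
  then obtain g where g: "r = act r' (inv\<^bsub>G\<^esub> g)" "a = unitary_conj (\<sigma> g) a'"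
    by (auto simp: cls_eq)
  show ?thesis unfolding g triv_act by (simp add: conj_one G(2) flip: conj_mult)
qed

text \<open>The classes are exactly the fibres of \<open>triv\<close>. For the converse, equal base
  points give \<open>r' = r g\<close> by transitivity, and conjugation by \<open>w r\<close> can be
  cancelled. All statements about classes below reduce to this.\<close>

private lemma cls_eq_iff: "cls r a = cls r' a' \<longleftrightarrow> triv (r, a) = triv (r', a')"
proof
  assume eq: "triv (r, a) = triv (r', a')"
  then obtain g where g: "r' = act r g" using trans by (auto simp: triv_def)
  have "unitary_conj (w r) a = unitary_conj (w r) (unitary_conj (\<sigma> g) a')"
    using eq unfolding g triv_act by (simp add: triv_def)
  then have "a = unitary_conj (\<sigma> g) a'"
    by (metis unitary_conj_inverse(2)[OF w_unitary])
  then show "cls r a = cls r' a'" by (simp add: g cls_act)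
qed (rule triv_cong_cls)

private lemma triv_compact: "snd z \<in> compact_ops \<Longrightarrow> snd (triv z) \<in> compact_ops"
  by (simp add: triv_def unitary_conj_compact_ops[OF w_unitary])

private lemma triv_continuous: "continuous_on (UNIV \<times> compact_ops) triv"
proof -
  have "continuous_on (UNIV \<times> compact_ops) (\<lambda>z. unitary_conj (w (fst z)) (snd z))"
    by (rule continuous_on_unitary_conj)
      (auto intro!: w_unitary continuous_intros continuous_on_compose2[OF w_cont])
  then show ?thesis
    unfolding triv_def[abs_def]
    by (intro continuous_on_Pair continuous_on_compose2[OF pi_cont]) (auto intro!: continuous_intros)
qed

private definition quot :: "'p \<times> ('l l2 \<Rightarrow>\<^sub>L 'l l2) \<Rightarrow> ('p \<times> ('l l2 \<Rightarrow>\<^sub>L 'l l2)) set" where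
  "quot z = cls (fst z) (snd z)"

private definition bundle_triv :: "('p \<times> ('l l2 \<Rightarrow>\<^sub>L 'l l2)) set \<Rightarrow> 'm \<times> ('l l2 \<Rightarrow>\<^sub>L 'l l2)" where
  "bundle_triv X = triv (SOME z. X = quot z)"

private lemma quot_eq_iff: "quot z = quot z' \<longleftrightarrow> triv z = triv z'"
  by (cases z; cases z') (simp add: quot_def cls_eq_iff)

private lemma bundle_triv_quot: "bundle_triv (quot z) = triv z"
proof -
  have "quot z = quot (SOME z'. quot z = quot z')" by (rule someI[of "\<lambda>z'. quot z = quot z'" z]) simp
  then show ?thesis by (simp add: bundle_triv_def quot_eq_iff)
qed

text \<open>Over a local section \<open>s\<close>, the map \<xi> sends (x, b) to \<open>s x\<close>
  paired with the conjugate of \<open>b\<close> by the inverse of \<open>w (s x)\<close>. It is a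
  continuous right inverse of \<open>triv\<close>, so its preimage of \<open>Z\<close> is an open
  set contained in the image of \<open>Z\<close>.\<close>

private lemma openin_triv_image:
  assumes "openin (top_of_set (UNIV \<times> compact_ops)) Z"
    and sat: "\<And>z z'. z \<in> Z \<Longrightarrow> snd z' \<in> compact_ops \<Longrightarrow> triv z' = triv z \<Longrightarrow> z' \<in> Z"
  shows "openin (top_of_set (UNIV \<times> compact_ops)) (triv ` Z)"
proof (subst openin_subopen, intro ballI, elim imageE)
  fix y z assume y: "y = triv z" and z: "z \<in> Z"
  have ZC: "Z \<subseteq> UNIV \<times> compact_ops" using assms(1) openin_imp_subset by blast
  obtain U s where U: "open U" "\<pi> (fst z) \<in> U" "continuous_on U s" "\<And>x. x \<in> U \<Longrightarrow> \<pi> (s x) = x"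
    using sections[of "\<pi> (fst z)"] by blast
  define \<xi> where "\<xi> y = (s (fst y), unitary_conj (unitary_inv (w (s (fst y)))) (snd y))" for y
  let ?D = "U \<times> (compact_ops :: ('l l2 \<Rightarrow>\<^sub>L 'l l2) set)"
  have sc: "continuous_on ?D (\<lambda>y. s (fst y))"
    by (rule continuous_on_compose2[OF U(3)]) (auto intro!: continuous_intros)
  have "continuous_on ?D (\<lambda>y. unitary_conj (unitary_inv (w (s (fst y)))) (snd y))"
  proof (rule continuous_on_unitary_conj)
    show "continuous_on ?D (\<lambda>y. blinfun_apply (unitary_inv (w (s (fst y)))) f)" for f
      by (rule continuous_on_unitary_inv) (auto intro!: w_unitary continuous_on_compose2[OF w_cont sc])
  qed (auto intro!: unitary_op_unitary_inv w_unitary continuous_intros)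
  then have \<xi>c: "continuous_on ?D \<xi>"
    unfolding \<xi>_def[abs_def] by (intro continuous_on_Pair sc)
  have \<xi>C: "\<xi> y \<in> UNIV \<times> compact_ops" if "y \<in> ?D" for y
    using that
    by (simp add: mem_Times_iff \<xi>_def unitary_conj_compact_ops[OF unitary_op_unitary_inv[OF w_unitary]])
  have tx: "triv (\<xi> y) = y" if "y \<in> ?D" for y
  proof -
    have "\<pi> (s (fst y)) = fst y" by (rule U(4)) (use that in auto)
    then show ?thesis by (simp add: triv_def \<xi>_def unitary_conj_inverse(1)[OF w_unitary])
  qed
  let ?T = "?D \<inter> \<xi> -` Z"
  have "openin (top_of_set ?D) ?T"
    by (rule continuous_openin_preimage[OF \<xi>c _ assms(1)]) (use \<xi>C in blast)
  moreover have "openin (top_of_set (UNIV \<times> compact_ops)) ?D"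
  proof -
    have "?D = (UNIV \<times> compact_ops) \<inter> (U \<times> UNIV)" by auto
    then show ?thesis using U(1) by (metis open_Times open_UNIV openin_open_Int)
  qed
  ultimately have "openin (top_of_set (UNIV \<times> compact_ops)) ?T" by (rule openin_trans)
  moreover have "triv z \<in> ?D"
    using z ZC U(2) triv_compact[of z] by (auto simp: triv_def)
  \<comment> \<open>The point \<xi> \<open>(triv z)\<close> may differ from \<open>z\<close>, but
    has the same image, so saturation puts it into \<open>Z\<close>.\<close>
  then have "triv z \<in> ?T"
    using sat[OF z, of "\<xi> (triv z)"] \<xi>C tx by (auto simp: mem_Times_iff)
  moreover have "?T \<subseteq> triv ` Z"
  proof
    fix y assume "y \<in> ?T"
    then have "triv (\<xi> y) = y" "\<xi> y \<in> Z" using tx by auto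
    then show "y \<in> triv ` Z" by (metis imageI)
  qed
  ultimately show "\<exists>T. openin (top_of_set (UNIV \<times> compact_ops)) T \<and> y \<in> T \<and> T \<subseteq> triv ` Z"
    unfolding y by (intro exI[of _ ?T] conjI)
qed

private lemma total_measurement_bundle:
  "total (measurement_bundle G \<pi> act \<sigma>) = quotient_topology (top_of_set (UNIV \<times> compact_ops)) quot"
  by (simp add: measurement_bundle_def Let_def quot_def[abs_def] cls_def case_prod_beta)

private lemma topspace_measurement_bundle:
  "topspace (total (measurement_bundle G \<pi> act \<sigma>)) = quot ` (UNIV \<times> compact_ops)"
  by (simp add: total_measurement_bundle topspace_quotient_topology)

text \<open>Continuity is the universal property of the quotient. Openness follows because the
  preimage of a set of classes is saturated.\<close>

private lemma homeomorphic_bundle_triv: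
  "homeomorphic_map (total (measurement_bundle G \<pi> act \<sigma>))
     (total (product_bundle (compact_ops :: ('l l2 \<Rightarrow>\<^sub>L 'l l2) set) :: ('m \<times> _, 'm) banach_bundle)) bundle_triv"
  unfolding total_measurement_bundle product_bundle_def banach_bundle.simps
proof (rule bijective_open_imp_homeomorphic_map)
  let ?E = "UNIV \<times> (compact_ops :: ('l l2 \<Rightarrow>\<^sub>L 'l l2) set)"
  let ?Q = "quotient_topology (top_of_set ?E) quot"
  have surj: "triv ` ?E = UNIV \<times> compact_ops"
  proof
    show "triv ` ?E \<subseteq> UNIV \<times> compact_ops" 
      by (rule image_subsetI) (simp add: mem_Times_iff triv_compact)
    have "(m, b) \<in> triv ` ?E" if "b \<in> compact_ops" for m b
    proof -
      obtain r where r: "\<pi> r = m" using sections[of m] by blast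
      let ?a = "unitary_conj (unitary_inv (w r)) b"
      have "triv (r, ?a) = (m, b)"
        by (simp add: triv_def r unitary_conj_inverse(1)[OF w_unitary])
      moreover have "?a \<in> compact_ops"
        using that by (intro unitary_conj_compact_ops unitary_op_unitary_inv w_unitary)
      ultimately show ?thesis by (metis SigmaI UNIV_I imageI)
    qed
    then show "UNIV \<times> compact_ops \<subseteq> triv ` ?E" by auto
  qed
  show "bundle_triv ` topspace ?Q = topspace (top_of_set (UNIV \<times> compact_ops))"
    unfolding topspace_quotient_topology using surj
    by (simp add: image_image bundle_triv_quot)
  show "inj_on bundle_triv (topspace ?Q)"
  proof (rule inj_onI)
    fix X Y assume "X \<in> topspace ?Q" "Y \<in> topspace ?Q" and eq: "bundle_triv X = bundle_triv Y"
    then obtain z z' where "X = quot z" "Y = quot z'"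
      unfolding topspace_quotient_topology by blast
    with eq show "X = Y" by (simp add: bundle_triv_quot quot_eq_iff)
  qed
  show "continuous_map ?Q (top_of_set (UNIV \<times> compact_ops)) bundle_triv"
    unfolding continuous_map
  proof (intro conjI allI impI)
    show "bundle_triv ` topspace ?Q \<subseteq> topspace (top_of_set (UNIV \<times> compact_ops))"
      unfolding topspace_quotient_topology using surj by (simp add: image_image bundle_triv_quot)
    fix V :: "('m \<times> ('l l2 \<Rightarrow>\<^sub>L 'l l2)) set" assume V: "openin (top_of_set (UNIV \<times> compact_ops)) V"
    have "openin (top_of_set ?E) (?E \<inter> triv -` V)"
      by (rule continuous_openin_preimage[OF triv_continuous _ V]) (use surj in blast)
    moreover have "{z \<in> topspace (top_of_set ?E). quot z \<in> {x \<in> topspace ?Q. bundle_triv x \<in> V}}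
        = ?E \<inter> triv -` V"
      by (auto simp: topspace_quotient_topology bundle_triv_quot)
    ultimately show "openin ?Q {x \<in> topspace ?Q. bundle_triv x \<in> V}"
      by (auto simp: openin_quotient_topology topspace_quotient_topology)
  qed
  show "open_map ?Q (top_of_set (UNIV \<times> compact_ops)) bundle_triv"
    unfolding open_map_def
  proof (intro allI impI)
    fix X assume X: "openin ?Q X"
    define Z where "Z = {z \<in> ?E. quot z \<in> X}"
    have Z: "openin (top_of_set ?E) Z" "X \<subseteq> quot ` ?E"
      using X by (simp_all add: openin_quotient_topology Z_def)
    then have "X = quot ` Z"
      unfolding Z_def by blast
    then have "bundle_triv ` X = triv ` Z"
      by (simp only: image_image bundle_triv_quot)
    moreover have "openin (top_of_set (UNIV \<times> compact_ops)) (triv ` Z)"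
      by (rule openin_triv_image[OF Z(1)]) (auto simp: Z_def mem_Times_iff quot_eq_iff[symmetric])
    ultimately show "openin (top_of_set (UNIV \<times> compact_ops)) (bundle_triv ` X)" by simp
  qed
qed

private lemma triv_cls: "bundle_triv (cls r a) = triv (r, a)"
  using bundle_triv_quot[of "(r, a)"] by (simp add: quot_def)

text \<open>The fibre operations are definite descriptions over representatives. Uniqueness follows
  from \<open>cls_eq_iff\<close>, as conjugation by a unitary is complex linear and preserves the
  norm.\<close>

lemma bundle_isomorphic_if_equivariant_unitary:
  "bundle_isomorphic (measurement_bundle G \<pi> act \<sigma>)
     (product_bundle (compact_ops :: ('l l2 \<Rightarrow>\<^sub>L 'l l2) set))"
proof -
  let ?B = "measurement_bundle G \<pi> act \<sigma>"
  let ?C = "compact_ops :: ('l l2 \<Rightarrow>\<^sub>L 'l l2) set"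
  have pr: "proj ?B (cls r a) = \<pi> r" if "a \<in> ?C" for r a
  proof -
    have "proj ?B (cls r a) = (THE m. \<exists>r'. \<exists>a'\<in>?C. cls r a = cls r' a' \<and> m = \<pi> r')"
      by (simp add: measurement_bundle_def Let_def cls_def)
    also have "\<dots> = \<pi> r"
      by (rule the_equality) (use that in \<open>auto simp: cls_eq_iff triv_def\<close>)
    finally show ?thesis .
  qed
  have no: "fnorm ?B (cls r a) = norm a" if "a \<in> ?C" for r a
  proof -
    have "fnorm ?B (cls r a) = (THE s. \<exists>r'. \<exists>a'\<in>?C. cls r a = cls r' a' \<and> s = norm a')"
      by (simp add: measurement_bundle_def Let_def cls_def)
    also have "\<dots> = norm a"
    proof (rule the_equality)
      fix s assume "\<exists>r'. \<exists>a'\<in>?C. cls r a = cls r' a' \<and> s = norm a'"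
      then obtain r' a' where "unitary_conj (w r) a = unitary_conj (w r') a'" "s = norm a'"
        by (auto simp: cls_eq_iff triv_def)
      then show "s = norm a" by (metis norm_unitary_conj[OF w_unitary])
    qed (use that in auto)
    finally show ?thesis .
  qed
  have ad: "fadd ?B (cls r a) (cls r b) = cls r (a + b)" if "a \<in> ?C" "b \<in> ?C" for r a b
  proof -
    have "fadd ?B (cls r a) (cls r b) = (THE Z. \<exists>r'. \<exists>a'\<in>?C. \<exists>b'\<in>?C.
        cls r a = cls r' a' \<and> cls r b = cls r' b' \<and> Z = cls r' (a' + b'))"
      by (simp add: measurement_bundle_def Let_def cls_def)
    also have "\<dots> = cls r (a + b)"
    proof (rule the_equality)
      fix Z assume "\<exists>r'. \<exists>a'\<in>?C. \<exists>b'\<in>?C. cls r a = cls r' a' \<and> cls r b = cls r' b' \<and> Z = cls r' (a' + b')"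
      then obtain r' a' b' where "cls r a = cls r' a'" "cls r b = cls r' b'" and Z: "Z = cls r' (a' + b')"
        by blast
      then show "Z = cls r (a + b)"
        unfolding Z by (simp add: cls_eq_iff triv_def unitary_conj_add)
    qed (use that in blast)
    finally show ?thesis .
  qed
  have sc: "fscale ?B c (cls r a) = cls r (cscale_op c a)" if "a \<in> ?C" for c r a
  proof -
    have "fscale ?B c (cls r a) = (THE Z. \<exists>r'. \<exists>a'\<in>?C. cls r a = cls r' a' \<and> Z = cls r' (cscale_op c a'))"
      by (simp add: measurement_bundle_def Let_def cls_def)
    also have "\<dots> = cls r (cscale_op c a)"
    proof (rule the_equality)
      fix Z assume "\<exists>r'. \<exists>a'\<in>?C. cls r a = cls r' a' \<and> Z = cls r' (cscale_op c a')"
      then obtain r' a' where "cls r a = cls r' a'" and Z: "Z = cls r' (cscale_op c a')"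
        by blast
      then show "Z = cls r (cscale_op c a)"
        unfolding Z by (simp add: cls_eq_iff triv_def unitary_conj_cscale_op[OF w_unitary])
    qed (use that in blast)
    finally show ?thesis .
  qed
  have top: "\<exists>r. \<exists>a\<in>?C. x = cls r a" if x: "x \<in> topspace (total ?B)" for x
  proof -
    obtain z where "x = quot z" "z \<in> UNIV \<times> ?C"
      using x unfolding topspace_measurement_bundle by (rule imageE)
    then show ?thesis
      by (intro exI[of _ "fst z"] bexI[of _ "snd z"]) (simp_all add: quot_def mem_Times_iff)
  qed
  have "bundle_iso ?B (product_bundle ?C) bundle_triv"
    unfolding bundle_iso_def
  proof (intro conjI ballI allI impI)
    show "homeomorphic_map (total ?B) (total (product_bundle ?C)) bundle_triv"
      by (rule homeomorphic_bundle_triv)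
    fix x assume "x \<in> topspace (total ?B)"
    then obtain r a where x: "x = cls r a" "a \<in> ?C" using top by blast
    show "proj (product_bundle ?C) (bundle_triv x) = proj ?B x"
      by (simp add: x pr triv_cls triv_def product_bundle_def)
    show "fnorm (product_bundle ?C) (bundle_triv x) = fnorm ?B x"
      by (simp add: x no triv_cls triv_def product_bundle_def norm_unitary_conj[OF w_unitary])
    show "bundle_triv (fscale ?B c x) = fscale (product_bundle ?C) c (bundle_triv x)" for c
      by (simp add: x sc triv_cls triv_def product_bundle_def unitary_conj_cscale_op[OF w_unitary])
    fix y assume "y \<in> topspace (total ?B)" and eq: "proj ?B x = proj ?B y"
    then obtain r' b where y: "y = cls r' b" "b \<in> ?C" using top by blast
    \<comment> \<open>\<open>fadd\<close> expects both summands over the same point of P, so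
      \<open>y\<close> is rewritten over \<open>r\<close>.\<close>
    then obtain g where "r' = act r g" using eq trans by (auto simp: x pr)
    then have "y = cls r (unitary_conj (\<sigma> g) b)" by (simp add: y cls_act)
    moreover have "unitary_conj (\<sigma> g) b \<in> ?C" by (rule unitary_conj_compact_ops[OF \<sigma>(1) y(2)])
    ultimately show "bundle_triv (fadd ?B x y) = fadd (product_bundle ?C) (bundle_triv x) (bundle_triv y)"
      by (simp add: x ad triv_cls triv_def product_bundle_def unitary_conj_add)
  qed
  then show ?thesis unfolding bundle_isomorphic_def by blast
qed

end

theorem theorem7:
  fixes n :: nat
    and \<omega>0 :: "'v::euclidean_space \<Rightarrow> 'v \<Rightarrow> real"
    and L L' :: "'v set"
    and j :: "'l::euclidean_space \<Rightarrow> 'v"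
    and G :: "('g::topological_space) monoid"
    and lam :: "'g \<Rightarrow> 'v \<Rightarrow>\<^sub>L 'v"
    and \<sigma> :: "'g \<Rightarrow> 'l l2 \<Rightarrow>\<^sub>L 'l l2"
    and A :: "('m::{t2_space, second_countable_topology}, 'v) chart set"
    and \<omega> :: "'m \<Rightarrow> ('m, 'v) tvec \<Rightarrow> ('m, 'v) tvec \<Rightarrow> real"
    and AP :: "('p::{t2_space, second_countable_topology}, 'e::euclidean_space) chart set"
    and \<pi> :: "'p \<Rightarrow> 'm"
    and act :: "'p \<Rightarrow> 'g \<Rightarrow> 'p"
    and \<Lambda> :: "'p \<Rightarrow> 'm \<times> ('v \<Rightarrow> ('m, 'v) tvec)"
  assumes "n \<ge> 1" and "DIM('v) = 2 * n"
    and "symplectic_space \<omega>0"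
    and "lagrangian \<omega>0 L"
    and "linear j" and "inj j" and "range j = L"
    and "lagrangian \<omega>0 L'" and "L \<inter> L' = {0}"
    and "connected_double_cover \<omega>0 G lam"
    and "segal_shale_weil \<omega>0 G lam j L' \<sigma>"
    and "symplectic_manifold A \<omega>"
    and "metaplectic_structure A \<omega> \<omega>0 G lam AP \<pi> act \<Lambda>"
  shows "bundle_isomorphic (measurement_bundle G \<pi> act \<sigma>)
           (product_bundle (compact_ops :: ('l l2 \<Rightarrow>\<^sub>L 'l l2) set)) \<and>
         trivial_bundle TYPE('l) (measurement_bundle G \<pi> act \<sigma>)"
proof -
  have G: "group G" "carrier G = UNIV" and cov: "covering_space UNIV lam (carrier (Sp \<omega>0))"
    using assms(10) by (auto simp: connected_double_cover_def topological_group_def)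
  have A: "smooth_atlas A" using assms(12) by (simp add: symplectic_manifold_def)
  have P: "principal_bundle A G (cover_atlas lam) AP \<pi> act"
    using assms(13) by (simp add: metaplectic_structure_def)
  have act: "act r \<one>\<^bsub>G\<^esub> = r" "act (act r g) h = act r (g \<otimes>\<^bsub>G\<^esub> h)" "\<pi> (act r g) = \<pi> r" for r g h
    using P by (simp_all add: principal_bundle_def)
  note triv = principal_bundle_trivializations[OF A cov P]
  note s = segal_shale_weilD[OF assms(11)]
  interpret group G by (rule G)
  have trans: "\<exists>g. r' = act r g" if eq: "\<pi> r = \<pi> r'" for r r'
  proof -
    obtain U \<tau> where U: "\<pi> r \<in> U" "bij_betw \<tau> (\<pi> -` U) (U \<times> UNIV)"
      "\<forall>r\<in>\<pi> -` U. fst (\<tau> r) = \<pi> r \<and> (\<forall>g. \<tau> (act r g) = (\<pi> r, snd (\<tau> r) \<otimes>\<^bsub>G\<^esub> g))"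
      using triv(2)[of "\<pi> r"] by blast
    \<comment> \<open>The group element that carries the fibre coordinate of \<open>r\<close> to
      that of \<open>r'\<close>.\<close>
    let ?g = "inv\<^bsub>G\<^esub> (snd (\<tau> r)) \<otimes>\<^bsub>G\<^esub> snd (\<tau> r')"
    have "\<tau> (act r ?g) = (\<pi> r, snd (\<tau> r'))"
      using U by (simp add: m_assoc[symmetric] G(2))
    also have "\<dots> = \<tau> r'" using U eq by (metis prod.collapse vimage_eq)
    finally have "act r ?g = r'"
      using U eq by (auto simp: bij_betw_def inj_on_def act)
    then show ?thesis by metis
  qed
  have sections: "\<exists>U s. open U \<and> m \<in> U \<and> continuous_on U s \<and> (\<forall>x\<in>U. \<pi> (s x) = x)" for m
  proof -
    obtain U \<tau> where U: "open U" "m \<in> U" "bij_betw \<tau> (\<pi> -` U) (U \<times> UNIV)"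
      "continuous_on (U \<times> UNIV) (inv_into (\<pi> -` U) \<tau>)"
      "\<forall>r\<in>\<pi> -` U. fst (\<tau> r) = \<pi> r \<and> (\<forall>g. \<tau> (act r g) = (\<pi> r, snd (\<tau> r) \<otimes>\<^bsub>G\<^esub> g))"
      using triv(2)[of m] by blast
    \<comment> \<open>The section with constant fibre coordinate, the unit of the group.\<close>
    let ?s = "\<lambda>x. inv_into (\<pi> -` U) \<tau> (x, \<one>\<^bsub>G\<^esub>)"
    have "continuous_on U ?s"
      by (rule continuous_on_compose2[OF U(4)]) (auto intro!: continuous_intros)
    moreover have "\<pi> (?s x) = x" if "x \<in> U" for x
    proof -
      have "(x, \<one>\<^bsub>G\<^esub>) \<in> \<tau> ` (\<pi> -` U)" using that U(3) by (simp add: bij_betw_def)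
      then have "\<tau> (?s x) = (x, \<one>\<^bsub>G\<^esub>)" "?s x \<in> \<pi> -` U"
        by (rule f_inv_into_f, rule inv_into_into)
      then show ?thesis using U(5) by (metis fst_conv)
    qed
    ultimately show ?thesis using U(1,2) by blast
  qed
  obtain w where w: "equivariant_unitary act \<sigma> UNIV w"
    using ex_equivariant_unitary[OF A cov P assms(11)] by blast
  have iso: "bundle_isomorphic (measurement_bundle G \<pi> act \<sigma>)
      (product_bundle (compact_ops :: ('l l2 \<Rightarrow>\<^sub>L 'l l2) set))"
    by (rule bundle_isomorphic_if_equivariant_unitary[OF G act trans triv(1) sections s(1-3) w])
  \<comment> \<open>The model fibre is the space of compact operators itself, a complex subspace
    that is complete because it is closed in the space of bounded operators.\<close>
  then have "trivial_bundle TYPE('l) (measurement_bundle G \<pi> act \<sigma>)"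
    unfolding trivial_bundle_def
    by (intro exI[of _ compact_ops])
      (simp add: subspace_compact_ops cscale_op_compact_ops complete_compact_ops)
  with iso show ?thesis ..
qed

end
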